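(* For any group $G$ we have $$ \frac16\bigl(\kappa(G)+h\bigr)\le c(G)\le 3\,(\kappa(G)-4), $$ where $h$ is the minimal number of relations over finite presentations of $G$.
   Context: All groups are finitely presentable and all simplicial complexes are finite. The simplicial complexity $\kappa(G)$ of a group $G$ is the minimal number of $2$-simplices of a simplicial $2$-complex with fundamental group $G$. The length of a finite presentation $\mathcal P=\langle a_1,\dots,a_n\mid r_1,\dots,r_m\rangle$ is $\ell(\mathcal P)=\sum_{i=1}^m|r_i|$, where $|r_i|$ is the word length of $r_i$ associated to the system of generators $\{a_1,\dots,a_n\}$. The $c$-complexity $c(G)$ is the minimal length of a finite presentation of $G$.
   Formalization: The upper bound c(G) ≤ 3(κ(G) − 4) is asserted only for groups that are not free; for a free group κ(G) = c(G) = 0, so it would read 0 ≤ −12. The lower bound is proved for every finitely presentable group. *)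

theory Defs
  imports "HOL-Analysis.Analysis" "HOL-Algebra.Generated_Groups"
begin

section \<open>Fundamental groups of finite simplicial complexes\<close>

text \<open>Loops are functions on all of \<open>real\<close>; only their restriction to \<open>{0..1}\<close> matters, and
  \<open>homotopic_paths\<close> identifies loops with the same restriction.\<close>

definition loops_at :: "'a::topological_space set \<Rightarrow> 'a \<Rightarrow> (real \<Rightarrow> 'a) set" where
  "loops_at S x = {p. path p \<and> path_image p \<subseteq> S \<and> pathstart p = x \<and> pathfinish p = x}"

definition loop_class :: "'a::topological_space set \<Rightarrow> (real \<Rightarrow> 'a) \<Rightarrow> (real \<Rightarrow> 'a) set" where
  "loop_class S p = {q. homotopic_paths S p q}"

definition fundamental_group ::
    "'a::topological_space set \<Rightarrow> 'a \<Rightarrow> (real \<Rightarrow> 'a) set monoid" where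
  "fundamental_group S x =
     \<lparr>carrier = loop_class S ` loops_at S x,
      mult = (\<lambda>A B. \<Union>p\<in>A. \<Union>q\<in>B. loop_class S (p +++ q)),
      one = loop_class S (\<lambda>_. x)\<rparr>"

text \<open>A finite abstract simplicial complex of dimension at most two. A simplex is identified with
  its (nonempty) vertex set, so the \<open>2\<close>-simplices are the faces with three elements. Complexes of
  dimension \<open>0\<close> and \<open>1\<close> are included, and faces need not lie in a \<open>2\<close>-simplex.\<close>

definition simplicial_2_complex :: "'v set set \<Rightarrow> bool" where
  "simplicial_2_complex K \<longleftrightarrow>
     finite K \<and>
     (\<forall>\<sigma>\<in>K. finite \<sigma> \<and> \<sigma> \<noteq> {} \<and> card \<sigma> \<le> 3) \<and>
     (\<forall>\<sigma>\<in>K. \<forall>\<tau>. \<tau> \<noteq> {} \<and> \<tau> \<subseteq> \<sigma> \<longrightarrow> \<tau> \<in> K)"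

definition two_simplices :: "'v set set \<Rightarrow> 'v set set" where
  "two_simplices K = {\<sigma>\<in>K. card \<sigma> = 3}"

text \<open>Barycentric coordinates, with the topology inherited from the product topology on
  functions; for a finite complex this is the usual topology.\<close>

definition geometric_realization :: "'v set set \<Rightarrow> ('v \<Rightarrow> real) set" where
  "geometric_realization K =
     {t. (\<forall>v. 0 \<le> t v) \<and> {v. t v \<noteq> 0} \<in> K \<and> (\<Sum>v\<in>{v. t v \<noteq> 0}. t v) = 1}"

text \<open>The realization is required to be path connected, so the choice of the base point is
  immaterial.\<close>

definition complex_has_fundamental_group ::
    "'v set set \<Rightarrow> ('a, 'b) monoid_scheme \<Rightarrow> bool" where
  "complex_has_fundamental_group K G \<longleftrightarrow>
     path_connected (geometric_realization K) \<and>
     (\<exists>x\<in>geometric_realization K. fundamental_group (geometric_realization K) x \<cong> G)"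

text \<open>Every finite complex is isomorphic to one whose vertices are natural numbers.\<close>

definition simplicial_complexity :: "('a, 'b) monoid_scheme \<Rightarrow> nat" where
  "simplicial_complexity G =
     (LEAST k. \<exists>K :: nat set set.
        simplicial_2_complex K \<and> complex_has_fundamental_group K G \<and> card (two_simplices K) = k)"


section \<open>Free groups and finite presentations\<close>

text \<open>The letter \<open>(x, True)\<close> stands for the generator \<open>x\<close> and \<open>(x, False)\<close> for its inverse.
  Elements of the free group are the freely reduced words, so the length of the list is the
  word length with respect to the free basis.\<close>

type_synonym 'x word = "('x \<times> bool) list"

definition inv_letter :: "'x \<times> bool \<Rightarrow> 'x \<times> bool" where
  "inv_letter a = (fst a, \<not> snd a)"

fun freely_reduced :: "'x word \<Rightarrow> bool" where
  "freely_reduced (a # b # w) \<longleftrightarrow> b \<noteq> inv_letter a \<and> freely_reduced (b # w)"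
| "freely_reduced _ \<longleftrightarrow> True"

fun push_letter :: "'x \<times> bool \<Rightarrow> 'x word \<Rightarrow> 'x word" where
  "push_letter a [] = [a]"
| "push_letter a (b # w) = (if b = inv_letter a then w else a # b # w)"

definition free_group :: "'x set \<Rightarrow> 'x word monoid" where
  "free_group B =
     \<lparr>carrier = {w. freely_reduced w \<and> fst ` set w \<subseteq> B}, mult = foldr push_letter, one = []\<rparr>"

definition normal_closure :: "('a, 'b) monoid_scheme \<Rightarrow> 'a set \<Rightarrow> 'a set" where
  "normal_closure G R =
     generate G {g \<otimes>\<^bsub>G\<^esub> r \<otimes>\<^bsub>G\<^esub> inv\<^bsub>G\<^esub> g | g r. g \<in> carrier G \<and> r \<in> R}"

text \<open>\<open>(n, rs)\<close> is the presentation with generators \<open>0, \<dots>, n - 1\<close> and relators \<open>rs\<close>. Relators may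
  be trivial or repeated, and \<open>n\<close> or the number of relators may be \<open>0\<close>.\<close>

type_synonym presentation = "nat \<times> nat word list"

definition presents :: "presentation \<Rightarrow> ('a, 'b) monoid_scheme \<Rightarrow> bool" where
  "presents P G \<longleftrightarrow>
     (let F = free_group {..<fst P}; R = set (snd P)
      in R \<subseteq> carrier F \<and> F Mod normal_closure F R \<cong> G)"

definition num_relations :: "presentation \<Rightarrow> nat" where
  "num_relations P = length (snd P)"

definition presentation_length :: "presentation \<Rightarrow> nat" where
  "presentation_length P = (\<Sum>r\<leftarrow>snd P. length r)"

definition finitely_presentable :: "('a, 'b) monoid_scheme \<Rightarrow> bool" where
  "finitely_presentable G \<longleftrightarrow> (\<exists>P. presents P G)"

definition c_complexity :: "('a, 'b) monoid_scheme \<Rightarrow> nat" where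
  "c_complexity G = (LEAST l. \<exists>P. presents P G \<and> presentation_length P = l)"

definition min_num_relations :: "('a, 'b) monoid_scheme \<Rightarrow> nat" where
  "min_num_relations G = (LEAST m. \<exists>P. presents P G \<and> num_relations P = m)"

text \<open>A basis of a free group \<open>G\<close> embeds in \<open>G\<close>, so it may be indexed by a set of the element
  type of \<open>G\<close>. The trivial group is free on the empty set. Free groups of finite
  rank are exceptional for the upper bound on the \<open>c\<close>-complexity: they are fundamental groups of
  graphs and are presented without relations, so both complexities vanish, and \<open>3 (\<kappa> - 4)\<close> is
  negative.\<close>

definition is_free_group :: "('a, 'b) monoid_scheme \<Rightarrow> bool" where
  "is_free_group G \<longleftrightarrow> (\<exists>B :: 'a set. free_group B \<cong> G)"


section \<open>The reduced words form a group\<close>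

lemma inv_letter_inv_letter [simp]: "inv_letter (inv_letter a) = a"
  by (simp add: inv_letter_def)

lemma reduced_ConsD: "freely_reduced (a # w) \<Longrightarrow> freely_reduced w"
  by (cases w) auto

lemma reduced_push_letter: "freely_reduced w \<Longrightarrow> freely_reduced (push_letter a w)"
  by (cases w) (auto dest: reduced_ConsD)

lemma push_letter_reduced: "freely_reduced (a # w) \<Longrightarrow> push_letter a w = a # w"
  by (cases w) auto

lemma push_letter_cancel: "freely_reduced w \<Longrightarrow> push_letter a (push_letter (inv_letter a) w) = w"
  by (cases w) (auto simp: push_letter_reduced)

lemma reduced_foldr_push: "freely_reduced w \<Longrightarrow> freely_reduced (foldr push_letter u w)"
  by (induction u) (auto intro: reduced_push_letter)

lemma set_push_letter: "set (push_letter a w) \<subseteq> insert a (set w)"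
  by (cases w) auto

lemma set_foldr_push: "set (foldr push_letter u w) \<subseteq> set u \<union> set w"
  using set_push_letter by (induction u) fastforce+

lemma foldr_push_Nil: "freely_reduced u \<Longrightarrow> foldr push_letter u [] = u"
proof (induction u)
  case (Cons a u)
  then have "foldr push_letter u [] = u"
    using reduced_ConsD by blast
  then show ?case
    using Cons.prems by (simp add: push_letter_reduced)
qed simp

lemma foldr_push_letter:
  assumes "freely_reduced w"
  shows "foldr push_letter (push_letter a v) w = push_letter a (foldr push_letter v w)"
  using assms push_letter_cancel[OF reduced_foldr_push[OF assms], of a] by (cases v) auto

lemma foldr_push_assoc:
  "freely_reduced w \<Longrightarrow>
   foldr push_letter (foldr push_letter u v) w = foldr push_letter u (foldr push_letter v w)"
  by (induction u) (auto simp: foldr_push_letter)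

lemma foldr_push_inverse:
  "freely_reduced v \<Longrightarrow> foldr push_letter (map inv_letter (rev u)) (foldr push_letter u v) = v"
proof (induction u arbitrary: v)
  case (Cons a u)
  have "push_letter (inv_letter a) (push_letter a x) = x" if "freely_reduced x" for x
    using push_letter_cancel[OF that, of "inv_letter a"] by simp
  then show ?case
    using Cons by (simp add: reduced_foldr_push)
qed simp

lemma group_free_group: "group (free_group B)"
proof (rule groupI)
  fix u v w assume u: "u \<in> carrier (free_group B)" and v: "v \<in> carrier (free_group B)"
    and w: "w \<in> carrier (free_group B)"
  show "u \<otimes>\<^bsub>free_group B\<^esub> v \<in> carrier (free_group B)"
    using u v set_foldr_push[of u v] by (fastforce simp: free_group_def reduced_foldr_push)
  show "u \<otimes>\<^bsub>free_group B\<^esub> v \<otimes>\<^bsub>free_group B\<^esub> w = u \<otimes>\<^bsub>free_group B\<^esub> (v \<otimes>\<^bsub>free_group B\<^esub> w)"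
    using u v w by (simp add: free_group_def foldr_push_assoc)
next
  fix u assume u: "u \<in> carrier (free_group B)"
  define v where "v = foldr push_letter (map inv_letter (rev u)) []"
  have "freely_reduced v" by (simp add: v_def reduced_foldr_push)
  moreover have "fst ` set v \<subseteq> B"
    using u set_foldr_push[of "map inv_letter (rev u)" "[]"]
    by (fastforce simp: v_def free_group_def inv_letter_def)
  moreover have "foldr push_letter v u = []"
    using u foldr_push_inverse[of "[]" u]
    by (simp add: v_def free_group_def foldr_push_assoc foldr_push_Nil)
  ultimately show "\<exists>v\<in>carrier (free_group B). v \<otimes>\<^bsub>free_group B\<^esub> u = \<one>\<^bsub>free_group B\<^esub>"
    by (intro bexI[of _ v]) (auto simp: free_group_def)
qed (auto simp: free_group_def)

end

theory Submission
  imports Defs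
begin

text \<open>The fundamental group of a connected complex is computed without simplicial approximation of
  homotopies. By subdividing a path along the open stars of the vertices, the classes of the edges,
  closed up along a maximal tree, generate the fundamental group. Conversely, every function \<open>\<phi>\<close> on
  the oriented edges with values in a group \<open>H\<close> that satisfies the triangle relations defines a
  covering with fibre \<open>H\<close>; its holonomy depends continuously, hence not at all, on a homotopy
  parameter, and extends \<open>\<phi>\<close> to a homomorphism. Edges modulo the tree and the triangles therefore
  present the fundamental group.

  Upper bound: in a complex with the minimal number \<open>\<kappa>\<close> of triangles no edge lies in exactly one
  triangle, since such an edge could be collapsed. If \<open>\<kappa> \<noteq> 0\<close>, take a vertex \<open>b\<close> of a triangle and a
  maximal tree containing all edges at \<open>b\<close>. All edges of triangles at \<open>b\<close> become trivial. There are
  at least three such triangles, which save \<open>9\<close> letters, and at least three edges opposite to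
  \<open>b\<close>, each of which occurs in a further triangle, which saves \<open>3\<close> more of the \<open>3 \<kappa>\<close> letters.

  Lower bound: subdivide every generator into three edges and fill a relator of length \<open>k\<close> by a
  triangulated disc with at most \<open>6 k - 1\<close> triangles.\<close>

section \<open>The fundamental group\<close>

text \<open>No covering space, quotient complex or van Kampen theorem is built. The single working
  notion is the \<open>cocycle\<close>, a labelling of oriented edges by group elements that is
  multiplicative on each simplex. Edge classes are a cocycle with values in the fundamental group,
  they generate it, and every cocycle that is trivial on the tree factors through them. This
  universal property carries the rest: invariance under a collapse, the presentation of a complex
  and the complex of a presentation all reduce to exhibiting cocycles and comparing homomorphisms on
  generators.

  Subdividing a path, lifting it, stability of transport and homotopy invariance are each proved by
  bisection with \<open>Bolzano\<close>, so that only a piece inside a single open star has to be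
  understood.

  In the lower bound a generator becomes three edges because no shorter cycle is simplicial, and the
  estimate 6 k - 1 instead of 6 k leaves one unit per relator: their sum is what turns into
  \<open>h\<close>.\<close>

lemma homotopic_paths_convex_image:
  fixes F :: "'c::real_normed_vector \<Rightarrow> 'a::topological_space"
  assumes F: "continuous_on C F" "F \<in> C \<rightarrow> S" and C: "convex C"
    and g: "path g" "path_image g \<subseteq> C" and h: "path h" "path_image h \<subseteq> C"
    and ends: "pathstart h = pathstart g" "pathfinish h = pathfinish g"
  shows "homotopic_paths S (F \<circ> g) (F \<circ> h)"
proof (rule homotopic_paths_continuous_image[OF _ F])
  show "homotopic_paths C g h"
  proof (rule homotopic_paths_linear)
    fix t :: real assume "t \<in> {0..1}"
    then have "g t \<in> C" "h t \<in> C"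
      using g h by (auto simp: path_image_def)
    then show "closed_segment (g t) (h t) \<subseteq> C"
      using C by (simp add: closed_segment_subset)
  qed (use g h ends in auto)
qed

text \<open>Parameter paths with common ends are joined linearly inside the unit interval, so every
  change of parametrization of \<open>p\<close>, including running back and forth, is covered at
  once.\<close>

lemma homotopic_paths_interval:
  fixes p :: "real \<Rightarrow> 'a::topological_space"
  assumes p: "path p" "path_image p \<subseteq> S"
    and g: "path g" "path_image g \<subseteq> {0..1}" and h: "path h" "path_image h \<subseteq> {0..1}"
    and ends: "pathstart h = pathstart g" "pathfinish h = pathfinish g"
  shows "homotopic_paths S (p \<circ> g) (p \<circ> h)"
  by (rule homotopic_paths_convex_image[where C = "{0..1::real}"])
     (use assms in \<open>auto simp: path_def path_image_def\<close>)

lemma path_image_linepath_Icc: "a \<in> {0..1} \<Longrightarrow> b \<in> {0..1} \<Longrightarrow> path_image (linepath a b) \<subseteq> {0..1::real}"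
  by (auto simp: closed_segment_eq_real_ivl split: if_splits)

lemma path_interval:
  assumes "path p" "a \<in> {0..1}" "b \<in> {0..1}"
  shows "path (p \<circ> linepath a (b::real))" "path_image (p \<circ> linepath a b) \<subseteq> path_image p"
proof -
  have "path_image (linepath a b) \<subseteq> {0..1}"
    using assms path_image_linepath_Icc by blast
  then show "path (p \<circ> linepath a b)" "path_image (p \<circ> linepath a b) \<subseteq> path_image p"
    using assms(1) continuous_on_compose[of "{0..1}" "linepath a b" p]
    by (auto simp: path_def path_image_def image_comp[symmetric] intro: continuous_on_subset)
qed

lemma comp_linepath_01: "p \<circ> linepath 0 1 = p" "p \<circ> linepath 1 0 = reversepath p"
  by (auto simp: fun_eq_iff linepath_def reversepath_def)

lemma comp_linepath_same: "p \<circ> linepath a a = (\<lambda>_. p a)"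
  by (auto simp: fun_eq_iff linepath_def)

text \<open>The points \<open>a\<close>, \<open>b\<close>, \<open>c\<close> may come in any order: 0
  0 1 and 0 1 1 give the unit laws that follow, 0 1 0 and 1 0 1 the inverse laws.\<close>

lemma homotopic_paths_join_interval:
  fixes p :: "real \<Rightarrow> 'a::topological_space"
  assumes p: "path p" "path_image p \<subseteq> S" and "a \<in> {0..1}" "b \<in> {0..1}" "c \<in> {0..1}"
  shows "homotopic_paths S ((p \<circ> linepath a b) +++ (p \<circ> linepath b c)) (p \<circ> linepath a c)"
  unfolding path_compose_join[symmetric]
  by (intro homotopic_paths_interval assms subset_path_image_join path_image_linepath_Icc) simp_all

lemma homotopic_paths_const_left:
  assumes "path p" "path_image p \<subseteq> S" "pathstart p = a"
  shows "homotopic_paths S ((\<lambda>_. a) +++ p) p"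
  using homotopic_paths_join_interval[OF assms(1,2), of 0 0 1] assms(3)
  by (simp add: comp_linepath_01 comp_linepath_same pathstart_def)

lemma homotopic_paths_const_right:
  assumes "path p" "path_image p \<subseteq> S" "pathfinish p = a"
  shows "homotopic_paths S (p +++ (\<lambda>_. a)) p"
  using homotopic_paths_join_interval[OF assms(1,2), of 0 1 1] assms(3)
  by (simp add: comp_linepath_01 comp_linepath_same pathfinish_def)

lemma homotopic_paths_rinv_const:
  assumes "path p" "path_image p \<subseteq> S" "pathstart p = a"
  shows "homotopic_paths S (p +++ reversepath p) (\<lambda>_. a)"
  using homotopic_paths_join_interval[OF assms(1,2), of 0 1 0] assms(3)
  by (simp add: comp_linepath_01 comp_linepath_same pathstart_def)

lemma homotopic_paths_linv_const:
  assumes "path p" "path_image p \<subseteq> S" "pathfinish p = a"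
  shows "homotopic_paths S (reversepath p +++ p) (\<lambda>_. a)"
  using homotopic_paths_join_interval[OF assms(1,2), of 1 0 1] assms(3)
  by (simp add: comp_linepath_01 comp_linepath_same pathfinish_def)

lemma path_const: "path (\<lambda>_. a)" "path_image (\<lambda>_. a) = {a}" "pathstart (\<lambda>_. a) = a" "pathfinish (\<lambda>_. a) = a"
  by (auto simp: path_def path_image_def pathstart_def pathfinish_def)

lemma loop_class_eqI: "homotopic_paths S p q \<Longrightarrow> loop_class S p = loop_class S q"
  unfolding loop_class_def using homotopic_paths_trans homotopic_paths_sym by blast

lemma loop_class_eq_iff:
  assumes "path p" "path_image p \<subseteq> S"
  shows "loop_class S p = loop_class S q \<longleftrightarrow> homotopic_paths S p q"
proof
  assume "loop_class S p = loop_class S q"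
  moreover have "p \<in> loop_class S p"
    using assms by (simp add: loop_class_def)
  ultimately show "homotopic_paths S p q"
    by (simp add: loop_class_def homotopic_paths_sym)
next
  assume "homotopic_paths S p q"
  then show "loop_class S p = loop_class S q"
    by (rule loop_class_eqI)
qed

lemma loops_at_join: "p \<in> loops_at S x \<Longrightarrow> q \<in> loops_at S x \<Longrightarrow> p +++ q \<in> loops_at S x"
  unfolding loops_at_def by (simp add: path_image_join)

lemma fundamental_group_simps:
  "carrier (fundamental_group S x) = loop_class S ` loops_at S x"
  "\<one>\<^bsub>fundamental_group S x\<^esub> = loop_class S (\<lambda>_. x)"
  by (simp_all add: fundamental_group_def)

text \<open>The product is a union over all pairs of representatives. Joining respects homotopy, so
  all members of the union coincide, and the union is not empty because each class contains its
  representative.\<close>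

lemma fundamental_group_mult:
  assumes p: "p \<in> loops_at S x" and q: "q \<in> loops_at S x"
  shows "loop_class S p \<otimes>\<^bsub>fundamental_group S x\<^esub> loop_class S q = loop_class S (p +++ q)"
proof -
  have *: "loop_class S (p' +++ q') = loop_class S (p +++ q)"
    if "p' \<in> loop_class S p" "q' \<in> loop_class S q" for p' q'
    using that p q
    by (intro loop_class_eqI homotopic_paths_sym[OF homotopic_paths_join])
       (auto simp: loop_class_def loops_at_def)
  have "(\<Union>p'\<in>loop_class S p. \<Union>q'\<in>loop_class S q. loop_class S (p' +++ q')) =
      (\<Union>p'\<in>loop_class S p. \<Union>q'\<in>loop_class S q. loop_class S (p +++ q))"
    by (intro SUP_cong refl *)
  also have "\<dots> = loop_class S (p +++ q)"
  proof -
    have "p \<in> loop_class S p" "q \<in> loop_class S q"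
      using p q by (auto simp: loop_class_def loops_at_def)
    then have "loop_class S p \<noteq> {}" "loop_class S q \<noteq> {}"
      by blast+
    then show ?thesis by simp
  qed
  finally show ?thesis
    by (simp add: fundamental_group_def)
qed

lemma group_fundamental_group:
  assumes x: "x \<in> S"
  shows "group (fundamental_group S x)"
proof (rule groupI)
  let ?G = "fundamental_group S x"
  have const: "(\<lambda>_. x) \<in> loops_at S x"
    using x by (auto simp: loops_at_def path_const)
  then show "\<one>\<^bsub>?G\<^esub> \<in> carrier ?G"
    by (auto simp: fundamental_group_simps)
  fix A assume "A \<in> carrier ?G"
  then obtain p where p: "A = loop_class S p" "p \<in> loops_at S x"
    by (auto simp: fundamental_group_simps)
  then show "\<one>\<^bsub>?G\<^esub> \<otimes>\<^bsub>?G\<^esub> A = A"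
    using fundamental_group_mult[OF const p(2)] homotopic_paths_const_left[of p S x]
    by (auto simp: fundamental_group_simps loops_at_def intro!: loop_class_eqI)
  have "reversepath p \<in> loops_at S x"
    using p by (auto simp: loops_at_def)
  then have "loop_class S (reversepath p) \<otimes>\<^bsub>?G\<^esub> A = \<one>\<^bsub>?G\<^esub>"
    using fundamental_group_mult[of "reversepath p" S x p] homotopic_paths_linv_const[of p S x] p
    by (auto simp: fundamental_group_simps loops_at_def intro!: loop_class_eqI)
  then show "\<exists>B\<in>carrier ?G. B \<otimes>\<^bsub>?G\<^esub> A = \<one>\<^bsub>?G\<^esub>"
    using \<open>reversepath p \<in> loops_at S x\<close> by (auto simp: fundamental_group_simps)
  fix B assume "B \<in> carrier ?G"
  then obtain q where q: "B = loop_class S q" "q \<in> loops_at S x"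
    by (auto simp: fundamental_group_simps)
  then show "A \<otimes>\<^bsub>?G\<^esub> B \<in> carrier ?G"
    using p fundamental_group_mult[of p S x q] loops_at_join
    by (fastforce simp: fundamental_group_simps)
  fix C assume "C \<in> carrier ?G"
  then obtain r where r: "C = loop_class S r" "r \<in> loops_at S x"
    by (auto simp: fundamental_group_simps)
  have "loop_class S ((p +++ q) +++ r) = loop_class S (p +++ (q +++ r))"
    using p q r by (intro loop_class_eqI homotopic_paths_sym[OF homotopic_paths_assoc])
      (auto simp: loops_at_def)
  then show "A \<otimes>\<^bsub>?G\<^esub> B \<otimes>\<^bsub>?G\<^esub> C = A \<otimes>\<^bsub>?G\<^esub> (B \<otimes>\<^bsub>?G\<^esub> C)"
    using p q r by (simp add: fundamental_group_mult loops_at_join)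
qed

text \<open>Closing up a path by fixed reference paths from the base point turns the fundamental
  groupoid into elements of the fundamental group.\<close>

locale base_paths =
  fixes S :: "'a::topological_space set" and x :: 'a
  assumes pc: "path_connected S" and x_in: "x \<in> S"
begin

abbreviation "\<pi> \<equiv> fundamental_group S x"

text \<open>At the base point the path is fixed to be constant, so that closing up a loop at
  \<open>x\<close> returns the class of that loop and not a conjugate.\<close>

definition ref_path :: "'a \<Rightarrow> real \<Rightarrow> 'a" where
  "ref_path y = (if y = x then (\<lambda>_. x) else
     (SOME g. path g \<and> path_image g \<subseteq> S \<and> pathstart g = x \<and> pathfinish g = y))"

definition closed_up :: "(real \<Rightarrow> 'a) \<Rightarrow> (real \<Rightarrow> 'a) set" where
  "closed_up p = loop_class S (ref_path (pathstart p) +++ p +++ reversepath (ref_path (pathfinish p)))"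

lemma group_\<pi>: "group \<pi>"
  using group_fundamental_group[OF x_in] .

lemma ref_path:
  assumes "y \<in> S"
  shows "path (ref_path y)" "path_image (ref_path y) \<subseteq> S" "pathstart (ref_path y) = x" "pathfinish (ref_path y) = y"
proof -
  have "\<exists>g. path g \<and> path_image g \<subseteq> S \<and> pathstart g = x \<and> pathfinish g = y"
    using pc x_in assms unfolding path_connected_def by blast
  from someI_ex[OF this]
  show "path (ref_path y)" "path_image (ref_path y) \<subseteq> S" "pathstart (ref_path y) = x" "pathfinish (ref_path y) = y"
    using x_in by (auto simp: ref_path_def path_const)
qed

lemma endpoints_in: "path_image p \<subseteq> S \<Longrightarrow> pathstart p \<in> S" "path_image p \<subseteq> S \<Longrightarrow> pathfinish p \<in> S"
  by auto

lemma closed_up_loops: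
  assumes "path p" "path_image p \<subseteq> S"
  shows "ref_path (pathstart p) +++ p +++ reversepath (ref_path (pathfinish p)) \<in> loops_at S x"
  using assms ref_path[OF endpoints_in(1)[OF assms(2)]] ref_path[OF endpoints_in(2)[OF assms(2)]]
  by (simp add: loops_at_def path_image_join)

lemma closed_up_carrier [simp]: "path p \<Longrightarrow> path_image p \<subseteq> S \<Longrightarrow> closed_up p \<in> carrier \<pi>"
  by (simp add: closed_up_def fundamental_group_simps closed_up_loops)

lemma closed_up_homotopic:
  assumes "homotopic_paths S p q"
  shows "closed_up p = closed_up q"
proof -
  have pq: "path p" "path_image p \<subseteq> S" "pathstart p = pathstart q" "pathfinish p = pathfinish q"
    using assms homotopic_paths_imp_path homotopic_paths_imp_subset homotopic_paths_imp_pathstart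
      homotopic_paths_imp_pathfinish by blast+
  note r = ref_path[OF endpoints_in(1)[OF pq(2)]] ref_path[OF endpoints_in(2)[OF pq(2)]]
  show ?thesis
    unfolding closed_up_def pq(3,4)[symmetric]
    using r by (intro loop_class_eqI homotopic_paths_join assms) (auto simp: pq)
qed

lemma closed_up_loop:
  assumes "p \<in> loops_at S x"
  shows "closed_up p = loop_class S p"
proof -
  have p: "path p" "path_image p \<subseteq> S" "pathstart p = x" "pathfinish p = x"
    using assms by (auto simp: loops_at_def)
  have r: "ref_path x = (\<lambda>_. x)" "reversepath (\<lambda>_. x) = (\<lambda>_. x)"
    by (auto simp: ref_path_def reversepath_def)
  have "homotopic_paths S ((\<lambda>_. x) +++ p +++ (\<lambda>_. x)) ((\<lambda>_. x) +++ p)"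
    using p x_in by (intro homotopic_paths_join homotopic_paths_const_right) (auto simp: path_const)
  also have "homotopic_paths S ((\<lambda>_. x) +++ p) p"
    using p by (intro homotopic_paths_const_left) auto
  finally show ?thesis
    unfolding closed_up_def p r by (rule loop_class_eqI)
qed

lemma closed_up_join:
  assumes p: "path p" "path_image p \<subseteq> S" and q: "path q" "path_image q \<subseteq> S"
    and pq: "pathfinish p = pathstart q"
  shows "closed_up (p +++ q) = closed_up p \<otimes>\<^bsub>\<pi>\<^esub> closed_up q"
proof -
  define a where "a = ref_path (pathstart p)"
  define b where "b = ref_path (pathstart q)"
  define c where "c = ref_path (pathfinish q)"
  have a: "path a" "path_image a \<subseteq> S" "pathstart a = x" "pathfinish a = pathstart p"
    unfolding a_def using ref_path[OF endpoints_in(1)[OF p(2)]] by auto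
  have b: "path b" "path_image b \<subseteq> S" "pathstart b = x" "pathfinish b = pathstart q"
    unfolding b_def using ref_path[OF endpoints_in(1)[OF q(2)]] by auto
  have c: "path c" "path_image c \<subseteq> S" "pathstart c = x" "pathfinish c = pathfinish q"
    unfolding c_def using ref_path[OF endpoints_in(2)[OF q(2)]] by auto
  note [simp] = a b c p q pq path_image_join
  let ?h = "homotopic_paths S"
  have 1: "?h (reversepath b +++ (b +++ (q +++ reversepath c))) ((reversepath b +++ b) +++ (q +++ reversepath c))"
    by (intro homotopic_paths_assoc) auto
  have 2: "?h ((reversepath b +++ b) +++ (q +++ reversepath c)) ((\<lambda>_. pathstart q) +++ (q +++ reversepath c))"
    by (intro homotopic_paths_join homotopic_paths_linv_const) auto
  have 3: "?h ((\<lambda>_. pathstart q) +++ (q +++ reversepath c)) (q +++ reversepath c)"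
    by (intro homotopic_paths_const_left) auto
  have R: "?h (reversepath b +++ (b +++ (q +++ reversepath c))) (q +++ reversepath c)"
    using 1 2 3 homotopic_paths_trans by blast
  have "?h ((a +++ (p +++ reversepath b)) +++ (b +++ (q +++ reversepath c)))
           (a +++ ((p +++ reversepath b) +++ (b +++ (q +++ reversepath c))))"
    by (intro homotopic_paths_sym[OF homotopic_paths_assoc]) auto
  also have "?h (a +++ ((p +++ reversepath b) +++ (b +++ (q +++ reversepath c))))
           (a +++ (p +++ (reversepath b +++ (b +++ (q +++ reversepath c)))))"
    by (intro homotopic_paths_join homotopic_paths_sym[OF homotopic_paths_assoc]) auto
  also have "?h (a +++ (p +++ (reversepath b +++ (b +++ (q +++ reversepath c)))))
           (a +++ (p +++ (q +++ reversepath c)))"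
    by (intro homotopic_paths_join R) auto
  also have "?h (a +++ (p +++ (q +++ reversepath c))) (a +++ ((p +++ q) +++ reversepath c))"
    by (intro homotopic_paths_join homotopic_paths_assoc) auto
  finally have "loop_class S ((a +++ (p +++ reversepath b)) +++ (b +++ (q +++ reversepath c)))
      = loop_class S (a +++ ((p +++ q) +++ reversepath c))"
    by (rule loop_class_eqI)
  then show ?thesis
    using fundamental_group_mult[OF closed_up_loops[OF p] closed_up_loops[OF q]]
    by (simp add: closed_up_def a_def b_def c_def)
qed

lemma closed_up_const:
  assumes "y \<in> S"
  shows "closed_up (\<lambda>_. y) = \<one>\<^bsub>\<pi>\<^esub>"
proof -
  interpret group \<pi> by (rule group_\<pi>)
  \<comment> \<open>A constant path joined to itself is homotopic to itself, so its class is
    idempotent, and the only idempotent of a group is the unit.\<close>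
  have "closed_up ((\<lambda>_. y) +++ (\<lambda>_. y)) = closed_up (\<lambda>_. y)"
    using assms by (intro closed_up_homotopic homotopic_paths_const_left) (auto simp: path_const)
  then have "closed_up (\<lambda>_. y) \<otimes>\<^bsub>\<pi>\<^esub> closed_up (\<lambda>_. y) = closed_up (\<lambda>_. y)"
    using assms closed_up_join[of "\<lambda>_. y" "\<lambda>_. y"] by (auto simp: path_const)
  then show ?thesis
    using assms by (simp add: path_const r_cancel_one)
qed

lemma closed_up_interval:
  assumes p: "path p" "path_image p \<subseteq> S" and "a \<in> {0..1}" "b \<in> {0..1}" "c \<in> {0..1}"
  shows "closed_up (p \<circ> linepath a b) \<otimes>\<^bsub>\<pi>\<^esub> closed_up (p \<circ> linepath b c) = closed_up (p \<circ> linepath a c)"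
proof -
  have "closed_up (p \<circ> linepath a b) \<otimes>\<^bsub>\<pi>\<^esub> closed_up (p \<circ> linepath b c) =
      closed_up ((p \<circ> linepath a b) +++ (p \<circ> linepath b c))"
    using path_interval[OF p(1) assms(3,4)] path_interval[OF p(1) assms(4,5)] p(2)
    by (intro closed_up_join[symmetric]) (auto simp: pathfinish_compose pathstart_compose)
  also have "\<dots> = closed_up (p \<circ> linepath a c)"
    by (intro closed_up_homotopic homotopic_paths_join_interval assms)
  finally show ?thesis .
qed

end

section \<open>Edge classes generate the fundamental group of a complex\<close>

definition vertex_point :: "'v \<Rightarrow> 'v \<Rightarrow> real" where
  "vertex_point v = (\<lambda>w. if w = v then 1 else 0)"

definition segment :: "('v \<Rightarrow> real) \<Rightarrow> ('v \<Rightarrow> real) \<Rightarrow> real \<Rightarrow> 'v \<Rightarrow> real" where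
  "segment y z s = (\<lambda>v. (1 - s) * y v + s * z v)"

definition cell :: "'v set \<Rightarrow> ('v \<Rightarrow> real) set" where
  "cell \<sigma> = {t. (\<forall>v. 0 \<le> t v) \<and> (\<forall>v. v \<notin> \<sigma> \<longrightarrow> t v = 0) \<and> (\<Sum>v\<in>\<sigma>. t v) = 1}"

text \<open>A 1-cocycle with coefficients in a possibly nonabelian group. Triples with repeated
  vertices are included; they force \<open>\<phi> u u\<close> to be the unit and
  \<open>\<phi> v u\<close> to be inverse to \<open>\<phi> u v\<close>.\<close>

definition cocycle :: "'v set set \<Rightarrow> ('a, 'c) monoid_scheme \<Rightarrow> ('v \<Rightarrow> 'v \<Rightarrow> 'a) \<Rightarrow> bool" where
  "cocycle K G \<phi> \<longleftrightarrow>
     (\<forall>\<sigma>\<in>K. \<forall>u\<in>\<sigma>. \<forall>v\<in>\<sigma>. \<phi> u v \<in> carrier G \<and> (\<forall>w\<in>\<sigma>. \<phi> u v \<otimes>\<^bsub>G\<^esub> \<phi> v w = \<phi> u w))"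

lemma (in group) inv_cancel:
  assumes "g \<in> carrier G" "h \<in> carrier G"
  shows "inv g \<otimes> (g \<otimes> h) = h" "g \<otimes> (inv g \<otimes> h) = h"
  using assms by (simp_all add: m_assoc[symmetric])

lemma (in group) conj_telescope:
  assumes "t \<in> carrier G" "t' \<in> carrier G" "t'' \<in> carrier G" "g \<in> carrier G" "h \<in> carrier G"
  shows "(t \<otimes> g \<otimes> inv t') \<otimes> (t' \<otimes> h \<otimes> inv t'') = t \<otimes> (g \<otimes> h) \<otimes> inv t''"
  using assms by (simp add: m_assoc inv_cancel)

lemma cocycleD:
  assumes "cocycle K G \<phi>" "\<sigma> \<in> K" "u \<in> \<sigma>" "v \<in> \<sigma>"
  shows "\<phi> u v \<in> carrier G" "w \<in> \<sigma> \<Longrightarrow> \<phi> u v \<otimes>\<^bsub>G\<^esub> \<phi> v w = \<phi> u w"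
  using assms by (auto simp: cocycle_def)

lemma cocycle_same:
  assumes "cocycle K G \<phi>" "group G" "{u} \<in> K"
  shows "\<phi> u u = \<one>\<^bsub>G\<^esub>"
  using cocycleD[OF assms(1,3), of u u] assms(2) by (simp add: group.r_cancel_one)

lemma vertex_point_cell: "v \<in> \<sigma> \<Longrightarrow> finite \<sigma> \<Longrightarrow> vertex_point v \<in> cell \<sigma>"
  by (auto simp: cell_def vertex_point_def sum.delta)

lemma vertex_point_nz [simp]: "vertex_point v w \<noteq> 0 \<longleftrightarrow> w = v" "vertex_point v w = 0 \<longleftrightarrow> w \<noteq> v"
  by (auto simp: vertex_point_def)

lemma segment_cell:
  assumes "y \<in> cell \<sigma>" "z \<in> cell \<sigma>" "0 \<le> s" "s \<le> 1"
  shows "segment y z s \<in> cell \<sigma>"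
  using assms by (auto simp: cell_def segment_def sum.distrib sum_distrib_left[symmetric])

lemma path_segment: "path (segment y z)"
  unfolding path_def segment_def by (intro continuous_intros)

lemma segment_ends [simp]:
  "pathstart (segment y z) = y" "pathfinish (segment y z) = z" "segment y z 0 = y" "segment y z 1 = z"
  by (auto simp: pathstart_def pathfinish_def segment_def)

locale two_complex =
  fixes K :: "'v set set"
  assumes K: "simplicial_2_complex K"
begin

abbreviation "\<R> \<equiv> geometric_realization K"

lemma finite_face: "\<sigma> \<in> K \<Longrightarrow> finite \<sigma>" and nonempty_face: "\<sigma> \<in> K \<Longrightarrow> \<sigma> \<noteq> {}"
  and face: "\<sigma> \<in> K \<Longrightarrow> \<tau> \<subseteq> \<sigma> \<Longrightarrow> \<tau> \<noteq> {} \<Longrightarrow> \<tau> \<in> K"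
  using K unfolding simplicial_2_complex_def by blast+

lemma in_vertex: "\<sigma> \<in> K \<Longrightarrow> u \<in> \<sigma> \<Longrightarrow> {u} \<in> K"
  using face[of \<sigma> "{u}"] by auto

lemma cell_realization: "\<sigma> \<in> K \<Longrightarrow> cell \<sigma> \<subseteq> \<R>"
proof
  fix t assume \<sigma>: "\<sigma> \<in> K" and t: "t \<in> cell \<sigma>"
  let ?\<tau> = "{v. t v \<noteq> 0}"
  have sub: "?\<tau> \<subseteq> \<sigma>"
    using t by (auto simp: cell_def)
  have "(\<Sum>v\<in>?\<tau>. t v) = (\<Sum>v\<in>\<sigma>. t v)"
    using sub finite_face[OF \<sigma>] by (intro sum.mono_neutral_left) auto
  then have 1: "(\<Sum>v\<in>?\<tau>. t v) = 1"
    using t by (simp add: cell_def)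
  then have "?\<tau> \<noteq> {}"
    by (metis sum.empty zero_neq_one)
  then show "t \<in> \<R>"
    using face[OF \<sigma> sub] 1 t by (auto simp: geometric_realization_def cell_def)
qed

lemma support_cell: "t \<in> \<R> \<Longrightarrow> {v. t v \<noteq> 0} \<in> K" "t \<in> \<R> \<Longrightarrow> t \<in> cell {v. t v \<noteq> 0}"
  by (auto simp: geometric_realization_def cell_def)

lemma support_vertex: "t \<in> \<R> \<Longrightarrow> t v \<noteq> 0 \<Longrightarrow> {v} \<in> K"
  using face[OF support_cell(1), of t "{v}"] by auto

lemma support_edge: "t \<in> \<R> \<Longrightarrow> t u \<noteq> 0 \<Longrightarrow> t v \<noteq> 0 \<Longrightarrow> {u, v} \<in> K"
  using face[OF support_cell(1), of t "{u, v}"] by auto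

lemma support_nonempty: "t \<in> \<R> \<Longrightarrow> \<exists>v. t v \<noteq> 0"
  using nonempty_face[OF support_cell(1), of t] by auto

lemma vertex_point_realization: "{v} \<in> K \<Longrightarrow> vertex_point v \<in> \<R>"
  by (rule subsetD[OF cell_realization vertex_point_cell[of v "{v}"]]) auto

lemma segment_image: "\<sigma> \<in> K \<Longrightarrow> y \<in> cell \<sigma> \<Longrightarrow> z \<in> cell \<sigma> \<Longrightarrow> path_image (segment y z) \<subseteq> \<R>"
  by (auto simp: path_image_def intro!: subsetD[OF cell_realization] segment_cell)

lemma segment_vertex: 
  assumes "t \<in> \<R>" "t v \<noteq> 0" "0 \<le> s" "s \<le> 1"
  shows "segment t (vertex_point v) s \<in> \<R>" "segment (vertex_point v) t s \<in> \<R>"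
proof -
  note s = support_cell[OF assms(1)]
  have "vertex_point v \<in> cell {v. t v \<noteq> 0}"
    using assms(2) finite_face[OF s(1)] by (intro vertex_point_cell) auto
  then show "segment t (vertex_point v) s \<in> \<R>" "segment (vertex_point v) t s \<in> \<R>"
    using segment_cell s(2) assms(3,4) by (auto intro!: subsetD[OF cell_realization[OF s(1)]])
qed

text \<open>The points with nonzero coordinate at \<open>u\<close> form the open star of
  \<open>u\<close>, and coordinates vary continuously along a path. This is the local step for every
  bisection along a single path.\<close>

lemma star_nhd:
  assumes p: "path p" "path_image p \<subseteq> \<R>" and r: "r \<in> {0..1}"
  obtains u d where "d > 0" "p r u \<noteq> 0" "\<And>s. s \<in> {0..1} \<Longrightarrow> \<bar>s - r\<bar> < d \<Longrightarrow> p s u \<noteq> 0"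
proof -
  have "p r \<in> \<R>"
    using p r by (auto simp: path_image_def)
  then obtain u where u: "p r u \<noteq> 0"
    using support_nonempty by blast
  have "continuous_on {0..1} (\<lambda>s. p s u)"
    using p(1) by (auto simp: path_def intro: continuous_on_product_then_coordinatewise)
  then obtain d where d: "d > 0" "\<And>s. s \<in> {0..1} \<Longrightarrow> dist s r < d \<Longrightarrow> dist (p s u) (p r u) < \<bar>p r u\<bar>"
    using r u unfolding continuous_on_iff by (metis zero_less_abs_iff)
  then have "p s u \<noteq> 0" if "s \<in> {0..1}" "\<bar>s - r\<bar> < d" for s
    using d(2)[OF that(1)] that(2) by (auto simp: dist_real_def)
  with d(1) u that show ?thesis by blast
qed

end

text \<open>A maximal tree with root \<open>b\<close>, encoded by parents; the rank drops by one at
  each step and makes induction towards the root possible. The base point \<open>x\<close> is an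
  arbitrary point of the realization and need not be a vertex, since the notion of a complex having
  a given fundamental group allows any point.\<close>

locale rooted_complex = two_complex K for K :: "'v set set" +
  fixes x :: "'v \<Rightarrow> real" and b :: 'v and par :: "'v \<Rightarrow> 'v" and rk :: "'v \<Rightarrow> nat"
  assumes x: "x \<in> geometric_realization K" and root: "{b} \<in> K" "rk b = 0"
    and par: "{v} \<in> K \<Longrightarrow> v \<noteq> b \<Longrightarrow> {par v, v} \<in> K \<and> rk v = Suc (rk (par v))"
begin

lemma par_vertex: "{v} \<in> K \<Longrightarrow> v \<noteq> b \<Longrightarrow> {par v} \<in> K"
  using face[of "{par v, v}" "{par v}"] par by auto

lemma path_connected_realization: "path_connected \<R>"
proof -
  have seg: "path_component \<R> y z" if "\<sigma> \<in> K" "y \<in> cell \<sigma>" "z \<in> cell \<sigma>" for \<sigma> y z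
    unfolding path_component_def using segment_image[OF that] path_segment segment_ends by blast
  have vtx: "path_component \<R> (vertex_point b) (vertex_point v)" if "{v} \<in> K" "rk v = n" for v n
    using that
  proof (induction n arbitrary: v)
    case 0
    then have "v = b" using par by fastforce
    then show ?case
      using vertex_point_realization[OF root(1)] by (simp add: path_component_refl)
  next
    case (Suc n)
    then have "v \<noteq> b" using root by auto
    then have *: "{par v, v} \<in> K" "rk (par v) = n" "{par v} \<in> K"
      using par[of v] par_vertex[of v] Suc.prems by auto
    have "path_component \<R> (vertex_point (par v)) (vertex_point v)"
      by (rule seg[OF *(1)]) (auto intro: vertex_point_cell)
    with Suc.IH[OF *(3,2)] show ?case by (rule path_component_trans)
  qed
  have "path_component \<R> (vertex_point b) y" if y: "y \<in> \<R>" for y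
  proof -
    obtain v where v: "y v \<noteq> 0" using support_nonempty[OF y] by blast
    have "path_component \<R> (vertex_point v) y"
      using v finite_face[OF support_cell(1)[OF y]]
      by (intro seg[OF support_cell(1)[OF y] _ support_cell(2)[OF y]] vertex_point_cell) auto
    with vtx[OF support_vertex[OF y v] refl] show ?thesis by (rule path_component_trans)
  qed
  then show ?thesis
    unfolding path_connected_component by (meson path_component_sym path_component_trans)
qed

sublocale base_paths "geometric_realization K" x
  by unfold_locales (use path_connected_realization x in auto)

sublocale P: group \<pi>
  by (rule group_\<pi>)

definition seg_class :: "('v \<Rightarrow> real) \<Rightarrow> ('v \<Rightarrow> real) \<Rightarrow> (real \<Rightarrow> 'v \<Rightarrow> real) set" where
  "seg_class y z = closed_up (segment y z)"

lemma seg_class_carrier: "\<sigma> \<in> K \<Longrightarrow> y \<in> cell \<sigma> \<Longrightarrow> z \<in> cell \<sigma> \<Longrightarrow> seg_class y z \<in> carrier \<pi>"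
  unfolding seg_class_def by (intro closed_up_carrier path_segment segment_image)

text \<open>The cell is convex: the affine map \<open>F\<close> sends the standard triangle to the
  one spanned by \<open>y\<close>, \<open>z\<close>, \<open>w\<close>, degenerate or not, and two of
  its sides are homotopic to the third. This is the source of all triangle relations.\<close>

lemma seg_class_trans:
  assumes \<sigma>: "\<sigma> \<in> K" and cells: "y \<in> cell \<sigma>" "z \<in> cell \<sigma>" "w \<in> cell \<sigma>"
  shows "seg_class y z \<otimes>\<^bsub>\<pi>\<^esub> seg_class z w = seg_class y w"
proof -
  define F :: "real \<times> real \<Rightarrow> 'v \<Rightarrow> real"
    where "F c = (\<lambda>v. y v + fst c * (z v - y v) + snd c * (w v - y v))" for c
  define C :: "(real \<times> real) set" where "C = {c. 0 \<le> fst c} \<inter> {c. 0 \<le> snd c} \<inter> {c. fst c + snd c \<le> 1}"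
  have C: "convex C"
  proof -
    have 1: "{c::real \<times> real. 0 \<le> fst c} = {c. inner (1,0) c \<ge> 0}"
      "{c::real \<times> real. 0 \<le> snd c} = {c. inner (0,1) c \<ge> 0}"
      "{c::real \<times> real. fst c + snd c \<le> 1} = {c. inner (1,1) c \<le> 1}"
      by (auto simp: inner_prod_def)
    show ?thesis
      unfolding C_def 1 by (intro convex_Int convex_halfspace_ge convex_halfspace_le)
  qed
  have F: "F \<in> C \<rightarrow> \<R>"
  proof
    fix c assume c: "c \<in> C"
    have "F c v = (1 - fst c - snd c) * y v + fst c * z v + snd c * w v" for v
      by (simp add: F_def algebra_simps)
    then have "F c \<in> cell \<sigma>"
      using c cells by (auto simp: cell_def C_def sum.distrib sum_distrib_left[symmetric])
    then show "F c \<in> \<R>" using cell_realization[OF \<sigma>] by auto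
  qed
  have Fc: "continuous_on C F"
    unfolding F_def by (intro continuous_intros)
  have "homotopic_paths \<R> (F \<circ> (linepath (0,0) (1,0) +++ linepath (1,0) (0,1))) (F \<circ> linepath (0,0) (0,1))"
  proof (rule homotopic_paths_convex_image[OF Fc F C])
    have pts: "(0,0) \<in> C" "(1,0) \<in> C" "(0,1) \<in> C" by (auto simp: C_def)
    then show "path_image (linepath (0,0) (1,0) +++ linepath (1,0) (0,1)) \<subseteq> C"
      "path_image (linepath (0,0) (0,1)) \<subseteq> C"
      using C by (auto simp: path_image_join closed_segment_subset dest: subsetD[OF closed_segment_subset])
  qed auto
  moreover have "F \<circ> linepath (0,0) (1,0) = segment y z" "F \<circ> linepath (1,0) (0,1) = segment z w"
    "F \<circ> linepath (0,0) (0,1) = segment y w"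
    by (auto simp: fun_eq_iff F_def linepath_def segment_def algebra_simps)
  ultimately have "homotopic_paths \<R> (segment y z +++ segment z w) (segment y w)"
    by (simp add: path_compose_join)
  from closed_up_homotopic[OF this] show ?thesis
    unfolding seg_class_def using segment_image[OF \<sigma>] cells path_segment
    by (subst (asm) closed_up_join) simp_all
qed

text \<open>As long as the path stays in the open star of \<open>u\<close>, each of its points
  slides to \<open>u\<close> along a segment of the complex. These slides fill a rectangle whose
  bottom is the path and whose other sides are the slide at \<open>a\<close>, the constant path at
  \<open>u\<close> and the reversed slide at \<open>c\<close>.\<close>

lemma star_class:
  assumes p: "path p" "path_image p \<subseteq> \<R>" and ac: "0 \<le> a" "a \<le> c" "c \<le> 1"
    and star: "\<And>r. r \<in> {a..c} \<Longrightarrow> p r u \<noteq> 0"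
  shows "closed_up (p \<circ> linepath a c) = seg_class (p a) (vertex_point u) \<otimes>\<^bsub>\<pi>\<^esub> seg_class (vertex_point u) (p c)"
proof -
  define F :: "real \<times> real \<Rightarrow> 'v \<Rightarrow> real"
    where "F = (\<lambda>c. segment (p (fst c)) (vertex_point u) (snd c))"
  define C where "C = {a..c} \<times> {0..1::real}"
  have pR: "p r \<in> \<R>" if "r \<in> {a..c}" for r
    using p ac that by (auto simp: path_image_def)
  have C: "convex C" unfolding C_def by (intro convex_Times) auto
  have F: "F \<in> C \<rightarrow> \<R>"
    using segment_vertex(1) pR star by (auto simp: F_def C_def)
  have "continuous_on {a..c} p"
    using p(1) ac by (auto simp: path_def intro: continuous_on_subset)
  then have "continuous_on {a..c} (\<lambda>r. p r v)" for v
    by (rule continuous_on_product_then_coordinatewise)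
  then have "continuous_on C (\<lambda>z. p (fst z) v)" for v
    by (rule continuous_on_compose2) (auto simp: C_def intro!: continuous_intros)
  then have Fc: "continuous_on C F"
    unfolding F_def segment_def by (intro continuous_intros)
  have sub: "closed_segment y z \<subseteq> C" if "y \<in> C" "z \<in> C" for y z
    using C that closed_segment_subset by blast
  have pts: "(a,0) \<in> C" "(a,1) \<in> C" "(c,0) \<in> C" "(c,1) \<in> C"
    using ac by (auto simp: C_def)
  have "homotopic_paths \<R> (F \<circ> linepath (a,0) (c,0))
      (F \<circ> (linepath (a,0) (a,1) +++ linepath (a,1) (c,1) +++ linepath (c,1) (c,0)))"
    using pts sub by (intro homotopic_paths_convex_image[OF Fc F C]) (simp_all add: path_image_join)
  moreover have "F \<circ> linepath (a,0) (c,0) = p \<circ> linepath a c"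
    "F \<circ> linepath (a,0) (a,1) = segment (p a) (vertex_point u)"
    "F \<circ> linepath (a,1) (c,1) = (\<lambda>_. vertex_point u)"
    "F \<circ> linepath (c,1) (c,0) = segment (vertex_point u) (p c)"
    by (auto simp: fun_eq_iff F_def linepath_def segment_def algebra_simps)
  ultimately have h: "homotopic_paths \<R> (p \<circ> linepath a c)
     (segment (p a) (vertex_point u) +++ (\<lambda>_. vertex_point u) +++ segment (vertex_point u) (p c))"
    by (simp add: path_compose_join)
  have pa: "p a \<in> \<R>" "p a u \<noteq> 0" and pc: "p c \<in> \<R>" "p c u \<noteq> 0"
    using pR star ac by auto
  have u: "vertex_point u \<in> \<R>"
    using vertex_point_realization support_vertex[OF pa] by blast
  have im: "path_image (segment (p a) (vertex_point u)) \<subseteq> \<R>" "path_image (segment (vertex_point u) (p c)) \<subseteq> \<R>"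
    using segment_vertex[OF pa] segment_vertex[OF pc] by (auto simp: path_image_def)
  have "closed_up ((\<lambda>_. vertex_point u) +++ segment (vertex_point u) (p c)) =
      closed_up (\<lambda>_. vertex_point u) \<otimes>\<^bsub>\<pi>\<^esub> closed_up (segment (vertex_point u) (p c))"
    using im u path_segment by (intro closed_up_join) (auto simp: path_const)
  then have 1: "closed_up ((\<lambda>_. vertex_point u) +++ segment (vertex_point u) (p c)) =
      closed_up (segment (vertex_point u) (p c))"
    using P.l_one[OF closed_up_carrier[OF path_segment im(2)]] by (simp add: closed_up_const[OF u])
  show ?thesis
    unfolding closed_up_homotopic[OF h] seg_class_def
    using 1 by (subst closed_up_join) (use im u path_segment in \<open>auto simp: path_const path_image_join\<close>)
qed

text \<open>The recursion is on the rank because \<open>par\<close> is an arbitrary function; at the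
  rank of \<open>v\<close> it multiplies the segments of the tree path from the root to
  \<open>v\<close>.\<close>

primrec tree_class_at :: "nat \<Rightarrow> 'v \<Rightarrow> (real \<Rightarrow> 'v \<Rightarrow> real) set" where
  "tree_class_at 0 v = \<one>\<^bsub>\<pi>\<^esub>"
| "tree_class_at (Suc n) v = tree_class_at n (par v) \<otimes>\<^bsub>\<pi>\<^esub> seg_class (vertex_point (par v)) (vertex_point v)"

definition tree_class :: "'v \<Rightarrow> (real \<Rightarrow> 'v \<Rightarrow> real) set" where
  "tree_class v = tree_class_at (rk v) v"

definition edge_class :: "'v \<Rightarrow> 'v \<Rightarrow> (real \<Rightarrow> 'v \<Rightarrow> real) set" where
  "edge_class u v =
     tree_class u \<otimes>\<^bsub>\<pi>\<^esub> seg_class (vertex_point u) (vertex_point v) \<otimes>\<^bsub>\<pi>\<^esub> inv\<^bsub>\<pi>\<^esub> tree_class v"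

lemma tree_class_root: "tree_class b = \<one>\<^bsub>\<pi>\<^esub>"
  by (simp add: tree_class_def root)

lemma tree_class_par:
  "{v} \<in> K \<Longrightarrow> v \<noteq> b \<Longrightarrow>
    tree_class v = tree_class (par v) \<otimes>\<^bsub>\<pi>\<^esub> seg_class (vertex_point (par v)) (vertex_point v)"
  using par[of v] by (simp add: tree_class_def)

lemma vertex_induct [consumes 1, case_names root step]:
  assumes "{v} \<in> K" and "P b"
    and "\<And>v. {v} \<in> K \<Longrightarrow> v \<noteq> b \<Longrightarrow> {par v} \<in> K \<Longrightarrow> {par v, v} \<in> K \<Longrightarrow> P (par v) \<Longrightarrow> P v"
  shows "P v"
  using assms(1)
proof (induction "rk v" arbitrary: v)
  case 0
  then have "v = b" using par by fastforce
  then show ?case using assms(2) by simp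
next
  case (Suc n)
  then have "v \<noteq> b" using root by auto
  then show ?case
    using Suc par[of v] par_vertex[of v] assms(3) by simp
qed

lemma vertex_seg_carrier: "\<sigma> \<in> K \<Longrightarrow> u \<in> \<sigma> \<Longrightarrow> v \<in> \<sigma> \<Longrightarrow> seg_class (vertex_point u) (vertex_point v) \<in> carrier \<pi>"
  by (rule seg_class_carrier) (auto intro: vertex_point_cell finite_face)

lemma tree_class_carrier: "{v} \<in> K \<Longrightarrow> tree_class v \<in> carrier \<pi>"
proof (induction rule: vertex_induct)
  case root
  then show ?case by (simp add: tree_class_root)
next
  case (step v)
  then show ?case
    using vertex_seg_carrier[of "{par v, v}" "par v" v] by (simp add: tree_class_par)
qed

lemma cocycle_edge_class: "cocycle K \<pi> edge_class"
  unfolding cocycle_def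
proof (intro ballI conjI)
  fix \<sigma> u v assume \<sigma>: "\<sigma> \<in> K" and u: "u \<in> \<sigma>" and v: "v \<in> \<sigma>"
  note c = vertex_seg_carrier[OF \<sigma>] tree_class_carrier[OF in_vertex[OF \<sigma>]]
  show "edge_class u v \<in> carrier \<pi>"
    unfolding edge_class_def using c u v by auto
  fix w assume w: "w \<in> \<sigma>"
  have "seg_class (vertex_point u) (vertex_point v) \<otimes>\<^bsub>\<pi>\<^esub> seg_class (vertex_point v) (vertex_point w)
      = seg_class (vertex_point u) (vertex_point w)"
    using finite_face[OF \<sigma>] u v w by (intro seg_class_trans[OF \<sigma>] vertex_point_cell)
  then show "edge_class u v \<otimes>\<^bsub>\<pi>\<^esub> edge_class v w = edge_class u w"
    unfolding edge_class_def using c u v w by (simp add: P.conj_telescope)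
qed

lemma edge_class_par: "{v} \<in> K \<Longrightarrow> v \<noteq> b \<Longrightarrow> edge_class (par v) v = \<one>\<^bsub>\<pi>\<^esub>"
  unfolding edge_class_def using tree_class_par[of v, symmetric] tree_class_carrier[of v]
  by (simp add: P.r_inv)

text \<open>The analogue of \<open>tree_class\<close> for an endpoint \<open>y\<close> that is not a
  vertex: the tree is followed to a vertex \<open>u\<close> whose star contains \<open>y\<close>,
  then the segment to \<open>y\<close>.\<close>

definition spoke :: "'v \<Rightarrow> ('v \<Rightarrow> real) \<Rightarrow> (real \<Rightarrow> 'v \<Rightarrow> real) set" where
  "spoke u y = tree_class u \<otimes>\<^bsub>\<pi>\<^esub> seg_class (vertex_point u) y"

lemma spoke_seg:
  assumes y: "y \<in> \<R>" and u: "y u \<noteq> 0" and v: "y v \<noteq> 0"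
  shows "spoke u y \<in> carrier \<pi>"
    and "seg_class (vertex_point u) y \<in> carrier \<pi>" and "seg_class y (vertex_point u) \<in> carrier \<pi>"
    and "spoke u y \<otimes>\<^bsub>\<pi>\<^esub> seg_class y (vertex_point v) = edge_class u v \<otimes>\<^bsub>\<pi>\<^esub> tree_class v"
    and "spoke u y = edge_class u v \<otimes>\<^bsub>\<pi>\<^esub> spoke v y"
proof -
  let ?\<sigma> = "{v. y v \<noteq> 0}"
  note s = support_cell[OF y]
  have c: "vertex_point u \<in> cell ?\<sigma>" "vertex_point v \<in> cell ?\<sigma>"
    using u v finite_face[OF s(1)] by (auto intro: vertex_point_cell)
  note car = seg_class_carrier[OF s(1)]
  have t: "tree_class u \<in> carrier \<pi>" "tree_class v \<in> carrier \<pi>"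
    using tree_class_carrier support_vertex y u v by auto
  show "spoke u y \<in> carrier \<pi>" "seg_class (vertex_point u) y \<in> carrier \<pi>" "seg_class y (vertex_point u) \<in> carrier \<pi>"
    unfolding spoke_def using t c s car by auto
  show "spoke u y \<otimes>\<^bsub>\<pi>\<^esub> seg_class y (vertex_point v) = edge_class u v \<otimes>\<^bsub>\<pi>\<^esub> tree_class v"
    unfolding spoke_def edge_class_def using t c s car seg_class_trans[OF s(1) c(1) s(2) c(2)]
    by (simp add: P.m_assoc)
  show "spoke u y = edge_class u v \<otimes>\<^bsub>\<pi>\<^esub> spoke v y"
    unfolding spoke_def edge_class_def
    using t c s car seg_class_trans[OF s(1) c(1) c(2) s(2)]
    by (simp add: P.m_assoc P.inv_cancel)
qed

abbreviation edge_subgroup :: "(real \<Rightarrow> 'v \<Rightarrow> real) set set" where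
  "edge_subgroup \<equiv> generate \<pi> {edge_class u v |u v. {u, v} \<in> K}"

text \<open>Conjugated by spokes, the class of a path telescopes over a subdivision, so bisection
  reduces the claim to a piece inside the star of one vertex \<open>w\<close>. There the value is
  \<open>edge_class u w\<close> times \<open>edge_class w v\<close>. Admitting every
  \<open>u\<close> and \<open>v\<close> with nonzero coordinates at the ends allows adjacent pieces
  to be matched at any common vertex.\<close>

lemma path_in_edge_subgroup:
  assumes p: "path p" "path_image p \<subseteq> \<R>" and "p 0 u \<noteq> 0" "p 1 v \<noteq> 0"
  shows "spoke u (p 0) \<otimes>\<^bsub>\<pi>\<^esub> closed_up p \<otimes>\<^bsub>\<pi>\<^esub> inv\<^bsub>\<pi>\<^esub> spoke v (p 1) \<in> edge_subgroup"
proof -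
  define Q where "Q a c \<longleftrightarrow> 0 \<le> a \<and> a \<le> c \<and> c \<le> 1 \<longrightarrow> (\<forall>u v. p a u \<noteq> 0 \<longrightarrow> p c v \<noteq> 0 \<longrightarrow>
      spoke u (p a) \<otimes>\<^bsub>\<pi>\<^esub> closed_up (p \<circ> linepath a c) \<otimes>\<^bsub>\<pi>\<^esub> inv\<^bsub>\<pi>\<^esub> spoke v (p c) \<in> edge_subgroup)" for a c
  have pR: "p r \<in> \<R>" if "0 \<le> r" "r \<le> 1" for r
    using p that by (auto simp: path_image_def)
  have "Q 0 1"
  proof (rule Bolzano)
    fix a c d assume Q: "Q a c" "Q c d" and le: "a \<le> c" "c \<le> d"
    show "Q a d"
      unfolding Q_def
    proof (intro impI allI)
      fix u v assume r: "0 \<le> a \<and> a \<le> d \<and> d \<le> 1" and u: "p a u \<noteq> 0" and v: "p d v \<noteq> 0"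
      obtain w where w: "p c w \<noteq> 0" using support_nonempty[OF pR[of c]] r le by auto
      have 1: "spoke u (p a) \<otimes>\<^bsub>\<pi>\<^esub> closed_up (p \<circ> linepath a c) \<otimes>\<^bsub>\<pi>\<^esub> inv\<^bsub>\<pi>\<^esub> spoke w (p c) \<in> edge_subgroup"
        "spoke w (p c) \<otimes>\<^bsub>\<pi>\<^esub> closed_up (p \<circ> linepath c d) \<otimes>\<^bsub>\<pi>\<^esub> inv\<^bsub>\<pi>\<^esub> spoke v (p d) \<in> edge_subgroup"
        using Q r le u v w unfolding Q_def by auto
      have c: "closed_up (p \<circ> linepath a c) \<in> carrier \<pi>" "closed_up (p \<circ> linepath c d) \<in> carrier \<pi>"
        using path_interval[OF p(1), of a c] path_interval[OF p(1), of c d] p(2) r le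
        by (auto intro!: closed_up_carrier)
      have s: "spoke u (p a) \<in> carrier \<pi>" "spoke w (p c) \<in> carrier \<pi>" "spoke v (p d) \<in> carrier \<pi>"
        using spoke_seg(1)[OF pR] u v w r le by auto
      have "closed_up (p \<circ> linepath a c) \<otimes>\<^bsub>\<pi>\<^esub> closed_up (p \<circ> linepath c d) = closed_up (p \<circ> linepath a d)"
        using r le by (intro closed_up_interval p) auto
      then show "spoke u (p a) \<otimes>\<^bsub>\<pi>\<^esub> closed_up (p \<circ> linepath a d) \<otimes>\<^bsub>\<pi>\<^esub> inv\<^bsub>\<pi>\<^esub> spoke v (p d) \<in> edge_subgroup"
        using generate.eng[OF 1] P.conj_telescope[OF s c] by simp
    qed
  next
    fix r :: real assume "0 \<le> r" "r \<le> 1"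
    then obtain w d where wd: "d > 0" "\<And>s. s \<in> {0..1} \<Longrightarrow> \<bar>s - r\<bar> < d \<Longrightarrow> p s w \<noteq> 0"
      using star_nhd[OF p] by (metis atLeastAtMost_iff)
    have "Q a c" if ac: "a \<le> r \<and> r \<le> c \<and> c - a < d" for a c
      unfolding Q_def
    proof (intro impI allI)
      fix u v assume le: "0 \<le> a \<and> a \<le> c \<and> c \<le> 1" and u: "p a u \<noteq> 0" and v: "p c v \<noteq> 0"
      have st: "p s w \<noteq> 0" if "s \<in> {a..c}" for s
        using that ac le by (intro wd(2)) auto
      have w: "p a w \<noteq> 0" "p c w \<noteq> 0" and ac': "p a \<in> \<R>" "p c \<in> \<R>"
        using st le pR by auto
      have e: "edge_class u w \<in> edge_subgroup" "edge_class w v \<in> edge_subgroup"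
        using support_edge[OF ac'(1) u w(1)] support_edge[OF ac'(2) w(2) v] by (auto intro: generate.incl)
      have ec: "edge_class u w \<in> carrier \<pi>" "edge_class w v \<in> carrier \<pi>"
        using cocycleD(1)[OF cocycle_edge_class support_edge[OF ac'(1) u w(1)]]
          cocycleD(1)[OF cocycle_edge_class support_edge[OF ac'(2) w(2) v]] by auto
      have "closed_up (p \<circ> linepath a c) = seg_class (p a) (vertex_point w) \<otimes>\<^bsub>\<pi>\<^esub> seg_class (vertex_point w) (p c)"
        using star_class[OF p _ _ _ st] le by auto
      then have "spoke u (p a) \<otimes>\<^bsub>\<pi>\<^esub> closed_up (p \<circ> linepath a c) =
          (edge_class u w \<otimes>\<^bsub>\<pi>\<^esub> tree_class w) \<otimes>\<^bsub>\<pi>\<^esub> seg_class (vertex_point w) (p c)"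
        using spoke_seg(1,4)[OF ac'(1) u w(1)] spoke_seg(3)[OF ac'(1) w(1) w(1)] spoke_seg(2)[OF ac'(2) w(2) v]
        by (simp add: P.m_assoc[symmetric])
      also have "\<dots> = edge_class u w \<otimes>\<^bsub>\<pi>\<^esub> spoke w (p c)"
        unfolding spoke_def using ec spoke_seg(2)[OF ac'(2) w(2) v] tree_class_carrier[OF support_vertex[OF ac'(2) w(2)]]
        by (simp add: P.m_assoc)
      also have "\<dots> = edge_class u w \<otimes>\<^bsub>\<pi>\<^esub> edge_class w v \<otimes>\<^bsub>\<pi>\<^esub> spoke v (p c)"
        using spoke_seg(5)[OF ac'(2) w(2) v] ec spoke_seg(1)[OF ac'(2) v v] by (simp add: P.m_assoc)
      finally have "spoke u (p a) \<otimes>\<^bsub>\<pi>\<^esub> closed_up (p \<circ> linepath a c) \<otimes>\<^bsub>\<pi>\<^esub> inv\<^bsub>\<pi>\<^esub> spoke v (p c)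
          = edge_class u w \<otimes>\<^bsub>\<pi>\<^esub> edge_class w v"
        using ec spoke_seg(1)[OF ac'(2) v v] by (simp add: P.m_assoc)
      then show "spoke u (p a) \<otimes>\<^bsub>\<pi>\<^esub> closed_up (p \<circ> linepath a c) \<otimes>\<^bsub>\<pi>\<^esub> inv\<^bsub>\<pi>\<^esub> spoke v (p c) \<in> edge_subgroup"
        using e by (auto intro: generate.eng)
    qed
    with wd(1) show "\<exists>d>0. \<forall>a c. a \<le> r \<and> r \<le> c \<and> c - a < d \<longrightarrow> Q a c" by blast
  qed simp
  then show ?thesis
    using assms(3,4) by (simp add: Q_def comp_linepath_01)
qed

theorem edge_classes_generate: "edge_subgroup = carrier \<pi>"
proof
  show "edge_subgroup \<subseteq> carrier \<pi>"
    by (rule P.generate_incl) (auto intro: cocycleD(1)[OF cocycle_edge_class])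
  obtain u where u: "x u \<noteq> 0" using support_nonempty[OF x] by blast
  note s = spoke_seg(1)[OF x u u]
  show "carrier \<pi> \<subseteq> edge_subgroup"
  proof
    fix g assume g: "g \<in> carrier \<pi>"
    \<comment> \<open>The base point need not be a vertex, so the previous lemma only places
      conjugates by \<open>spoke u x\<close> in the subgroup. Conjugating \<open>g\<close> the other
      way beforehand compensates for this.\<close>
    define h where "h = inv\<^bsub>\<pi>\<^esub> spoke u x \<otimes>\<^bsub>\<pi>\<^esub> g \<otimes>\<^bsub>\<pi>\<^esub> spoke u x"
    then have "h \<in> carrier \<pi>" using g s by simp
    then obtain p where p: "p \<in> loops_at \<R> x" "h = closed_up p"
      using closed_up_loop by (auto simp: fundamental_group_simps)
    then have "spoke u x \<otimes>\<^bsub>\<pi>\<^esub> h \<otimes>\<^bsub>\<pi>\<^esub> inv\<^bsub>\<pi>\<^esub> spoke u x \<in> edge_subgroup"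
      using path_in_edge_subgroup[of p u u] u by (auto simp: loops_at_def pathstart_def pathfinish_def)
    moreover have "spoke u x \<otimes>\<^bsub>\<pi>\<^esub> h \<otimes>\<^bsub>\<pi>\<^esub> inv\<^bsub>\<pi>\<^esub> spoke u x = g"
      unfolding h_def using g s by (simp add: P.m_assoc P.inv_cancel)
    ultimately show "g \<in> edge_subgroup" by simp
  qed
qed

end

section \<open>Holonomy of a cocycle\<close>

locale complex_cocycle = two_complex K for K :: "'v set set" +
  fixes H :: "('h, 'k) monoid_scheme" (structure) and \<phi> :: "'v \<Rightarrow> 'v \<Rightarrow> 'h"
  assumes H: "group H" and \<phi>: "cocycle K H \<phi>"
begin

sublocale H: group H by (rule H)

lemma \<phi>_support:
  assumes "t \<in> \<R>" "t u \<noteq> 0" "t v \<noteq> 0"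
  shows "\<phi> u v \<in> carrier H" "t w \<noteq> 0 \<Longrightarrow> \<phi> u v \<otimes> \<phi> v w = \<phi> u w"
  using cocycleD[OF \<phi> support_cell(1)[OF assms(1)], of u v] assms by auto

text \<open>A lift of \<open>p\<close> to the covering space with fibre \<open>H\<close> defined by \<open>\<phi>\<close>, written in the
  trivialisations over the open stars of the vertices.\<close>

definition lift_on :: "(real \<Rightarrow> 'v \<Rightarrow> real) \<Rightarrow> real \<Rightarrow> real \<Rightarrow> (real \<Rightarrow> 'v \<Rightarrow> 'h) \<Rightarrow> bool" where
  "lift_on p a c L \<longleftrightarrow>
     (\<forall>r\<in>{a..c}. \<forall>u. p r u \<noteq> 0 \<longrightarrow> L r u \<in> carrier H) \<and>
     (\<forall>r\<in>{a..c}. \<forall>u v. p r u \<noteq> 0 \<longrightarrow> p r v \<noteq> 0 \<longrightarrow> L r v = L r u \<otimes> \<phi> u v) \<and>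
     (\<forall>u s t. a \<le> s \<longrightarrow> s \<le> t \<longrightarrow> t \<le> c \<longrightarrow> (\<forall>r\<in>{s..t}. p r u \<noteq> 0) \<longrightarrow> L s u = L t u)"

lemma lift_onD:
  assumes "lift_on p a c L"
  shows "a \<le> r \<Longrightarrow> r \<le> c \<Longrightarrow> p r u \<noteq> 0 \<Longrightarrow> L r u \<in> carrier H"
    and "a \<le> r \<Longrightarrow> r \<le> c \<Longrightarrow> p r u \<noteq> 0 \<Longrightarrow> p r v \<noteq> 0 \<Longrightarrow> L r v = L r u \<otimes> \<phi> u v"
    and "a \<le> s \<Longrightarrow> s \<le> t \<Longrightarrow> t \<le> c \<Longrightarrow> (\<And>r. s \<le> r \<Longrightarrow> r \<le> t \<Longrightarrow> p r u \<noteq> 0) \<Longrightarrow> L s u = L t u"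
  using assms unfolding lift_on_def by (meson atLeastAtMost_iff)+

text \<open>At the common time \<open>c\<close> the two lifts differ by a left translation
  \<open>g\<close>. It is read off at one vertex \<open>w\<close> and is the same at all others,
  because the trivialisations are compared by right multiplication with \<phi>. Translating the
  second lift by \<open>g\<close> makes the two agree.\<close>

lemma lift_exists_join:
  assumes L1: "lift_on p a c L1" and L2: "lift_on p c d L2" and ac: "a \<le> c" "c \<le> d"
    and pR: "\<And>r. a \<le> r \<Longrightarrow> r \<le> d \<Longrightarrow> p r \<in> \<R>"
  shows "\<exists>L. lift_on p a d L"
proof -
  have pc: "p c \<in> \<R>" using pR ac by simp
  obtain w where w: "p c w \<noteq> 0" using support_nonempty[OF pc] by blast
  define g where "g = L1 c w \<otimes> inv (L2 c w)"
  have L1w: "L1 c w \<in> carrier H" and L2w: "L2 c w \<in> carrier H"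
    using lift_onD(1)[OF L1, of c] lift_onD(1)[OF L2, of c] w ac by auto
  have g: "g \<in> carrier H" unfolding g_def using L1w L2w by simp
  have eq: "L1 c u = g \<otimes> L2 c u" if u: "p c u \<noteq> 0" for u
  proof -
    have "g \<otimes> L2 c u = L1 c w \<otimes> \<phi> w u"
      unfolding g_def using lift_onD(2)[OF L2, of c w u] L1w L2w w u ac \<phi>_support(1)[OF pc w u]
      by (simp add: H.m_assoc H.inv_cancel)
    then show ?thesis using lift_onD(2)[OF L1, of c w u] w u ac by simp
  qed
  define L where "L = (\<lambda>r u. if r \<le> c then L1 r u else g \<otimes> L2 r u)"
  have Lc: "L r u = g \<otimes> L2 r u" if "c \<le> r" "p r u \<noteq> 0" for r u
    using that eq by (cases "r = c") (auto simp: L_def)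
  have "lift_on p a d L"
    unfolding lift_on_def
  proof (intro conjI ballI allI impI)
    fix r u assume r: "r \<in> {a..d}" and u: "p r u \<noteq> 0"
    show "L r u \<in> carrier H"
      using r u lift_onD(1)[OF L1, of r u] lift_onD(1)[OF L2, of r u] g by (auto simp: L_def)
    fix v assume v: "p r v \<noteq> 0"
    show "L r v = L r u \<otimes> \<phi> u v"
    proof (cases "r \<le> c")
      case True
      then show ?thesis using lift_onD(2)[OF L1, of r u v] r u v by (simp add: L_def)
    next
      case False
      then have "L2 r u \<in> carrier H" "L2 r v = L2 r u \<otimes> \<phi> u v"
        using lift_onD(1)[OF L2, of r u] lift_onD(2)[OF L2, of r u v] r u v by auto
      with False show ?thesis
        using g \<phi>_support(1)[OF pR u v] r by (simp add: L_def H.m_assoc)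
    qed
  next
    fix u s t assume st: "a \<le> s" "s \<le> t" "t \<le> d" and star: "\<forall>r\<in>{s..t}. p r u \<noteq> 0"
    consider "t \<le> c" | "s \<le> c" "c \<le> t" | "c \<le> s" by linarith
    then show "L s u = L t u"
    proof cases
      case 1
      then show ?thesis using lift_onD(3)[OF L1, of s t u] st star by (simp add: L_def)
    next
      case 2
      have "L s u = L1 c u"
        using lift_onD(3)[OF L1, of s c u] 2 st star by (simp add: L_def)
      also have "\<dots> = g \<otimes> L2 t u"
        using eq[of u] lift_onD(3)[OF L2, of c t u] 2 st star by simp
      finally show ?thesis using Lc[of t u] 2 st star by simp
    next
      case 3
      then show ?thesis using lift_onD(3)[OF L2, of s t u] st star Lc[of s u] Lc[of t u] by simp
    qed
  qed
  then show ?thesis by blast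
qed

text \<open>Over the open star of \<open>w\<close> the covering is trivial; this is the sheet whose
  coordinate at \<open>w\<close> is the unit.\<close>

lemma lift_star:
  assumes "\<And>r. a \<le> r \<Longrightarrow> r \<le> c \<Longrightarrow> p r \<in> \<R> \<and> p r w \<noteq> 0"
  shows "lift_on p a c (\<lambda>_. \<phi> w)"
  unfolding lift_on_def
proof (intro conjI ballI allI impI)
  fix r u assume r: "r \<in> {a..c}" and u: "p r u \<noteq> 0"
  have w: "p r \<in> \<R>" "p r w \<noteq> 0" using assms r by auto
  show "\<phi> w u \<in> carrier H" by (rule \<phi>_support(1)[OF w u])
  fix v assume "p r v \<noteq> 0"
  then show "\<phi> w v = \<phi> w u \<otimes> \<phi> u v" by (rule \<phi>_support(2)[OF w u, symmetric])
qed simp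

lemma lift_exists:
  assumes p: "path p" "path_image p \<subseteq> \<R>"
  shows "\<exists>L. lift_on p 0 1 L"
proof -
  have pR: "p r \<in> \<R>" if "0 \<le> r" "r \<le> 1" for r
    using p that by (auto simp: path_image_def)
  define Q where "Q a c \<longleftrightarrow> 0 \<le> a \<and> a \<le> c \<and> c \<le> 1 \<longrightarrow> (\<exists>L. lift_on p a c L)" for a c
  have "Q 0 1"
  proof (rule Bolzano)
    fix a c d :: real assume Q: "Q a c" "Q c d" and le: "a \<le> c" "c \<le> d"
    show "Q a d"
      unfolding Q_def
    proof
      assume r: "0 \<le> a \<and> a \<le> d \<and> d \<le> 1"
      then obtain L1 L2 where "lift_on p a c L1" "lift_on p c d L2"
        using Q le unfolding Q_def by auto
      then show "\<exists>L. lift_on p a d L"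
        by (rule lift_exists_join[OF _ _ le]) (use pR r in auto)
    qed
  next
    fix r :: real assume "0 \<le> r" "r \<le> 1"
    then obtain w d where wd: "d > 0" "\<And>s. s \<in> {0..1} \<Longrightarrow> \<bar>s - r\<bar> < d \<Longrightarrow> p s w \<noteq> 0"
      using star_nhd[OF p] by (metis atLeastAtMost_iff)
    have "Q a c" if ac: "a \<le> r \<and> r \<le> c \<and> c - a < d" for a c
      unfolding Q_def
    proof
      assume "0 \<le> a \<and> a \<le> c \<and> c \<le> 1"
      then have "lift_on p a c (\<lambda>_. \<phi> w)"
        using ac pR by (intro lift_star conjI wd(2)) auto
      then show "\<exists>L. lift_on p a c L" by blast
    qed
    with wd(1) show "\<exists>d>0. \<forall>a c. a \<le> r \<and> r \<le> c \<and> c - a < d \<longrightarrow> Q a c" by blast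
  qed simp
  then show ?thesis by (simp add: Q_def)
qed

lemma square_nhd:
  fixes h :: "real \<times> real \<Rightarrow> 'v \<Rightarrow> real"
  assumes h: "continuous_on ({0..1} \<times> {0..1}) h" and s0: "s0 \<in> {0..1}" "r0 \<in> {0..1}" and nz: "h (s0, r0) w \<noteq> 0"
  obtains d where "d > 0" "\<And>s r. s \<in> {0..1} \<Longrightarrow> r \<in> {0..1} \<Longrightarrow> \<bar>s - s0\<bar> < d \<Longrightarrow> \<bar>r - r0\<bar> < d \<Longrightarrow> h (s, r) w \<noteq> 0"
proof -
  have "continuous_on ({0..1} \<times> {0..1}) (\<lambda>z. h z w)"
    using h by (rule continuous_on_product_then_coordinatewise)
  moreover have "(s0, r0) \<in> {0..1} \<times> {0..1}" using s0 by auto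
  moreover have "\<bar>h (s0, r0) w\<bar> > 0" using nz by simp
  ultimately obtain d where d: "d > 0"
    "\<And>z. z \<in> {0..1} \<times> {0..1} \<Longrightarrow> dist z (s0, r0) < d \<Longrightarrow> dist (h z w) (h (s0, r0) w) < \<bar>h (s0, r0) w\<bar>"
    unfolding continuous_on_iff by metis
  have "h (s, r) w \<noteq> 0" if "s \<in> {0..1}" "r \<in> {0..1}" "\<bar>s - s0\<bar> < d / 2" "\<bar>r - r0\<bar> < d / 2" for s r
  proof -
    have "dist (s, r) (s0, r0) \<le> \<bar>s - s0\<bar> + \<bar>r - r0\<bar>"
      using sqrt_sum_squares_le_sum_abs[of "s - s0" "r - r0"] by (simp add: dist_Pair_Pair dist_real_def)
    then have "dist (s, r) (s0, r0) < d" using that by linarith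
    then show ?thesis using d(2)[of "(s, r)"] that by (auto simp: dist_real_def)
  qed
  with d(1) that[of "d / 2"] show ?thesis by simp
qed

text \<open>A left translation of the lift cancels in this quotient, so the choice of a starting
  point in the fibre has no influence.\<close>

definition transport :: "(real \<Rightarrow> 'v \<Rightarrow> 'h) \<Rightarrow> real \<Rightarrow> real \<Rightarrow> 'v \<Rightarrow> 'v \<Rightarrow> 'h" where
  "transport L a c u v = inv (L a u) \<otimes> L c v"

lemma transport_trans:
  assumes "lift_on p 0 1 L" "0 \<le> a" "a \<le> c" "c \<le> d" "d \<le> 1" "p a u \<noteq> 0" "p c w \<noteq> 0" "p d v \<noteq> 0"
  shows "transport L a d u v = transport L a c u w \<otimes> transport L c d w v"
proof -
  have "L a u \<in> carrier H" "L c w \<in> carrier H" "L d v \<in> carrier H"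
    using lift_onD(1)[OF assms(1)] assms by auto
  then show ?thesis
    by (simp add: transport_def H.m_assoc H.inv_cancel)
qed

text \<open>The value involves only \<phi> and the three vertices, neither the lift nor the path.
  This rigidity is what makes transport locally constant in a homotopy.\<close>

lemma transport_star:
  assumes L: "lift_on p 0 1 L" and ac: "0 \<le> a" "a \<le> c" "c \<le> 1"
    and pR: "p a \<in> \<R>" "p c \<in> \<R>" and star: "\<And>r. a \<le> r \<Longrightarrow> r \<le> c \<Longrightarrow> p r w \<noteq> 0"
    and u: "p a u \<noteq> 0" and v: "p c v \<noteq> 0"
  shows "transport L a c u v = \<phi> u w \<otimes> \<phi> w v"
proof -
  have w: "p a w \<noteq> 0" "p c w \<noteq> 0" using star ac by auto
  have c: "L a u \<in> carrier H" "\<phi> u w \<in> carrier H" "\<phi> w v \<in> carrier H"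
    using lift_onD(1)[OF L, of a u] \<phi>_support(1)[OF pR(1) u w(1)] \<phi>_support(1)[OF pR(2) w(2) v] ac u by auto
  have "L c v = L c w \<otimes> \<phi> w v" "L a w = L a u \<otimes> \<phi> u w" "L a w = L c w"
    using lift_onD(2)[OF L, of c w v] lift_onD(2)[OF L, of a u w] lift_onD(3)[OF L, of a c w] ac u v w star
    by auto
  then have "L c v = L a u \<otimes> (\<phi> u w \<otimes> \<phi> w v)"
    using c by (simp add: H.m_assoc)
  then show ?thesis
    unfolding transport_def using c by (simp add: H.inv_cancel)
qed

text \<open>A short piece of the path at level \<open>s0\<close> and the corresponding pieces at
  nearby levels lie in the star of one vertex, where transport is given by
  \<open>transport_star\<close>; bisection assembles the pieces. Both lifts are arbitrary, so the
  statement also contains the uniqueness of transport at a fixed level.\<close>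

lemma transport_stable:
  fixes h :: "real \<times> real \<Rightarrow> 'v \<Rightarrow> real"
  assumes h: "continuous_on ({0..1} \<times> {0..1}) h" "\<And>s r. s \<in> {0..1} \<Longrightarrow> r \<in> {0..1} \<Longrightarrow> h (s, r) \<in> \<R>"
    and s0: "s0 \<in> {0..1}" and u: "h (s0, 0) u \<noteq> 0" and v: "h (s0, 1) v \<noteq> 0"
  shows "\<exists>d>0. \<forall>s\<in>{0..1}. \<bar>s - s0\<bar> < d \<longrightarrow> (\<forall>L L'. lift_on (\<lambda>r. h (s0, r)) 0 1 L \<longrightarrow>
      lift_on (\<lambda>r. h (s, r)) 0 1 L' \<longrightarrow> transport L 0 1 u v = transport L' 0 1 u v)"
proof -
  \<comment> \<open>Nonvanishing at both ends is part of the invariant: when two pieces are joined,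
    the intermediate vertex must still be usable at the level \<open>s\<close>.\<close>
  define M where "M d a c u v \<longleftrightarrow> (\<forall>s\<in>{0..1}. \<bar>s - s0\<bar> < d \<longrightarrow> h (s, a) u \<noteq> 0 \<and> h (s, c) v \<noteq> 0 \<and>
      (\<forall>L L'. lift_on (\<lambda>r. h (s0, r)) 0 1 L \<longrightarrow>
      lift_on (\<lambda>r. h (s, r)) 0 1 L' \<longrightarrow> transport L a c u v = transport L' a c u v))" for d a c u v
  define Q where "Q a c \<longleftrightarrow> 0 \<le> a \<and> a \<le> c \<and> c \<le> 1 \<longrightarrow>
      (\<forall>u v. h (s0, a) u \<noteq> 0 \<longrightarrow> h (s0, c) v \<noteq> 0 \<longrightarrow> (\<exists>d>0. M d a c u v))" for a c
  have "Q 0 1"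
  proof (rule Bolzano)
    fix a c e assume Q: "Q a c" "Q c e" and le: "a \<le> c" "c \<le> e"
    show "Q a e"
      unfolding Q_def
    proof (intro impI allI)
      fix u v assume r: "0 \<le> a \<and> a \<le> e \<and> e \<le> 1" and u: "h (s0, a) u \<noteq> 0" and v: "h (s0, e) v \<noteq> 0"
      obtain w where w: "h (s0, c) w \<noteq> 0" using support_nonempty[OF h(2)[OF s0, of c]] r le by auto
      obtain d1 where d1: "d1 > 0" "M d1 a c u w" using Q(1) r le u w unfolding Q_def by auto
      obtain d2 where d2: "d2 > 0" "M d2 c e w v" using Q(2) r le v w unfolding Q_def by auto
      have "M (min d1 d2) a e u v"
        unfolding M_def
      proof (intro ballI impI)
        fix s assume s: "s \<in> {0..1}" "\<bar>s - s0\<bar> < min d1 d2"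
        note m1 = d1(2)[unfolded M_def, rule_format, OF s(1)]
        note m2 = d2(2)[unfolded M_def, rule_format, OF s(1)]
        have nz: "h (s, a) u \<noteq> 0" "h (s, c) w \<noteq> 0" "h (s, e) v \<noteq> 0"
          using m1 m2 s(2) by auto
        moreover have "transport L a e u v = transport L' a e u v"
          if "lift_on (\<lambda>r. h (s0, r)) 0 1 L" "lift_on (\<lambda>r. h (s, r)) 0 1 L'" for L L'
        proof -
          have "transport L a c u w = transport L' a c u w" "transport L c e w v = transport L' c e w v"
            using m1 m2 s(2) that by auto
          then show ?thesis
            using transport_trans[OF that(1), of a c e u w v] transport_trans[OF that(2), of a c e u w v]
              nz u v w r le by simp
        qed
        ultimately show "h (s, a) u \<noteq> 0 \<and> h (s, e) v \<noteq> 0 \<and> (\<forall>L L'. lift_on (\<lambda>r. h (s0, r)) 0 1 L \<longrightarrow>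
          lift_on (\<lambda>r. h (s, r)) 0 1 L' \<longrightarrow> transport L a e u v = transport L' a e u v)" by blast
      qed
      then show "\<exists>d>0. M d a e u v" using d1(1) d2(1) by (intro exI[of _ "min d1 d2"]) auto
    qed
  next
    fix r :: real assume "0 \<le> r" "r \<le> 1"
    then have r: "r \<in> {0..1}" by simp
    obtain w where w: "h (s0, r) w \<noteq> 0" using support_nonempty[OF h(2)[OF s0 r]] by blast
    obtain d where d: "d > 0"
      "\<And>s t. s \<in> {0..1} \<Longrightarrow> t \<in> {0..1} \<Longrightarrow> \<bar>s - s0\<bar> < d \<Longrightarrow> \<bar>t - r\<bar> < d \<Longrightarrow> h (s, t) w \<noteq> 0"
      using square_nhd[OF h(1) s0 r w] by blast
    have "Q a c" if ac: "a \<le> r \<and> r \<le> c \<and> c - a < d" for a c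
      unfolding Q_def
    proof (intro impI allI)
      fix u v assume le: "0 \<le> a \<and> a \<le> c \<and> c \<le> 1" and u: "h (s0, a) u \<noteq> 0" and v: "h (s0, c) v \<noteq> 0"
      have a: "a \<in> {0..1}" and c: "c \<in> {0..1}" using le by auto
      obtain d1 where d1: "d1 > 0"
        "\<And>s t. s \<in> {0..1} \<Longrightarrow> t \<in> {0..1} \<Longrightarrow> \<bar>s - s0\<bar> < d1 \<Longrightarrow> \<bar>t - a\<bar> < d1 \<Longrightarrow> h (s, t) u \<noteq> 0"
        using square_nhd[OF h(1) s0 a u] by blast
      obtain d2 where d2: "d2 > 0"
        "\<And>s t. s \<in> {0..1} \<Longrightarrow> t \<in> {0..1} \<Longrightarrow> \<bar>s - s0\<bar> < d2 \<Longrightarrow> \<bar>t - c\<bar> < d2 \<Longrightarrow> h (s, t) v \<noteq> 0"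
        using square_nhd[OF h(1) s0 c v] by blast
      define d3 where "d3 = min d (min d1 d2)"
      have "M d3 a c u v"
        unfolding M_def
      proof (intro ballI impI)
        fix s assume s: "s \<in> {0..1}" "\<bar>s - s0\<bar> < d3"
        have nz: "h (s, a) u \<noteq> 0" "h (s, c) v \<noteq> 0"
          using d1(2)[OF s(1) a] d2(2)[OF s(1) c] s(2) d1(1) d2(1) by (auto simp: d3_def)
        have star: "h (s', t) w \<noteq> 0" if "a \<le> t" "t \<le> c" "s' \<in> {0..1}" "\<bar>s' - s0\<bar> < d" for t s'
          using that ac le by (intro d(2)) auto
        have "transport L a c u v = \<phi> u w \<otimes> \<phi> w v" if "lift_on (\<lambda>r. h (s0, r)) 0 1 L" for L
          using le h(2)[OF s0] a c u v s0 d(1) by (intro transport_star[OF that] star) auto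
        moreover have "transport L a c u v = \<phi> u w \<otimes> \<phi> w v" if "lift_on (\<lambda>r. h (s, r)) 0 1 L" for L
          using le h(2)[OF s(1)] a c nz s by (intro transport_star[OF that] star) (auto simp: d3_def)
        ultimately show "h (s, a) u \<noteq> 0 \<and> h (s, c) v \<noteq> 0 \<and> (\<forall>L L'. lift_on (\<lambda>r. h (s0, r)) 0 1 L \<longrightarrow>
          lift_on (\<lambda>r. h (s, r)) 0 1 L' \<longrightarrow> transport L a c u v = transport L' a c u v)" using nz by simp
      qed
      then show "\<exists>d>0. M d a c u v" using d(1) d1(1) d2(1) by (intro exI[of _ d3]) (auto simp: d3_def)
    qed
    with d(1) show "\<exists>d>0. \<forall>a c. a \<le> r \<and> r \<le> c \<and> c - a < d \<longrightarrow> Q a c" by blast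
  qed simp
  then obtain d where "d > 0" "M d 0 1 u v" using u v by (auto simp: Q_def)
  then show ?thesis unfolding M_def by blast
qed

section \<open>Holonomy of paths\<close>

definition hol :: "(real \<Rightarrow> 'v \<Rightarrow> real) \<Rightarrow> 'v \<Rightarrow> 'v \<Rightarrow> 'h" where
  "hol p u v = transport (SOME L. lift_on p 0 1 L) 0 1 u v"

text \<open>Stability along the constant homotopy, taken at level 0 with two different lifts, says
  that the chosen lift may be replaced by any other.\<close>

lemma hol_lift:
  assumes p: "path p" "path_image p \<subseteq> \<R>" and uv: "p 0 u \<noteq> 0" "p 1 v \<noteq> 0" and L: "lift_on p 0 1 L"
  shows "hol p u v = transport L 0 1 u v"
proof -
  have s: "lift_on p 0 1 (SOME L. lift_on p 0 1 L)"
    using lift_exists[OF p] by (rule someI_ex)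
  have "continuous_on ({0..1} \<times> {0..1}) (\<lambda>z::real \<times> real. p (snd z))"
    using p(1) unfolding path_def by (rule continuous_on_compose2) (auto intro!: continuous_intros)
  then have "\<exists>d>0. \<forall>s::real\<in>{0..1}. \<bar>s - 0\<bar> < d \<longrightarrow> (\<forall>L L'. lift_on (\<lambda>r. p (snd (0::real, r))) 0 1 L \<longrightarrow>
      lift_on (\<lambda>r. p (snd (s, r))) 0 1 L' \<longrightarrow> transport L 0 1 u v = transport L' 0 1 u v)"
    by (rule transport_stable) (use p(2) uv in \<open>auto simp: path_image_def\<close>)
  then obtain d where d: "d > 0" "\<forall>s::real\<in>{0..1}. \<bar>s - 0\<bar> < d \<longrightarrow> (\<forall>L L'. lift_on p 0 1 L \<longrightarrow>
      lift_on p 0 1 L' \<longrightarrow> transport L 0 1 u v = transport L' 0 1 u v)"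
    unfolding snd_conv by blast
  show ?thesis
    unfolding hol_def by (rule d(2)[rule_format, of 0, OF _ _ s L]) (use d(1) in auto)
qed

lemma hol_carrier:
  assumes p: "path p" "path_image p \<subseteq> \<R>" and uv: "p 0 u \<noteq> 0" "p 1 v \<noteq> 0"
  shows "hol p u v \<in> carrier H"
proof -
  obtain L where L: "lift_on p 0 1 L" using lift_exists[OF p] by blast
  show ?thesis
    unfolding hol_lift[OF p uv L] transport_def using lift_onD(1)[OF L] uv by simp
qed

lemma lift_cong:
  assumes L: "lift_on p 0 1 L" and eq: "\<And>r. r \<in> {0..1} \<Longrightarrow> p r = q r"
  shows "lift_on q 0 1 L"
  unfolding lift_on_def
proof (intro conjI ballI allI impI)
  fix r u assume r: "r \<in> {0..1::real}" and u: "q r u \<noteq> 0"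
  then show "L r u \<in> carrier H" using lift_onD(1)[OF L, of r u] eq[OF r] by auto
  fix v assume "q r v \<noteq> 0"
  then show "L r v = L r u \<otimes> \<phi> u v" using lift_onD(2)[OF L, of r u v] eq[OF r] r u by auto
next
  fix u and s t :: real assume "0 \<le> s" "s \<le> t" "t \<le> 1" "\<forall>r\<in>{s..t}. q r u \<noteq> 0"
  then show "L s u = L t u" using eq by (intro lift_onD(3)[OF L]) auto
qed

lemma hol_cong:
  assumes p: "path p" "path_image p \<subseteq> \<R>" and uv: "p 0 u \<noteq> 0" "p 1 v \<noteq> 0"
    and eq: "\<And>r. r \<in> {0..1} \<Longrightarrow> p r = q r"
  shows "hol p u v = hol q u v"
proof -
  have "lift_on p 0 1 L \<longleftrightarrow> lift_on q 0 1 L" for L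
    using lift_cong[of p L q] lift_cong[of q L p] eq by auto
  then show ?thesis by (simp add: hol_def)
qed

text \<open>All levels of the homotopy have the same ends, so \<open>u\<close> and \<open>v\<close>
  serve for each of them. Holonomy is then locally constant in the homotopy parameter, and bisection
  makes it constant.\<close>

lemma hol_homotopic:
  assumes hom: "homotopic_paths \<R> p q" and uv: "p 0 u \<noteq> 0" "p 1 v \<noteq> 0"
  shows "hol p u v = hol q u v"
proof -
  obtain h :: "real \<times> real \<Rightarrow> 'v \<Rightarrow> real" where
    h: "continuous_on ({0..1} \<times> {0..1}) h" "h \<in> ({0..1} \<times> {0..1}) \<rightarrow> \<R>"
    and h01: "\<forall>r\<in>{0..1}. h (0, r) = p r" "\<forall>r\<in>{0..1}. h (1, r) = q r"
    and ends: "\<forall>t\<in>{0..1}. pathstart (h \<circ> Pair t) = pathstart p" "\<forall>t\<in>{0..1}. pathfinish (h \<circ> Pair t) = pathfinish p"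
    using hom unfolding homotopic_paths by auto
  have hR: "h (s, r) \<in> \<R>" if "s \<in> {0..1}" "r \<in> {0..1}" for s r
    using h(2) that by auto
  define P where "P s = (\<lambda>r. h (s, r))" for s
  have P: "path (P s)" "path_image (P s) \<subseteq> \<R>" "P s 0 u \<noteq> 0" "P s 1 v \<noteq> 0" if "s \<in> {0..1}" for s
  proof -
    show "path (P s)"
      unfolding path_def P_def using h(1) by (rule continuous_on_compose2) (use that in \<open>auto intro!: continuous_intros\<close>)
    show "path_image (P s) \<subseteq> \<R>" using h(2) that by (auto simp: P_def path_image_def)
    show "P s 0 u \<noteq> 0" "P s 1 v \<noteq> 0"
      using ends that uv by (auto simp: P_def pathstart_def pathfinish_def)
  qed
  define Q where "Q a c \<longleftrightarrow> 0 \<le> a \<and> a \<le> c \<and> c \<le> 1 \<longrightarrow> hol (P a) u v = hol (P c) u v" for a c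
  have "Q 0 1"
  proof (rule Bolzano)
    fix s0 :: real assume "0 \<le> s0" "s0 \<le> 1"
    then have s0: "s0 \<in> {0..1}" by simp
    obtain d where d: "d > 0" "\<forall>s\<in>{0..1}. \<bar>s - s0\<bar> < d \<longrightarrow> (\<forall>L L'. lift_on (\<lambda>r. h (s0, r)) 0 1 L \<longrightarrow>
      lift_on (\<lambda>r. h (s, r)) 0 1 L' \<longrightarrow> transport L 0 1 u v = transport L' 0 1 u v)"
      using transport_stable[OF h(1) hR s0, of u v] P(3,4)[OF s0] unfolding P_def by blast
    have near: "hol (P s) u v = hol (P s0) u v" if s: "s \<in> {0..1}" "\<bar>s - s0\<bar> < d" for s
    proof -
      obtain L L' where L: "lift_on (P s0) 0 1 L" "lift_on (P s) 0 1 L'"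
        using lift_exists P s0 s by metis
      then show ?thesis
        using hol_lift[OF P[OF s0] L(1)] hol_lift[OF P[OF s(1)] L(2)] d(2) s by (simp add: P_def)
    qed
    have "Q a c" if "a \<le> s0 \<and> s0 \<le> c \<and> c - a < d" for a c
      using near[of a] near[of c] that by (auto simp: Q_def)
    with d(1) show "\<exists>d>0. \<forall>a c. a \<le> s0 \<and> s0 \<le> c \<and> c - a < d \<longrightarrow> Q a c" by blast
  qed (auto simp: Q_def)
  then have "hol (P 0) u v = hol (P 1) u v" by (simp add: Q_def)
  moreover have "hol (P 0) u v = hol p u v" "hol (P 1) u v = hol q u v"
    using h01 by (intro hol_cong P; simp add: P_def)+
  ultimately show ?thesis by simp
qed

lemma hol_join:
  assumes p: "path p" "path_image p \<subseteq> \<R>" and q: "path q" "path_image q \<subseteq> \<R>" and pq: "pathfinish p = pathstart q"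
    and u: "p 0 u \<noteq> 0" and v: "p 1 v \<noteq> 0" and w: "q 1 w \<noteq> 0"
  shows "hol (p +++ q) u w = hol p u v \<otimes> hol q v w"
proof -
  have j: "path (p +++ q)" "path_image (p +++ q) \<subseteq> \<R>" using p q pq by (auto simp: path_image_join)
  obtain L where L: "lift_on (p +++ q) 0 1 L" using lift_exists[OF j] by blast
  have p1: "p 1 = q 0" using pq by (simp add: pathstart_def pathfinish_def)
  have jl: "(p +++ q) (r / 2) = p r" if "r \<le> 1" for r
    using that by (simp add: joinpaths_def)
  have jr: "(p +++ q) ((r + 1) / 2) = q r" if "0 \<le> r" for r
    using that p1 by (cases "r = 0") (auto simp: joinpaths_def add_divide_distrib)
  \<comment> \<open>A lift of the joined path, with the parameter rescaled, restricts to lifts of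
    both halves; the transports are then composed at time 1/2.\<close>
  have "lift_on p 0 1 (\<lambda>r. L (r / 2))"
    unfolding lift_on_def
  proof (intro conjI ballI allI impI)
    fix r u assume r: "r \<in> {0..1::real}" and u: "p r u \<noteq> 0"
    then show "L (r / 2) u \<in> carrier H" using lift_onD(1)[OF L, of "r / 2" u] jl by simp
    fix v assume "p r v \<noteq> 0"
    then show "L (r / 2) v = L (r / 2) u \<otimes> \<phi> u v" using r u lift_onD(2)[OF L, of "r / 2" u v] jl by simp
  next
    fix u and s t :: real assume st: "0 \<le> s" "s \<le> t" "t \<le> 1" and star: "\<forall>r\<in>{s..t}. p r u \<noteq> 0"
    have "(p +++ q) r u \<noteq> 0" if "s / 2 \<le> r" "r \<le> t / 2" for r
      using jl[of "2 * r"] star that st by auto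
    then show "L (s / 2) u = L (t / 2) u" using st by (intro lift_onD(3)[OF L]) auto
  qed
  moreover have "lift_on q 0 1 (\<lambda>r. L ((r + 1) / 2))"
    unfolding lift_on_def
  proof (intro conjI ballI allI impI)
    fix r u assume r: "r \<in> {0..1::real}" and u: "q r u \<noteq> 0"
    then show "L ((r + 1) / 2) u \<in> carrier H" using lift_onD(1)[OF L, of "(r + 1) / 2" u] jr by simp
    fix v assume "q r v \<noteq> 0"
    then show "L ((r + 1) / 2) v = L ((r + 1) / 2) u \<otimes> \<phi> u v"
      using r u lift_onD(2)[OF L, of "(r + 1) / 2" u v] jr by simp
  next
    fix u and s t :: real assume st: "0 \<le> s" "s \<le> t" "t \<le> 1" and star: "\<forall>r\<in>{s..t}. q r u \<noteq> 0"
    have "(p +++ q) r u \<noteq> 0" if "(s + 1) / 2 \<le> r" "r \<le> (t + 1) / 2" for r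
      using jr[of "2 * r - 1"] star that st by auto
    then show "L ((s + 1) / 2) u = L ((t + 1) / 2) u" using st by (intro lift_onD(3)[OF L]) auto
  qed
  ultimately have "hol p u v = transport L 0 (1/2) u v" "hol q v w = transport L (1/2) 1 v w"
    using hol_lift[OF p u v] hol_lift[OF q _ w, of v] v p1 by (simp_all add: transport_def)
  moreover have nz: "(p +++ q) 0 u \<noteq> 0" "(p +++ q) (1/2) v \<noteq> 0" "(p +++ q) 1 w \<noteq> 0"
    using u v w by (auto simp: joinpaths_def)
  moreover have "hol (p +++ q) u w = transport L 0 1 u w"
    by (rule hol_lift[OF j nz(1,3) L])
  ultimately show ?thesis
    using transport_trans[OF L, of 0 "1/2" 1 u v w] by simp
qed

lemma hol_const:
  assumes "y \<in> \<R>" "y u \<noteq> 0" "y v \<noteq> 0"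
  shows "hol (\<lambda>_. y) u v = \<phi> u v"
proof -
  have 1: "{u} \<in> K" using support_vertex assms by blast
  have "lift_on (\<lambda>_. y) 0 1 (\<lambda>_. \<phi> u)"
    by (rule lift_star) (use assms in auto)
  then have "hol (\<lambda>_. y) u v = transport (\<lambda>_. \<phi> u) 0 1 u v"
    using assms by (intro hol_lift) (auto simp: path_const)
  then show ?thesis
    using cocycle_same[OF \<phi> H 1] \<phi>_support(1)[OF assms] by (simp add: transport_def)
qed

lemma hol_reversepath:
  assumes p: "path p" "path_image p \<subseteq> \<R>" and uv: "p 0 u \<noteq> 0" "p 1 v \<noteq> 0"
  shows "hol (reversepath p) v u = inv (hol p u v)"
proof -
  have r: "reversepath p 0 = p 1" "reversepath p 1 = p 0" by (auto simp: reversepath_def)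
  have "hol p u v \<otimes> hol (reversepath p) v u = hol (p +++ reversepath p) u u"
    using p uv r by (intro hol_join[symmetric]) auto
  also have "\<dots> = hol (\<lambda>_. p 0) u u"
    using p uv r by (intro hol_homotopic homotopic_paths_rinv_const)
      (auto simp: pathstart_def joinpaths_def)
  also have "\<dots> = \<one>"
  proof -
    have "p 0 \<in> \<R>" using p by (auto simp: path_image_def)
    then show ?thesis
      using hol_const[of "p 0" u u] uv cocycle_same[OF \<phi> H support_vertex] by simp
  qed
  finally have "hol p u v \<otimes> hol (reversepath p) v u = \<one>" .
  then show ?thesis
    using hol_carrier[OF p uv] hol_carrier[of "reversepath p" v u] p uv r
    by (metis H.inv_equality H.inv_inv path_image_reversepath path_reversepath)
qed

text \<open>The first half of the segment lies in the star of \<open>u\<close> and the second in the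
  star of \<open>v\<close>, so both transports are known from \<phi>.\<close>

lemma hol_edge:
  assumes e: "{u, v} \<in> K"
  shows "hol (segment (vertex_point u) (vertex_point v)) u v = \<phi> u v"
proof -
  let ?p = "segment (vertex_point u) (vertex_point v)"
  have p: "path ?p" "path_image ?p \<subseteq> \<R>"
    by (rule path_segment, rule segment_image[OF e]) (auto intro: vertex_point_cell)
  obtain L where L: "lift_on ?p 0 1 L" using lift_exists[OF p] by blast
  have 1: "?p r u \<noteq> 0" if "0 \<le> r" "r \<le> 1/2" for r
    using that by (auto simp: segment_def vertex_point_def)
  have 2: "?p r v \<noteq> 0" if "1/2 \<le> r" "r \<le> 1" for r
    using that by (auto simp: segment_def vertex_point_def)
  have pR: "?p (1/2) \<in> \<R>" "?p 0 \<in> \<R>" "?p 1 \<in> \<R>"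
    using p(2) by (force simp: path_image_def image_subset_iff simp del: segment_ends)+
  have "hol ?p u v = transport L 0 1 u v"
    using L by (intro hol_lift p) auto
  also have "\<dots> = transport L 0 (1/2) u v \<otimes> transport L (1/2) 1 v v"
    using transport_trans[OF L, of 0 "1/2" 1 u v v] 2 by simp
  also have "transport L 0 (1/2) u v = \<phi> u u \<otimes> \<phi> u v"
    using 1 2 pR by (intro transport_star[OF L]) auto
  also have "transport L (1/2) 1 v v = \<phi> v v \<otimes> \<phi> v v"
    using 2 pR by (intro transport_star[OF L]) auto
  finally show ?thesis
    using cocycle_same[OF \<phi> H in_vertex[OF e]] cocycleD(1)[OF \<phi> e, of u v] by simp
qed

end

section \<open>The homomorphism defined by a normalized cocycle\<close>

locale rooted_cocycle = rooted_complex K x b par rk + complex_cocycle K H \<phi>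
  for K :: "'v set set" and x b par rk and H :: "('h, 'k) monoid_scheme" (structure) and \<phi> +
  assumes normalized: "{v} \<in> K \<Longrightarrow> v \<noteq> b \<Longrightarrow> \<phi> (par v) v = \<one>"
begin

definition base_star :: 'v where
  "base_star = (SOME u. x u \<noteq> 0)"

text \<open>Holonomy from the root to \<open>y\<close> by way of the base point. It records the
  effect of the arbitrary reference paths and has to cancel in the value of an edge class.\<close>

definition ref_hol :: "('v \<Rightarrow> real) \<Rightarrow> 'v \<Rightarrow> 'h" where
  "ref_hol y u = inv (hol (ref_path (vertex_point b)) base_star b) \<otimes> hol (ref_path y) base_star u"

text \<open>The conjugating factor moves the fibre from the base point to the root. With it an edge
  class is sent to \<open>\<phi> u v\<close> itself and not merely to a conjugate.\<close>

definition hol_class :: "(real \<Rightarrow> 'v \<Rightarrow> real) set \<Rightarrow> 'h" where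
  "hol_class A = inv (hol (ref_path (vertex_point b)) base_star b) \<otimes>
     hol (SOME p. p \<in> loops_at \<R> x \<and> A = loop_class \<R> p) base_star base_star \<otimes>
     hol (ref_path (vertex_point b)) base_star b"

lemma base_star: "x base_star \<noteq> 0"
  unfolding base_star_def using support_nonempty[OF x] by (rule someI_ex)

lemma ref_path_01: "y \<in> \<R> \<Longrightarrow> ref_path y 0 = x" "y \<in> \<R> \<Longrightarrow> ref_path y 1 = y"
  using ref_path(3,4)[of y] by (auto simp: pathstart_def pathfinish_def)

lemma ref_path_hol: "y \<in> \<R> \<Longrightarrow> y u \<noteq> 0 \<Longrightarrow> hol (ref_path y) base_star u \<in> carrier H"
  using hol_carrier[OF ref_path(1,2)] ref_path_01 base_star by simp

lemma root_point: "vertex_point b \<in> \<R>"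
  by (rule vertex_point_realization[OF root(1)])

lemma hol_class_loop:
  assumes p: "p \<in> loops_at \<R> x"
  shows "hol_class (loop_class \<R> p) = inv (hol (ref_path (vertex_point b)) base_star b) \<otimes>
     hol p base_star base_star \<otimes> hol (ref_path (vertex_point b)) base_star b"
proof -
  define q where "q = (SOME q. q \<in> loops_at \<R> x \<and> loop_class \<R> p = loop_class \<R> q)"
  have q: "q \<in> loops_at \<R> x \<and> loop_class \<R> p = loop_class \<R> q"
    unfolding q_def by (rule someI[of _ p]) (use p in simp)
  have "homotopic_paths \<R> p q"
    using q p loop_class_eq_iff[of p \<R> q] by (auto simp: loops_at_def)
  moreover have "p 0 = x" "p 1 = x" using p by (auto simp: loops_at_def pathstart_def pathfinish_def)
  ultimately have "hol p base_star base_star = hol q base_star base_star"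
    using base_star by (intro hol_homotopic) auto
  then show ?thesis
    unfolding hol_class_def q_def[symmetric] by simp
qed

lemma loop_hol:
  assumes "p \<in> loops_at \<R> x"
  shows "hol p base_star base_star \<in> carrier H"
  using assms base_star by (intro hol_carrier) (auto simp: loops_at_def pathstart_def pathfinish_def)

lemma hol_class_hom: "hol_class \<in> hom \<pi> H"
proof (rule homI)
  note r = ref_path_hol[OF root_point, of b]
  fix A assume "A \<in> carrier \<pi>"
  then obtain p where p: "A = loop_class \<R> p" "p \<in> loops_at \<R> x"
    by (auto simp: fundamental_group_simps)
  show "hol_class A \<in> carrier H"
    using r loop_hol[OF p(2)] by (simp add: p(1) hol_class_loop[OF p(2)])
  fix B assume "B \<in> carrier \<pi>"
  then obtain q where q: "B = loop_class \<R> q" "q \<in> loops_at \<R> x"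
    by (auto simp: fundamental_group_simps)
  have "hol (p +++ q) base_star base_star = hol p base_star base_star \<otimes> hol q base_star base_star"
    using p(2) q(2) base_star
    by (intro hol_join) (auto simp: loops_at_def pathstart_def pathfinish_def)
  then show "hol_class (A \<otimes>\<^bsub>\<pi>\<^esub> B) = hol_class A \<otimes> hol_class B"
    using p q r loop_hol[OF p(2)] loop_hol[OF q(2)]
    by (simp add: fundamental_group_mult hol_class_loop loops_at_join H.m_assoc H.inv_cancel)
qed

lemma ref_hol_carrier: "y \<in> \<R> \<Longrightarrow> y u \<noteq> 0 \<Longrightarrow> ref_hol y u \<in> carrier H"
  unfolding ref_hol_def using ref_path_hol ref_path_hol[OF root_point, of b] by simp

lemma ref_hol_root: "ref_hol (vertex_point b) b = \<one>"
  unfolding ref_hol_def using ref_path_hol[OF root_point, of b] by simp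

lemma hol_class_closed_up:
  assumes p: "path p" "path_image p \<subseteq> \<R>" and uv: "p 0 u \<noteq> 0" "p 1 v \<noteq> 0"
  shows "hol_class (closed_up p) = ref_hol (p 0) u \<otimes> hol p u v \<otimes> inv (ref_hol (p 1) v)"
proof -
  have R: "p 0 \<in> \<R>" "p 1 \<in> \<R>" using p by (auto simp: path_image_def)
  have e: "pathstart p = p 0" "pathfinish p = p 1" by (auto simp: pathstart_def pathfinish_def)
  define f where "f = ref_path (p 0)"
  define g where "g = ref_path (p 1)"
  note fg = ref_path[OF R(1), folded f_def] ref_path[OF R(2), folded g_def]
  have f01: "f 0 = x" "f 1 = p 0" "g 0 = x" "g 1 = p 1"
    using ref_path_01 R by (auto simp: f_def g_def)
  have r01: "reversepath g 0 = p 1" "reversepath g 1 = x"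
    using f01 by (auto simp: reversepath_def)
  have j01: "(p +++ reversepath g) 1 = x"
    using r01 by (simp add: joinpaths_def)
  have j: "hol (p +++ reversepath g) u base_star = hol p u v \<otimes> hol (reversepath g) v base_star"
    using p fg e uv r01 base_star by (intro hol_join) auto
  have "hol (f +++ p +++ reversepath g) base_star base_star =
      hol f base_star u \<otimes> hol (p +++ reversepath g) u base_star"
    using p fg e uv f01 r01 j01 base_star
    by (intro hol_join) (auto simp: path_image_join)
  also have "\<dots> = hol f base_star u \<otimes> (hol p u v \<otimes> inv (hol g base_star v))"
    unfolding j using fg f01 uv base_star by (subst hol_reversepath) auto
  finally have h: "hol (f +++ p +++ reversepath g) base_star base_star =
      hol f base_star u \<otimes> (hol p u v \<otimes> inv (hol g base_star v))" .
  have c: "hol f base_star u \<in> carrier H" "hol g base_star v \<in> carrier H" "hol p u v \<in> carrier H"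
    using ref_path_hol R uv hol_carrier[OF p uv] by (auto simp: f_def g_def)
  note r = ref_path_hol[OF root_point, of b]
  have loop: "f +++ p +++ reversepath g \<in> loops_at \<R> x"
    using closed_up_loops[OF p] by (simp add: e f_def g_def)
  show ?thesis
    unfolding closed_up_def e f_def[symmetric] g_def[symmetric] hol_class_loop[OF loop] h ref_hol_def
    using c r by (simp add: H.m_assoc H.inv_mult_group)
qed

lemma hol_class_seg:
  assumes e: "{u, v} \<in> K"
  shows "hol_class (seg_class (vertex_point u) (vertex_point v)) =
    ref_hol (vertex_point u) u \<otimes> \<phi> u v \<otimes> inv (ref_hol (vertex_point v) v)"
proof -
  have "path_image (segment (vertex_point u) (vertex_point v)) \<subseteq> \<R>"
    by (rule segment_image[OF e]) (auto intro: vertex_point_cell)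
  from hol_class_closed_up[OF path_segment this, of u v] show ?thesis
    by (simp add: seg_class_def hol_edge[OF e])
qed

sublocale hol_class: group_hom \<pi> H hol_class
  by unfold_locales (rule hol_class_hom)

lemma vertex_hol: "{v} \<in> K \<Longrightarrow> ref_hol (vertex_point v) v \<in> carrier H"
  by (rule ref_hol_carrier[OF vertex_point_realization]) auto

text \<open>A normalized cocycle contributes nothing along the tree, so only the inverse of the
  reference factor at \<open>v\<close> survives. In \<open>hol_class_edge\<close> it cancels against
  the reference factors of the segment.\<close>

lemma hol_class_tree: "{v} \<in> K \<Longrightarrow> hol_class (tree_class v) = inv (ref_hol (vertex_point v) v)"
proof (induction rule: vertex_induct)
  case root
  then show ?case by (simp add: tree_class_root ref_hol_root)
next
  case (step v)
  note c = vertex_hol[OF step(1)] vertex_hol[OF step(3)]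
  have "hol_class (tree_class v) = hol_class (tree_class (par v)) \<otimes>
      hol_class (seg_class (vertex_point (par v)) (vertex_point v))"
    using vertex_seg_carrier[OF step(4)] tree_class_carrier[OF step(3)]
    by (simp add: tree_class_par[OF step(1,2)])
  also have "\<dots> = inv (ref_hol (vertex_point v) v)"
    unfolding step(5) hol_class_seg[OF step(4)] using c normalized[OF step(1,2)]
    by (simp add: H.m_assoc H.inv_cancel)
  finally show ?case .
qed

theorem hol_class_edge:
  assumes e: "{u, v} \<in> K"
  shows "hol_class (edge_class u v) = \<phi> u v"
proof -
  have uv: "{u} \<in> K" "{v} \<in> K" using in_vertex[OF e] by auto
  have "hol_class (edge_class u v) = hol_class (tree_class u) \<otimes>
      hol_class (seg_class (vertex_point u) (vertex_point v)) \<otimes> inv (hol_class (tree_class v))"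
    unfolding edge_class_def using vertex_seg_carrier[OF e] tree_class_carrier[OF uv(1)] tree_class_carrier[OF uv(2)]
    by simp
  also have "\<dots> = \<phi> u v"
    unfolding hol_class_tree[OF uv(1)] hol_class_tree[OF uv(2)] hol_class_seg[OF e]
    using vertex_hol[OF uv(1)] vertex_hol[OF uv(2)] cocycleD(1)[OF \<phi> e, of u v]
    by (simp add: H.m_assoc H.inv_cancel)
  finally show ?thesis .
qed

end

text \<open>Triangle relations and triviality on the tree are the only constraints for prescribing a
  homomorphism on edge classes. Together with \<open>edge_classes_generate\<close> this is the
  universal property by which the fundamental group is handled from here on.\<close>

theorem (in rooted_complex) cocycle_hom:
  assumes "group H" "cocycle K H \<phi>" "\<And>v. {v} \<in> K \<Longrightarrow> v \<noteq> b \<Longrightarrow> \<phi> (par v) v = \<one>\<^bsub>H\<^esub>"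
  obtains \<Phi> where "\<Phi> \<in> hom \<pi> H" "\<And>u v. {u, v} \<in> K \<Longrightarrow> \<Phi> (edge_class u v) = \<phi> u v"
proof -
  interpret rooted_cocycle K x b par rk H \<phi>
    by (intro rooted_cocycle.intro complex_cocycle.intro complex_cocycle_axioms.intro
        rooted_cocycle_axioms.intro rooted_complex_axioms two_complex_axioms assms)
  show ?thesis
    using that[OF hol_class_hom hol_class_edge] .
qed

section \<open>Words and presentations\<close>

definition letter_val :: "('a, 'c) monoid_scheme \<Rightarrow> ('x \<Rightarrow> 'a) \<Rightarrow> 'x \<times> bool \<Rightarrow> 'a" where
  "letter_val G f a = (if snd a then f (fst a) else inv\<^bsub>G\<^esub> (f (fst a)))"

primrec word_val :: "('a, 'c) monoid_scheme \<Rightarrow> ('x \<Rightarrow> 'a) \<Rightarrow> 'x word \<Rightarrow> 'a" where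
  "word_val G f [] = \<one>\<^bsub>G\<^esub>"
| "word_val G f (a # w) = letter_val G f a \<otimes>\<^bsub>G\<^esub> word_val G f w"

context group
begin

lemma letter_val_closed: "f (fst a) \<in> carrier G \<Longrightarrow> letter_val G f a \<in> carrier G"
  by (simp add: letter_val_def)

lemma letter_val_inv: "f (fst a) \<in> carrier G \<Longrightarrow> letter_val G f (inv_letter a) = inv letter_val G f a"
  by (simp add: letter_val_def inv_letter_def)

lemma word_val_closed: "(\<And>i. i \<in> fst ` set w \<Longrightarrow> f i \<in> carrier G) \<Longrightarrow> word_val G f w \<in> carrier G"
  by (induction w) (auto intro!: letter_val_closed m_closed)

lemma word_val_append:
  "(\<And>i. i \<in> fst ` set (u @ w) \<Longrightarrow> f i \<in> carrier G) \<Longrightarrow>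
    word_val G f (u @ w) = word_val G f u \<otimes> word_val G f w"
proof (induction u)
  case (Cons a u)
  then have "letter_val G f a \<in> carrier G" "word_val G f u \<in> carrier G" "word_val G f w \<in> carrier G"
    by (auto intro!: word_val_closed letter_val_closed)
  with Cons show ?case by (simp add: m_assoc)
qed (simp add: word_val_closed)

lemma word_val_push_letter:
  assumes "\<And>i. i \<in> insert (fst a) (fst ` set w) \<Longrightarrow> f i \<in> carrier G"
  shows "word_val G f (push_letter a w) = letter_val G f a \<otimes> word_val G f w"
proof (cases w)
  case (Cons b v)
  have "word_val G f v \<in> carrier G" "letter_val G f a \<in> carrier G"
    using assms Cons by (auto intro!: word_val_closed letter_val_closed)
  then show ?thesis
    using Cons assms by (auto simp: letter_val_inv inv_cancel)
qed simp

lemma word_val_foldr_push: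
  assumes "\<And>i. i \<in> fst ` set (u @ w) \<Longrightarrow> f i \<in> carrier G"
  shows "word_val G f (foldr push_letter u w) = word_val G f u \<otimes> word_val G f w"
  using assms
proof (induction u)
  case (Cons a u)
  have "fst ` set (foldr push_letter u w) \<subseteq> fst ` set (u @ w)"
    using set_foldr_push[of u w] by auto
  then have "word_val G f (foldr push_letter (a # u) w) =
      letter_val G f a \<otimes> word_val G f (foldr push_letter u w)"
    using Cons.prems by (simp, intro word_val_push_letter) auto
  moreover have "letter_val G f a \<in> carrier G" "word_val G f u \<in> carrier G" "word_val G f w \<in> carrier G"
    using Cons.prems by (auto intro!: word_val_closed letter_val_closed)
  ultimately show ?case using Cons by (simp add: m_assoc)
qed (simp add: word_val_closed)

end

lemma free_group_simps:
  "w \<in> carrier (free_group B) \<longleftrightarrow> freely_reduced w \<and> fst ` set w \<subseteq> B"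
  "\<one>\<^bsub>free_group B\<^esub> = []"
  "u \<otimes>\<^bsub>free_group B\<^esub> w = foldr push_letter u w"
  by (auto simp: free_group_def)

lemma word_val_hom:
  assumes "group G" "\<And>i. i \<in> B \<Longrightarrow> f i \<in> carrier G"
  shows "word_val G f \<in> hom (free_group B) G"
proof (rule homI)
  interpret group G by fact
  fix u assume u: "u \<in> carrier (free_group B)"
  then show "word_val G f u \<in> carrier G"
    using assms(2) by (intro word_val_closed) (auto simp: free_group_simps)
  fix w assume w: "w \<in> carrier (free_group B)"
  then show "word_val G f (u \<otimes>\<^bsub>free_group B\<^esub> w) = word_val G f u \<otimes>\<^bsub>G\<^esub> word_val G f w"
    unfolding free_group_simps using u assms(2) by (intro word_val_foldr_push) (auto simp: free_group_simps)
qed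

lemma generator_carrier: "i \<in> B \<Longrightarrow> [(i, s)] \<in> carrier (free_group B)"
  by (auto simp: free_group_simps)

lemma inv_generator:
  assumes "i \<in> B"
  shows "inv\<^bsub>free_group B\<^esub> [(i, True)] = [(i, False)]"
proof -
  interpret group "free_group B" by (rule group_free_group)
  show ?thesis
    by (rule inv_equality) (use assms in \<open>auto simp: free_group_simps inv_letter_def\<close>)
qed

lemma hom_word_val:
  assumes G: "group G" and h: "h \<in> hom (free_group B) G" and w: "w \<in> carrier (free_group B)"
  shows "h w = word_val G (\<lambda>i. h [(i, True)]) w"
proof -
  interpret group_hom "free_group B" G h
    using assms by (simp add: group_hom_def group_hom_axioms_def group_free_group)
  show ?thesis
    using w
  proof (induction w)
    case Nil
    then show ?case using hom_one by (simp add: free_group_simps)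
  next
    case (Cons a w)
    have i: "fst a \<in> B" and w: "w \<in> carrier (free_group B)"
      using Cons.prems reduced_ConsD[of a w] by (auto simp: free_group_simps)
    have aw: "a # w = [a] \<otimes>\<^bsub>free_group B\<^esub> w"
      using Cons.prems by (simp add: free_group_simps push_letter_reduced)
    have "h [a] = letter_val G (\<lambda>i. h [(i, True)]) a"
    proof (cases "snd a")
      case True
      then have "a = (fst a, True)" by (simp add: prod_eq_iff)
      then show ?thesis using True by (simp add: letter_val_def)
    next
      case False
      then have "[a] = inv\<^bsub>free_group B\<^esub> [(fst a, True)]"
        using inv_generator[OF i] by (simp add: prod_eq_iff)
      then show ?thesis using False generator_carrier[OF i, of True] by (simp add: letter_val_def)
    qed
    moreover have "[a] \<in> carrier (free_group B)" using generator_carrier[OF i, of "snd a"] by simp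
    moreover have "h (a # w) = h [a] \<otimes>\<^bsub>G\<^esub> h w"
      unfolding aw using calculation(2) w by simp
    ultimately show ?case using Cons.IH[OF w] by simp
  qed
qed

lemma word_val_cong:
  "(\<And>i. i \<in> fst ` set w \<Longrightarrow> f i = g i) \<Longrightarrow> word_val G f w = word_val G g w"
  by (induction w) (auto simp: letter_val_def)

lemma word_val_in_generate:
  assumes "group G" "\<And>i. i \<in> fst ` set w \<Longrightarrow> f i \<in> A"
  shows "word_val G f w \<in> generate G A"
  using assms(2)
proof (induction w)
  case (Cons a w)
  then have "letter_val G f a \<in> generate G A"
    by (auto simp: letter_val_def intro: generate.incl generate.inv)
  with Cons show ?case by (auto intro: generate.eng)
qed (auto intro: generate.one)

subsection \<open>Normal closures\<close>

context group
begin

lemma normal_closure_normal: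
  assumes "R \<subseteq> carrier G"
  shows "normal_closure G R \<lhd> G"
  unfolding normal_closure_def
proof (rule normal_generateI)
  show "{g \<otimes> r \<otimes> inv g |g r. g \<in> carrier G \<and> r \<in> R} \<subseteq> carrier G"
    using assms by auto
  fix h k assume "h \<in> {g \<otimes> r \<otimes> inv g |g r. g \<in> carrier G \<and> r \<in> R}" and k: "k \<in> carrier G"
  then obtain g r where h: "h = g \<otimes> r \<otimes> inv g" "g \<in> carrier G" "r \<in> R" by auto
  have "k \<otimes> h \<otimes> inv k = (k \<otimes> g) \<otimes> r \<otimes> inv (k \<otimes> g)"
    using h k assms by (auto simp: m_assoc inv_mult_group)
  with h k show "k \<otimes> h \<otimes> inv k \<in> {g \<otimes> r \<otimes> inv g |g r. g \<in> carrier G \<and> r \<in> R}" by blast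
qed

lemma normal_closure_incl:
  assumes "r \<in> R" "R \<subseteq> carrier G"
  shows "r \<in> normal_closure G R"
proof -
  have "r = \<one> \<otimes> r \<otimes> inv \<one>" using assms by auto
  then show ?thesis
    unfolding normal_closure_def using assms(1) by (intro generate.incl) blast
qed

lemma normal_closure_least:
  assumes N: "N \<lhd> G" and R: "R \<subseteq> N"
  shows "normal_closure G R \<subseteq> N"
  unfolding normal_closure_def
proof (rule generate_subgroup_incl)
  show "{g \<otimes> r \<otimes> inv g |g r. g \<in> carrier G \<and> r \<in> R} \<subseteq> N"
    using normal.inv_op_closed2[OF N] R by blast
  show "subgroup N G" using N by (rule normal_imp_subgroup)
qed

lemma normal_closure_eqI:
  assumes "R \<subseteq> carrier G" "R' \<subseteq> carrier G" "R \<subseteq> normal_closure G R'" "R' \<subseteq> normal_closure G R"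
  shows "normal_closure G R = normal_closure G R'"
  using assms by (intro equalityI normal_closure_least normal_closure_normal)

end

text \<open>Evaluation at \<open>f\<close> maps the free group onto \<open>A\<close> and kills
  \<open>N\<close>. The homomorphism \<Phi> leads back: after evaluation it agrees with the coset
  map on generators, hence on all words, so a word that evaluates to the unit lies in
  \<open>N\<close>. Injectivity is thus obtained without normal forms in \<open>A\<close>.\<close>

lemma presentsI:
  fixes A :: "('a, 'c) monoid_scheme" and n :: nat and rs :: "nat word list"
  defines "F \<equiv> free_group {..<n}"
  defines "N \<equiv> normal_closure F (set rs)"
  assumes A: "group A" and f: "\<And>i. i < n \<Longrightarrow> f i \<in> carrier A" and rs: "set rs \<subseteq> carrier F"
    and rel: "\<And>r. r \<in> set rs \<Longrightarrow> word_val A f r = \<one>\<^bsub>A\<^esub>"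
    and gen: "carrier A \<subseteq> generate A (f ` {..<n})"
    and \<Phi>: "\<Phi> \<in> hom A (F Mod N)" "\<And>i. i < n \<Longrightarrow> \<Phi> (f i) = N #>\<^bsub>F\<^esub> [(i, True)]"
  shows "presents (n, rs) A"
proof -
  interpret F: group F unfolding F_def by (rule group_free_group)
  interpret N: normal N F unfolding N_def by (rule F.normal_closure_normal[OF rs])
  interpret A: group A by fact
  interpret h: group_hom F A "word_val A f"
    using word_val_hom[OF A, of "{..<n}" f] f
    by (simp add: group_hom_def group_hom_axioms_def A.is_group F.is_group[unfolded F_def] F_def)
  have Q: "group (F Mod N)" by (rule N.factorgroup_is_group)
  have "N \<subseteq> kernel F A (word_val A f)"
    unfolding N_def using h.normal_kernel rel rs by (intro F.normal_closure_least) (auto simp: kernel_def)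
  moreover have "w \<in> N" if w: "w \<in> kernel F A (word_val A f)" for w
  proof -
    have wF: "w \<in> carrier F" and w1: "word_val A f w = \<one>\<^bsub>A\<^esub>" using w by (auto simp: kernel_def)
    have sub: "i < n" if "i \<in> fst ` set w" for i
      using wF that by (auto simp: F_def free_group_simps)
    have "N #>\<^bsub>F\<^esub> w = word_val (F Mod N) (\<lambda>i. N #>\<^bsub>F\<^esub> [(i, True)]) w"
      using hom_word_val[OF Q, of "\<lambda>w. N #>\<^bsub>F\<^esub> w" "{..<n}" w] N.r_coset_hom_Mod wF by (simp add: F_def)
    also have "\<dots> = word_val (F Mod N) (\<lambda>i. (\<Phi> \<circ> word_val A f) [(i, True)]) w"
      using sub \<Phi>(2) f by (intro word_val_cong) (auto simp: letter_val_def)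
    also have "\<dots> = (\<Phi> \<circ> word_val A f) w"
      using hom_word_val[OF Q, of "\<Phi> \<circ> word_val A f" "{..<n}" w] hom_compose[OF h.homh \<Phi>(1)] wF
      by (simp add: F_def)
    also have "\<dots> = \<one>\<^bsub>F Mod N\<^esub>"
      using hom_one[OF \<Phi>(1) A Q] w1 by simp
    also have "\<dots> = N" by (simp add: FactGroup_def)
    finally show ?thesis
      using F.coset_join1[OF _ wF N.is_subgroup] by simp
  qed
  ultimately have ker: "kernel F A (word_val A f) = N" by blast
  have "f i \<in> word_val A f ` carrier F" if "i < n" for i
  proof -
    have "f i = word_val A f [(i, True)]" using f[OF that] by (simp add: letter_val_def)
    then show ?thesis
      using generator_carrier[of i "{..<n}" True] that unfolding F_def by (intro image_eqI) auto
  qed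
  then have "generate A (f ` {..<n}) \<subseteq> word_val A f ` carrier F"
    by (intro A.generate_subgroup_incl h.img_is_subgroup) auto
  then have "word_val A f ` carrier F = carrier A"
    using gen by auto
  then have "F Mod N \<cong> A"
    using h.FactGroup_iso ker by simp
  then show ?thesis
    using rs by (simp add: presents_def Let_def F_def N_def)
qed

lemma presents_iso: "presents P A \<Longrightarrow> A \<cong> G \<Longrightarrow> presents P G"
  unfolding presents_def Let_def using iso_trans by blast

lemma presents_group:
  assumes "set rs \<subseteq> carrier (free_group {..<n})"
  shows "group (free_group {..<n} Mod normal_closure (free_group {..<n}) (set rs))"
  using group.normal_closure_normal[OF group_free_group assms] by (rule normal.factorgroup_is_group)

lemma presents_unique:
  assumes "presents P G" "presents P G'"
  shows "G \<cong> G'"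
proof -
  have "set (snd P) \<subseteq> carrier (free_group {..<fst P})"
    using assms(1) by (simp add: presents_def Let_def)
  from group.iso_sym[OF presents_group[OF this]] show ?thesis
    using assms unfolding presents_def Let_def by (blast intro: iso_trans)
qed

section \<open>Renaming generators; presentations without relators\<close>

lemma foldr_push_rename:
  assumes "inj_on e (fst ` set (u @ w))"
  shows "foldr push_letter (map (apfst e) u) (map (apfst e) w) =
    map (apfst e) (foldr push_letter u w)"
  using assms
proof (induction u)
  case (Cons a u)
  let ?v = "foldr push_letter u w"
  have "fst ` set ?v \<subseteq> fst ` set (u @ w)"
    using set_foldr_push[of u w] by auto
  then have inj: "inj_on e (insert (fst a) (fst ` set ?v))"
    using inj_on_subset[OF Cons.prems, of "insert (fst a) (fst ` set ?v)"] by auto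
  have "push_letter (apfst e a) (map (apfst e) ?v) = map (apfst e) (push_letter a ?v)"
    using inj by (cases ?v) (auto simp: inv_letter_def prod_eq_iff inj_on_def)
  moreover have "inj_on e (fst ` set (u @ w))"
    using Cons.prems by (rule inj_on_subset) auto
  ultimately show ?case using Cons.IH by simp
qed simp

lemma freely_reduced_rename:
  "inj_on e (fst ` set w) \<Longrightarrow> freely_reduced (map (apfst e) w) \<longleftrightarrow> freely_reduced w"
  by (induction w rule: freely_reduced.induct) (auto simp: inv_letter_def prod_eq_iff inj_on_def)

lemma free_group_rename:
  assumes e: "inj_on e B"
  shows "free_group B \<cong> free_group (e ` B)"
proof -
  let ?r = "map (apfst e)"
  have sub: "inj_on e (fst ` set w)" if "w \<in> carrier (free_group B)" for w
    using that e by (auto simp: free_group_simps intro: inj_on_subset)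
  have "?r \<in> hom (free_group B) (free_group (e ` B))"
  proof (rule homI)
    fix u assume u: "u \<in> carrier (free_group B)"
    then show "?r u \<in> carrier (free_group (e ` B))"
      using freely_reduced_rename[OF sub[OF u]] by (force simp: free_group_simps)
    fix w assume w: "w \<in> carrier (free_group B)"
    have "fst ` set (u @ w) \<subseteq> B"
      using u w by (auto simp: free_group_simps)
    then have "inj_on e (fst ` set (u @ w))"
      using e by (rule inj_on_subset[rotated])
    then show "?r (u \<otimes>\<^bsub>free_group B\<^esub> w) = ?r u \<otimes>\<^bsub>free_group (e ` B)\<^esub> ?r w"
      by (simp add: free_group_simps foldr_push_rename)
  qed
  moreover have "bij_betw ?r (carrier (free_group B)) (carrier (free_group (e ` B)))"
  proof (rule bij_betwI')
    fix u w assume "u \<in> carrier (free_group B)" "w \<in> carrier (free_group B)"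
    then have "fst a \<in> B" if "a \<in> set u \<union> set w" for a
      using that by (auto simp: free_group_simps)
    then have "inj_on (apfst e) (set u \<union> set w)"
      using e by (intro inj_onI) (metis fst_apfst inj_on_eq_iff prod_eq_iff snd_apfst)
    then show "(?r u = ?r w) = (u = w)" by (rule inj_on_map_eq_map)
  next
    fix u assume u: "u \<in> carrier (free_group B)"
    then show "?r u \<in> carrier (free_group (e ` B))"
      using freely_reduced_rename[OF sub[OF u]] by (force simp: free_group_simps)
  next
    fix w assume w: "w \<in> carrier (free_group (e ` B))"
    let ?u = "map (apfst (inv_into B e)) w"
    have i: "inj_on (inv_into B e) (e ` B)" by (rule inj_on_inv_into) simp
    have "freely_reduced ?u"
      using w i freely_reduced_rename[of "inv_into B e" w] by (auto simp: free_group_simps intro: inj_on_subset)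
    moreover have "fst ` set ?u \<subseteq> B"
      using w by (force simp: free_group_simps intro: inv_into_into)
    moreover have "w = ?r ?u"
      using w by (auto simp: free_group_simps f_inv_into_f image_subset_iff intro!: map_idI[symmetric])
    ultimately show "\<exists>u\<in>carrier (free_group B). w = ?r u"
      by (intro bexI[of _ ?u]) (auto simp: free_group_simps)
  qed
  ultimately show ?thesis by (auto simp: is_iso_def iso_def)
qed

text \<open>A basis has to be indexed by elements of the type of \<open>G\<close>. The images of the
  generators under the isomorphism are such elements; they are distinct by injectivity, so renaming
  along \<open>e\<close> applies.\<close>

lemma is_free_group_no_relations:
  assumes G: "group G" and P: "presents (n, []) G"
  shows "is_free_group G"
proof -
  let ?F = "free_group {..<n}"
  interpret F: group ?F by (rule group_free_group)
  have "normal_closure ?F {} = {\<one>\<^bsub>?F\<^esub>}"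
    by (simp add: normal_closure_def F.generate_empty)
  then have "?F Mod {\<one>\<^bsub>?F\<^esub>} \<cong> G"
    using P by (simp add: presents_def Let_def)
  moreover have "?F \<cong> ?F Mod {\<one>\<^bsub>?F\<^esub>}"
  proof (rule group.iso_sym)
    show "group (?F Mod {\<one>\<^bsub>?F\<^esub>})"
      using F.one_is_normal by (rule normal.factorgroup_is_group)
    show "?F Mod {\<one>\<^bsub>?F\<^esub>} \<cong> ?F"
      using F.trivial_factor_iso by (auto simp: is_iso_def)
  qed
  ultimately have "?F \<cong> G" using iso_trans by blast
  then obtain h where h: "h \<in> iso ?F G" by (auto simp: is_iso_def)
  define e where "e i = h [(i, True)]" for i
  have "inj_on h (carrier ?F)" using h by (auto simp: iso_def bij_betw_def)
  then have e: "inj_on e {..<n}"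
    using generator_carrier[of _ "{..<n}" True] by (auto simp: inj_on_def e_def)
  have "free_group (e ` {..<n}) \<cong> ?F"
    using free_group_rename[OF e] group.iso_sym[OF group_free_group] by blast
  then have "free_group (e ` {..<n}) \<cong> G" using \<open>?F \<cong> G\<close> iso_trans by blast
  then show ?thesis unfolding is_free_group_def by blast
qed

section \<open>Presentations read off a complex\<close>

definition adjacency :: "'v set set \<Rightarrow> 'v rel" where
  "adjacency K = {(u, v). {u, v} \<in> K}"

definition edge_connected :: "'v set set \<Rightarrow> 'v \<Rightarrow> bool" where
  "edge_connected K b \<longleftrightarrow> (\<forall>v. {v} \<in> K \<longrightarrow> (b, v) \<in> (adjacency K)\<^sup>*)"

lemma (in two_complex) card_face: "\<sigma> \<in> K \<Longrightarrow> card \<sigma> \<le> 3"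
  using K unfolding simplicial_2_complex_def by blast

text \<open>The rank is the distance from \<open>b\<close> in the edge graph, and \<open>par\<close>
  picks a neighbour that is one step closer. In such a breadth-first tree every neighbour of
  \<open>b\<close> hangs at \<open>b\<close> itself, which the letter count of the upper bound
  exploits.\<close>

lemma (in two_complex) tree_exists:
  assumes x: "x \<in> \<R>" and b: "{b} \<in> K" and con: "edge_connected K b"
  obtains par rk where "rooted_complex K x b par rk" "\<And>v. {b, v} \<in> K \<Longrightarrow> v \<noteq> b \<Longrightarrow> par v = b"
proof -
  let ?A = "adjacency K"
  define rk where "rk v = (LEAST n. (b, v) \<in> ?A ^^ n)" for v
  define par where "par v = (SOME u. (b, u) \<in> ?A ^^ (rk v - 1) \<and> (u, v) \<in> ?A)" for v
  have rkI: "(b, v) \<in> ?A ^^ rk v" if "(b, v) \<in> ?A ^^ n" for v n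
    unfolding rk_def using that by (rule LeastI)
  have rk_le: "rk v \<le> n" if "(b, v) \<in> ?A ^^ n" for v n
    unfolding rk_def using that by (rule Least_le)
  have rk_b: "rk b = 0" using rk_le[of b 0] by simp
  have step: "(b, par v) \<in> ?A ^^ (rk v - 1) \<and> {par v, v} \<in> K \<and> rk v = Suc (rk (par v))"
    if v: "{v} \<in> K" "v \<noteq> b" for v
  proof -
    obtain n where "(b, v) \<in> ?A ^^ n"
      using con v(1) unfolding edge_connected_def by (meson rtrancl_imp_relpow)
    then have bv: "(b, v) \<in> ?A ^^ rk v" by (rule rkI)
    then have "rk v \<noteq> 0" using v(2) by (cases "rk v") auto
    then obtain m where m: "rk v = Suc m" by (cases "rk v") auto
    then have "\<exists>u. (b, u) \<in> ?A ^^ (rk v - 1) \<and> (u, v) \<in> ?A"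
      using bv by auto
    then have p: "(b, par v) \<in> ?A ^^ (rk v - 1) \<and> (par v, v) \<in> ?A"
      unfolding par_def by (rule someI_ex)
    then have "rk (par v) \<le> m" using rk_le[of "par v" m] m by simp
    moreover have "rk v \<le> Suc (rk (par v))"
      using rk_le[of v "Suc (rk (par v))"] rkI[of "par v"] p by auto
    ultimately show ?thesis using p m by (auto simp: adjacency_def)
  qed
  have "rooted_complex K x b par rk"
    by unfold_locales (use x b rk_b step in auto)
  moreover have "par v = b" if "{b, v} \<in> K" "v \<noteq> b" for v
  proof -
    have v: "{v} \<in> K" using in_vertex[OF that(1)] by simp
    have "(b, v) \<in> ?A ^^ 1" using that by (auto simp: adjacency_def)
    then have "rk v - 1 = 0" using rk_le[of v 1] by simp
    then show ?thesis using step[OF v that(2)] by auto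
  qed
  ultimately show ?thesis using that by blast
qed

text \<open>The stars of the vertices reachable from \<open>b\<close> and those of the other
  vertices are two open sets covering the realization. They are disjoint there: a common point would
  have a vertex of each kind in its support, and these two span an edge.\<close>

lemma (in two_complex) edge_connected_of_path_connected:
  assumes pc: "path_connected \<R>" and b: "{b} \<in> K"
  shows "edge_connected K b"
  unfolding edge_connected_def
proof (intro allI impI, rule ccontr)
  fix v assume v: "{v} \<in> K" and nv: "(b, v) \<notin> (adjacency K)\<^sup>*"
  define R where "R = {u. (b, u) \<in> (adjacency K)\<^sup>*}"
  let ?U = "\<lambda>R. \<Union>u\<in>R. {t::'v \<Rightarrow> real. t u \<noteq> 0}"
  have op: "open (?U X)" for X
    by (intro open_UN ballI open_Collect_neq continuous_on_product_coordinates continuous_on_const)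
  have con: "connected \<R>" using pc by (rule path_connected_imp_connected)
  have "?U R \<inter> ?U (- R) \<inter> \<R> = {}"
  proof -
    have False if t: "t \<in> \<R>" "t u \<noteq> 0" "t w \<noteq> 0" "u \<in> R" "w \<notin> R" for t u w
    proof -
      have "(u, w) \<in> adjacency K" using support_edge[OF t(1-3)] by (simp add: adjacency_def)
      with t(4,5) show False unfolding R_def using rtrancl_into_rtrancl by fastforce
    qed
    then show ?thesis by auto
  qed
  moreover have "\<R> \<subseteq> ?U R \<union> ?U (- R)"
    using support_nonempty by auto
  ultimately have "?U R \<inter> \<R> = {} \<or> ?U (- R) \<inter> \<R> = {}"
    by (rule connectedD[OF con op op])
  moreover have "vertex_point b \<in> ?U R \<inter> \<R>" "vertex_point v \<in> ?U (- R) \<inter> \<R>"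
    using vertex_point_realization b v nv by (auto simp: R_def)
  ultimately show False by blast
qed

lemma cocycle_inv:
  assumes \<phi>: "cocycle K G \<phi>" "group G" "simplicial_2_complex K" and e: "{u, v} \<in> K"
  shows "inv\<^bsub>G\<^esub> (\<phi> u v) = \<phi> v u"
proof -
  interpret two_complex K using \<phi>(3) by (simp add: two_complex_def)
  have "\<phi> v u \<otimes>\<^bsub>G\<^esub> \<phi> u v = \<one>\<^bsub>G\<^esub>"
    using cocycleD(2)[OF \<phi>(1) e, of v u v] cocycle_same[OF \<phi>(1,2) in_vertex[OF e]] by simp
  then show ?thesis
    using cocycleD(1)[OF \<phi>(1) e] \<phi>(2) by (intro group.inv_equality) auto
qed

text \<open>One oriented relation for each triangle is enough. Cyclic rotation and inversion yield
  the other five orders of its vertices, and triples with a repetition follow from the rules for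
  \<open>\<phi> u u\<close> and for inverses.\<close>

lemma cocycleI:
  assumes K: "simplicial_2_complex K" and G: "group G"
    and closed: "\<And>u v. {u, v} \<in> K \<Longrightarrow> \<phi> u v \<in> carrier G"
    and same: "\<And>u. {u} \<in> K \<Longrightarrow> \<phi> u u = \<one>\<^bsub>G\<^esub>"
    and inverse: "\<And>u v. {u, v} \<in> K \<Longrightarrow> \<phi> v u = inv\<^bsub>G\<^esub> (\<phi> u v)"
    and triangle: "\<And>\<sigma>. \<sigma> \<in> two_simplices K \<Longrightarrow>
      \<exists>u v w. \<sigma> = {u, v, w} \<and> \<phi> u v \<otimes>\<^bsub>G\<^esub> \<phi> v w \<otimes>\<^bsub>G\<^esub> \<phi> w u = \<one>\<^bsub>G\<^esub>"
  shows "cocycle K G \<phi>"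
proof -
  interpret G: group G by fact
  interpret two_complex K using K by (simp add: two_complex_def)
  have edge: "{u, v} \<in> K" if "\<sigma> \<in> K" "u \<in> \<sigma>" "v \<in> \<sigma>" for \<sigma> u v
    using face[OF that(1), of "{u, v}"] that by auto
  have "\<phi> p q \<otimes>\<^bsub>G\<^esub> \<phi> q r = \<phi> p r" if \<sigma>: "\<sigma> \<in> K" and pqr: "p \<in> \<sigma>" "q \<in> \<sigma>" "r \<in> \<sigma>" for \<sigma> p q r
  proof (cases "p = q \<or> q = r \<or> p = r")
    case True
    have "\<phi> p q \<in> carrier G" "\<phi> q r \<in> carrier G" "\<phi> p p = \<one>\<^bsub>G\<^esub>" "\<phi> q q = \<one>\<^bsub>G\<^esub>"
      using edge[OF \<sigma>] pqr closed same in_vertex[OF \<sigma>] by auto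
    then show ?thesis using True inverse[OF edge[OF \<sigma> pqr(1,2)]] by auto
  next
    case False
    have "card {p, q, r} = 3" using False by auto
    moreover have "card \<sigma> \<le> 3" "finite \<sigma>" using card_face finite_face \<sigma> by auto
    ultimately have eq: "\<sigma> = {p, q, r}" using pqr card_subset_eq[of \<sigma> "{p, q, r}"] card_mono[of \<sigma> "{p, q, r}"] by auto
    then have "\<sigma> \<in> two_simplices K" using \<open>card {p, q, r} = 3\<close> \<sigma> by (simp add: two_simplices_def)
    then obtain u v w where uvw: "\<sigma> = {u, v, w}" "\<phi> u v \<otimes>\<^bsub>G\<^esub> \<phi> v w \<otimes>\<^bsub>G\<^esub> \<phi> w u = \<one>\<^bsub>G\<^esub>"
      using triangle by blast
    have c: "\<phi> a c \<in> carrier G" "\<phi> c a = inv\<^bsub>G\<^esub> (\<phi> a c)" if "a \<in> \<sigma>" "c \<in> \<sigma>" for a c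
      using closed inverse edge[OF \<sigma> that] by auto
    have rot: "\<phi> d e \<otimes>\<^bsub>G\<^esub> \<phi> e c = \<phi> d c" if "\<phi> c d \<otimes>\<^bsub>G\<^esub> \<phi> d e = \<phi> c e" "c \<in> \<sigma>" "d \<in> \<sigma>" "e \<in> \<sigma>" for c d e
    proof -
      have "\<phi> d e = inv\<^bsub>G\<^esub> (\<phi> c d) \<otimes>\<^bsub>G\<^esub> \<phi> c e"
        using c(1) that(2-4) by (simp add: that(1)[symmetric] G.inv_cancel)
      then show ?thesis using c[OF that(2,3)] c[OF that(2,4)] by (simp add: G.m_assoc)
    qed
    have flip: "\<phi> e d \<otimes>\<^bsub>G\<^esub> \<phi> d c = \<phi> e c" if "\<phi> c d \<otimes>\<^bsub>G\<^esub> \<phi> d e = \<phi> c e" "c \<in> \<sigma>" "d \<in> \<sigma>" "e \<in> \<sigma>" for c d e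
      using c[OF that(2,3)] c[OF that(3,4)] c[OF that(2,4)] by (simp add: that(1)[symmetric] G.inv_mult_group)
    have s: "u \<in> \<sigma>" "v \<in> \<sigma>" "w \<in> \<sigma>" using uvw by auto
    have 1: "\<phi> u v \<otimes>\<^bsub>G\<^esub> \<phi> v w = \<phi> u w"
      using uvw(2) c s by (metis G.inv_equality G.inv_inv G.m_closed)
    note 2 = rot[OF 1 s]
    note 3 = rot[OF 2 s(2,3,1)]
    note 4 = flip[OF 1 s] and 5 = flip[OF 2 s(2,3,1)] and 6 = flip[OF 3 s(3,1,2)]
    have "(p = u \<and> q = v \<and> r = w) \<or> (p = v \<and> q = w \<and> r = u) \<or> (p = w \<and> q = u \<and> r = v) \<or>
        (p = w \<and> q = v \<and> r = u) \<or> (p = u \<and> q = w \<and> r = v) \<or> (p = v \<and> q = u \<and> r = w)"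
      using pqr[unfolded uvw(1)] False by blast
    then show ?thesis by (elim disjE conjE) (simp_all only: 1 2 3 4 5 6)
  qed
  then show ?thesis
    unfolding cocycle_def using closed edge by blast
qed

section \<open>Collapsing a triangle through a free edge\<close>

lemma hom_inverse_on_generators:
  assumes A: "group A" "carrier A = generate A X" and B: "group B"
    and f: "f \<in> hom A B" and g: "g \<in> hom B A"
    and gf: "\<And>a. a \<in> X \<Longrightarrow> g (f a) = a" and a: "a \<in> carrier A"
  shows "g (f a) = a"
proof -
  interpret A: group A by fact
  interpret c: group_hom A A "g \<circ> f"
    using hom_compose[OF f g] by (simp add: group_hom_def group_hom_axioms_def A)
  have X: "X \<subseteq> carrier A" using A(2) generate.incl[of _ X A] by auto
  have "subgroup {a \<in> carrier A. g (f a) = a} A"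
    using c.hom_mult c.hom_inv c.hom_one by (intro A.subgroupI) auto
  then have "generate A X \<subseteq> {a \<in> carrier A. g (f a) = a}"
    using X gf by (intro A.generate_subgroup_incl) auto
  then show ?thesis using a A(2) by auto
qed

lemma iso_on_generators:
  assumes A: "group A" "carrier A = generate A X" and B: "group B" "carrier B = generate B Y"
    and f: "f \<in> hom A B" and g: "g \<in> hom B A"
    and gf: "\<And>a. a \<in> X \<Longrightarrow> g (f a) = a" and fg: "\<And>c. c \<in> Y \<Longrightarrow> f (g c) = c"
  shows "A \<cong> B"
proof -
  have gf': "g (f a) = a" if "a \<in> carrier A" for a
    using hom_inverse_on_generators[OF A B(1) f g gf that] .
  have fg': "f (g c) = c" if "c \<in> carrier B" for c
    using hom_inverse_on_generators[OF B A(1) g f fg that] .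
  have "bij_betw f (carrier A) (carrier B)"
    using f g gf' fg' by (intro bij_betw_byWitness[where f' = g]) (auto simp: hom_def)
  then show ?thesis using f by (auto simp: is_iso_def iso_def)
qed

text \<open>In the triangle the removed edge can be replaced by the detour over \<open>w\<close>.
  Labels on the smaller complex extend by the product along this detour, labels on the larger one
  restrict, and the two induced homomorphisms undo each other on edge classes.\<close>

lemma collapse:
  fixes K :: "'v set set"
  assumes K: "simplicial_2_complex K" and pc: "path_connected (geometric_realization K)"
    and x: "x \<in> geometric_realization K"
    and \<sigma>: "{p, q, w} \<in> K" "p \<noteq> q" "p \<noteq> w" "q \<noteq> w"
    and free: "\<And>\<tau>. \<tau> \<in> two_simplices K \<Longrightarrow> p \<in> \<tau> \<Longrightarrow> q \<in> \<tau> \<Longrightarrow> \<tau> = {p, q, w}"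
  defines "L \<equiv> K - {{p, q}, {p, q, w}}"
  shows "simplicial_2_complex L" "path_connected (geometric_realization L)"
    "\<exists>y\<in>geometric_realization L. fundamental_group (geometric_realization L) y
       \<cong> fundamental_group (geometric_realization K) x"
    "two_simplices L = two_simplices K - {{p, q, w}}"
proof -
  interpret two_complex K using K by (simp add: two_complex_def)
  \<comment> \<open>The only faces that contain both \<open>p\<close> and \<open>q\<close> are the
    two that are removed; therefore the remaining family is still closed under taking faces.\<close>
  have faces: "\<tau> = {p, q} \<or> \<tau> = {p, q, w}" if "\<tau> \<in> K" "p \<in> \<tau>" "q \<in> \<tau>" for \<tau>
  proof -
    have c: "card \<tau> \<le> 3" "finite \<tau>" using card_face finite_face that by auto
    have sub: "{p, q} \<subseteq> \<tau>" using that by simp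
    show ?thesis
    proof (cases "card \<tau> = 3")
      case True
      then show ?thesis using free[of \<tau>] that by (simp add: two_simplices_def)
    next
      case False
      then have "card \<tau> \<le> card {p, q}" using c \<sigma>(2) by simp
      then show ?thesis using card_seteq[OF c(2) sub] by simp
    qed
  qed
  show L: "simplicial_2_complex L"
    unfolding simplicial_2_complex_def
  proof (intro conjI ballI allI impI)
    show "finite L" using K by (simp add: L_def simplicial_2_complex_def)
    fix \<tau> assume \<tau>: "\<tau> \<in> L"
    then have \<tau>K: "\<tau> \<in> K" by (simp add: L_def)
    then show "finite \<tau>" "\<tau> \<noteq> {}" "card \<tau> \<le> 3" using card_face finite_face nonempty_face by auto
    fix \<rho> assume \<rho>: "\<rho> \<noteq> {} \<and> \<rho> \<subseteq> \<tau>"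
    then have "\<rho> \<in> K" using face[OF \<tau>K] by blast
    moreover have "\<rho> \<noteq> {p, q} \<and> \<rho> \<noteq> {p, q, w}"
      using \<rho> faces[OF \<tau>K] \<tau> by (auto simp: L_def)
    ultimately show "\<rho> \<in> L" by (simp add: L_def)
  qed
  interpret L: two_complex L using L by (simp add: two_complex_def)
  have LK: "L \<subseteq> K" by (auto simp: L_def)
  have vert: "{v} \<in> L \<longleftrightarrow> {v} \<in> K" for v using \<sigma>(2) by (auto simp: L_def doubleton_eq_iff)
  have edges: "{p, w} \<in> L" "{q, w} \<in> L" "{w, p} \<in> L" "{w, q} \<in> L"
  proof -
    have "{p, w} \<in> K" "{q, w} \<in> K" using face[OF \<sigma>(1)] by auto
    then show "{p, w} \<in> L" "{q, w} \<in> L" using \<sigma> by (auto simp: L_def doubleton_eq_iff)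
    then show "{w, p} \<in> L" "{w, q} \<in> L" by (simp_all add: insert_commute)
  qed
  have wK: "{w} \<in> K" using in_vertex[OF \<sigma>(1)] by simp
  have "adjacency K \<subseteq> (adjacency L)\<^sup>*"
  proof
    fix z assume "z \<in> adjacency K"
    then obtain u v where z: "z = (u, v)" "{u, v} \<in> K" by (auto simp: adjacency_def)
    show "z \<in> (adjacency L)\<^sup>*"
    proof (cases "{u, v} \<in> L")
      case True
      then show ?thesis using z by (auto simp: adjacency_def)
    next
      case False
      then have "{u, v} = {p, q} \<or> {u, v} = {p, q, w}" using z by (auto simp: L_def)
      moreover have "{u, v} \<noteq> {p, q, w}"
      proof
        assume "{u, v} = {p, q, w}"
        then have "card {u, v} = 3" using \<sigma> by simp
        then show False by (auto simp: card_insert_if split: if_splits)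
      qed
      ultimately have "{u, v} = {p, q}" by simp
      then have "(u, w) \<in> adjacency L" "(w, v) \<in> adjacency L"
        using edges by (auto simp: adjacency_def doubleton_eq_iff)
      then show ?thesis unfolding z(1) by (meson r_into_rtrancl rtrancl_trans)
    qed
  qed
  then have "(adjacency K)\<^sup>* \<subseteq> (adjacency L)\<^sup>*" by (rule rtrancl_subset_rtrancl)
  then have con: "edge_connected L w"
    using edge_connected_of_path_connected[OF pc wK] vert by (auto simp: edge_connected_def)
  have wL: "{w} \<in> L" using vert wK by simp
  \<comment> \<open>A tree of the smaller complex serves both complexes: they have the same
    vertices, and the removed edge is then not a tree edge.\<close>
  obtain par rk where T: "rooted_complex L (vertex_point w) w par rk"
    using L.tree_exists[OF L.vertex_point_realization[OF wL] wL con] by blast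
  interpret T: rooted_complex L "vertex_point w" w par rk by (rule T)
  interpret S: rooted_complex K x w par rk
    by unfold_locales (use x T.root T.par vert LK in auto)
  show "path_connected (geometric_realization L)" by (rule T.path_connected_realization)
  show "two_simplices L = two_simplices K - {{p, q, w}}"
    using \<sigma>(2) by (auto simp: two_simplices_def L_def)
  note cL = T.cocycle_edge_class and cK = S.cocycle_edge_class
  define \<phi> where "\<phi> u v = (if {u, v} = {p, q} then T.edge_class u w \<otimes>\<^bsub>T.\<pi>\<^esub> T.edge_class w v else T.edge_class u v)" for u v
  have same: "T.edge_class u u = \<one>\<^bsub>T.\<pi>\<^esub>" if "{u} \<in> K" for u
    using cocycle_same[OF cL T.group_\<pi>] that vert by simp
  have in\<sigma>: "T.edge_class u w \<in> carrier T.\<pi>" "T.edge_class w u \<in> carrier T.\<pi>"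
    "T.edge_class w u \<otimes>\<^bsub>T.\<pi>\<^esub> T.edge_class u w = \<one>\<^bsub>T.\<pi>\<^esub>" if "u \<in> {p, q, w}" for u
  proof -
    have "{u, w} \<in> L" using that edges wL by auto
    from cocycleD[OF cL this]
    show "T.edge_class u w \<in> carrier T.\<pi>" "T.edge_class w u \<in> carrier T.\<pi>"
      "T.edge_class w u \<otimes>\<^bsub>T.\<pi>\<^esub> T.edge_class u w = \<one>\<^bsub>T.\<pi>\<^esub>"
      using same[OF wK] by auto
  qed
  \<comment> \<open>On \<open>{p, q, w}\<close> the extended labels factor through \<open>w\<close>
    also for the edges that remain and for repeated vertices. With one formula for all pairs the
    triangle relation is a telescoping product.\<close>
  have \<phi>\<sigma>: "\<phi> u v = T.edge_class u w \<otimes>\<^bsub>T.\<pi>\<^esub> T.edge_class w v" if uv: "u \<in> {p, q, w}" "v \<in> {p, q, w}" for u v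
  proof (cases "{u, v} = {p, q}")
    case False
    have "u = w \<or> v = w \<or> u = v" using uv False by auto
    then show ?thesis
    proof (elim disjE)
      assume "u = v"
      moreover have "T.edge_class v w \<otimes>\<^bsub>T.\<pi>\<^esub> T.edge_class w v = T.edge_class v v"
        using uv(2) edges wL by (intro cocycleD(2)[OF cL, of "{v, w}"]) auto
      ultimately show ?thesis using False by (simp add: \<phi>_def)
    qed (use False in\<sigma> uv same[OF wK] in \<open>simp_all add: \<phi>_def\<close>)
  qed (simp add: \<phi>_def)
  have "cocycle K T.\<pi> \<phi>"
    unfolding cocycle_def
  proof (intro ballI conjI)
    fix \<tau> u v assume \<tau>: "\<tau> \<in> K" and u: "u \<in> \<tau>" and v: "v \<in> \<tau>"
    have cases: "\<tau> \<subseteq> {p, q, w} \<or> (\<tau> \<in> L \<and> (\<forall>u\<in>\<tau>. \<forall>v\<in>\<tau>. \<phi> u v = T.edge_class u v))"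
    proof (cases "p \<in> \<tau> \<and> q \<in> \<tau>")
      case True
      then show ?thesis using faces[OF \<tau>] by auto
    next
      case False
      then have "\<tau> \<in> L" "\<forall>u\<in>\<tau>. \<forall>v\<in>\<tau>. {u, v} \<noteq> {p, q}" using \<tau> by (auto simp: L_def doubleton_eq_iff)
      then show ?thesis by (simp add: \<phi>_def)
    qed
    then show "\<phi> u v \<in> carrier T.\<pi>"
    proof
      assume "\<tau> \<subseteq> {p, q, w}"
      then have "u \<in> {p, q, w}" "v \<in> {p, q, w}" using u v by auto
      then show ?thesis using \<phi>\<sigma>[of u v] in\<sigma>(1)[of u] in\<sigma>(2)[of v] by simp
    next
      assume "\<tau> \<in> L \<and> (\<forall>u\<in>\<tau>. \<forall>v\<in>\<tau>. \<phi> u v = T.edge_class u v)"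
      then show ?thesis using u v cocycleD(1)[OF cL, of \<tau> u v] by simp
    qed
    fix z assume z: "z \<in> \<tau>"
    from cases show "\<phi> u v \<otimes>\<^bsub>T.\<pi>\<^esub> \<phi> v z = \<phi> u z"
    proof
      assume "\<tau> \<subseteq> {p, q, w}"
      then have s: "u \<in> {p, q, w}" "v \<in> {p, q, w}" "z \<in> {p, q, w}" using u v z by auto
      note i = in\<sigma>[OF s(1)] in\<sigma>[OF s(2)] in\<sigma>[OF s(3)]
      have "T.edge_class u w \<otimes>\<^bsub>T.\<pi>\<^esub> T.edge_class w v \<otimes>\<^bsub>T.\<pi>\<^esub> (T.edge_class v w \<otimes>\<^bsub>T.\<pi>\<^esub> T.edge_class w z)
         = T.edge_class u w \<otimes>\<^bsub>T.\<pi>\<^esub> (T.edge_class w v \<otimes>\<^bsub>T.\<pi>\<^esub> T.edge_class v w) \<otimes>\<^bsub>T.\<pi>\<^esub> T.edge_class w z"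
        using i(1,2,4,5,7,8) by (simp add: T.P.m_assoc)
      then show ?thesis using \<phi>\<sigma> s i by simp
    next
      assume "\<tau> \<in> L \<and> (\<forall>u\<in>\<tau>. \<forall>v\<in>\<tau>. \<phi> u v = T.edge_class u v)"
      then show ?thesis using cocycleD(2)[OF cL] u v z by auto
    qed
  qed
  moreover have "\<phi> (par v) v = \<one>\<^bsub>T.\<pi>\<^esub>" if "{v} \<in> K" "v \<noteq> w" for v
  proof -
    have "{par v, v} \<in> L" using T.par that vert by simp
    then have "{par v, v} \<noteq> {p, q}" by (auto simp: L_def)
    then show ?thesis using T.edge_class_par that vert by (simp add: \<phi>_def)
  qed
  ultimately obtain f where f: "f \<in> hom S.\<pi> T.\<pi>" "\<And>u v. {u, v} \<in> K \<Longrightarrow> f (S.edge_class u v) = \<phi> u v"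
    using S.cocycle_hom[OF T.group_\<pi>] by blast
  have cKL: "cocycle L S.\<pi> S.edge_class"
    using cK LK by (auto simp: cocycle_def)
  obtain g where g: "g \<in> hom T.\<pi> S.\<pi>" "\<And>u v. {u, v} \<in> L \<Longrightarrow> g (T.edge_class u v) = S.edge_class u v"
    using T.cocycle_hom[OF S.group_\<pi> cKL] S.edge_class_par vert by blast
  have "S.\<pi> \<cong> T.\<pi>"
  proof (rule iso_on_generators[OF S.group_\<pi> S.edge_classes_generate[symmetric] T.group_\<pi>
      T.edge_classes_generate[symmetric] f(1) g(1)])
    fix a assume "a \<in> {S.edge_class u v |u v. {u, v} \<in> K}"
    then obtain u v where a: "a = S.edge_class u v" "{u, v} \<in> K" by auto
    show "g (f a) = a"
    proof (cases "{u, v} = {p, q}")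
      case True
      then have uv: "u \<in> {p, q, w}" "v \<in> {p, q, w}" by (auto simp: doubleton_eq_iff)
      then have e: "{u, w} \<in> L" "{w, v} \<in> L" using edges wL by (auto simp: insert_commute)
      have "g (f a) = S.edge_class u w \<otimes>\<^bsub>S.\<pi>\<^esub> S.edge_class w v"
        using a f(2) True hom_mult[OF g(1) in\<sigma>(1)[OF uv(1)] in\<sigma>(2)[OF uv(2)]] g(2)[OF e(1)] g(2)[OF e(2)]
        by (simp add: \<phi>_def)
      also have "\<dots> = a" unfolding a using cocycleD(2)[OF cK \<sigma>(1) uv(1), of w v] uv by auto
      finally show ?thesis .
    next
      case False
      have "{u, v} \<noteq> {p, q, w}"
      proof
        assume "{u, v} = {p, q, w}"
        then have "card {u, v} = 3" using \<sigma> by simp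
        then show False by (auto simp: card_insert_if split: if_splits)
      qed
      then have "{u, v} \<in> L" using a False by (simp add: L_def)
      then show ?thesis using a f(2) g(2) False by (simp add: \<phi>_def)
    qed
  next
    fix c assume "c \<in> {T.edge_class u v |u v. {u, v} \<in> L}"
    then obtain u v where c: "c = T.edge_class u v" "{u, v} \<in> L" by auto
    moreover have "{u, v} \<noteq> {p, q}" using c by (auto simp: L_def)
    ultimately show "f (g c) = c" using f(2)[of u v] g(2)[of u v] LK by (auto simp: \<phi>_def)
  qed
  then have "T.\<pi> \<cong> S.\<pi>" by (rule group.iso_sym[OF S.group_\<pi>])
  then show "\<exists>y\<in>geometric_realization L. fundamental_group (geometric_realization L) y
       \<cong> fundamental_group (geometric_realization K) x"
    using T.x by blast
qed

section \<open>The presentation obtained from a rooted complex\<close>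

lemma foldr_push_append: "freely_reduced (u @ w) \<Longrightarrow> foldr push_letter u w = u @ w"
proof (induction u)
  case (Cons a u)
  then have "freely_reduced (u @ w)" using reduced_ConsD[of a "u @ w"] by simp
  with Cons show ?case by (simp add: push_letter_reduced)
qed simp

lemma freely_reduced_distinct: "distinct (map fst w) \<Longrightarrow> freely_reduced w"
  by (induction w rule: freely_reduced.induct) (auto simp: inv_letter_def)

lemma card_two_subsets_triple:
  assumes "u \<noteq> v" "v \<noteq> w" "u \<noteq> w" and E: "\<And>e. e \<in> E \<Longrightarrow> card e = 2"
  shows "card {e \<in> E. e \<subseteq> {u, v, w}} =
    of_bool ({u, v} \<in> E) + of_bool ({v, w} \<in> E) + of_bool ({w, u} \<in> E)"
proof -
  have "e \<in> {{u, v}, {v, w}, {w, u}}" if "e \<in> E" "e \<subseteq> {u, v, w}" for e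
  proof -
    have "card e = 2" using E that(1) by blast
    then obtain p q where "e = {p, q}" "p \<noteq> q" by (meson card_2_iff)
    then show ?thesis using that(2) by (auto simp: doubleton_eq_iff)
  qed
  then have "{e \<in> E. e \<subseteq> {u, v, w}} = {e \<in> {{u, v}, {v, w}, {w, u}}. e \<in> E}" by auto
  also have "\<dots> = (if {u, v} \<in> E then {{u, v}} else {}) \<union> (if {v, w} \<in> E then {{v, w}} else {}) \<union>
      (if {w, u} \<in> E then {{w, u}} else {})" by auto
  finally show ?thesis using assms(1-3) by (auto simp: doubleton_eq_iff)
qed

text \<open>All edges at \<open>b\<close> lie in the tree, so a triangle at \<open>b\<close> makes
  its opposite edge trivial. That edge is left out of the generators \<open>E\<close>, and the
  triangle needs no relator. Any other triangle gives the word of its sides in \<open>E\<close>;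
  these are pairwise different generators, so the word is reduced and its length is the number of
  such sides.\<close>

lemma complex_presentation:
  fixes K :: "nat set set"
  assumes T: "rooted_complex K x b par rk" and star: "\<And>v. {b, v} \<in> K \<Longrightarrow> v \<noteq> b \<Longrightarrow> par v = b"
  defines "E \<equiv> {e \<in> K. card e = 2 \<and> \<not> (\<exists>v. {v} \<in> K \<and> v \<noteq> b \<and> e = {par v, v}) \<and> insert b e \<notin> two_simplices K}"
  obtains P where "presents P (fundamental_group (geometric_realization K) x)"
    and "presentation_length P = (\<Sum>\<sigma>\<in>{\<sigma> \<in> two_simplices K. b \<notin> \<sigma>}. card {e \<in> E. e \<subseteq> \<sigma>})"
    and "two_simplices K = {} \<Longrightarrow> snd P = []"
proof -
  interpret rooted_complex K x b par rk by (rule T)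
  note coc = cocycle_edge_class
  have finK: "finite K" using K by (simp add: simplicial_2_complex_def)
  define n where "n = card E"
  have "finite E" using finK by (simp add: E_def)
  then obtain idx where idx: "bij_betw idx E {..<n}"
    using ex_bij_betw_finite_nat[of E] by (auto simp: n_def lessThan_atLeast0)
  have idx_lt: "idx e < n" if "e \<in> E" for e using idx that by (auto simp: bij_betw_def)
  have idx_inj: "idx e = idx e' \<longleftrightarrow> e = e'" if "e \<in> E" "e' \<in> E" for e e'
    using idx that by (auto simp: bij_betw_def inj_on_def)
  \<comment> \<open>Edges are unordered pairs. A generator is oriented from the smaller to the
    larger vertex, in agreement with the sign \<open>u < v\<close> in \<open>wd\<close>.\<close>
  define f where "f i = edge_class (Min (inv_into E idx i)) (Max (inv_into E idx i))" for i
  define wd where "wd u v = (if {u, v} \<in> E then [(idx {u, v}, u < v)] else [])" for u v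
  let ?F = "free_group {..<n}"
  interpret F: group ?F by (rule group_free_group)
  have E2: "card e = 2" if "e \<in> E" for e using that by (simp add: E_def)
  have wd_same: "wd u u = []" for u
    using E2[of "{u}"] by (auto simp: wd_def)
  have wd_tree: "wd (par v) v = []" if "{v} \<in> K" "v \<noteq> b" for v
    using that by (auto simp: wd_def E_def)
  have wd_F: "wd u v \<in> carrier ?F" for u v
    using idx_lt by (auto simp: wd_def free_group_simps)
  have wd_inv: "inv\<^bsub>?F\<^esub> (wd u v) = wd v u" for u v
  proof (rule F.inv_equality)
    show "wd v u \<otimes>\<^bsub>?F\<^esub> wd u v = \<one>\<^bsub>?F\<^esub>"
      using wd_same by (cases "u = v") (auto simp: wd_def free_group_simps inv_letter_def insert_commute)
  qed (rule wd_F)+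
  define T' where "T' = {\<sigma> \<in> two_simplices K. b \<notin> \<sigma>}"
  have finT': "finite T'" using finK by (simp add: T'_def two_simplices_def)
  have "\<forall>\<sigma>\<in>two_simplices K. \<exists>t. \<sigma> = {fst t, fst (snd t), snd (snd t)} \<and>
      fst t \<noteq> fst (snd t) \<and> fst (snd t) \<noteq> snd (snd t) \<and> fst t \<noteq> snd (snd t)"
  proof
    fix \<sigma> assume "\<sigma> \<in> two_simplices K"
    then obtain u v w where "\<sigma> = {u, v, w} \<and> u \<noteq> v \<and> v \<noteq> w \<and> u \<noteq> w"
      by (auto simp: two_simplices_def card_3_iff)
    then show "\<exists>t. \<sigma> = {fst t, fst (snd t), snd (snd t)} \<and>
      fst t \<noteq> fst (snd t) \<and> fst (snd t) \<noteq> snd (snd t) \<and> fst t \<noteq> snd (snd t)"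
      by (intro exI[of _ "(u, v, w)"]) simp
  qed
  then obtain tr where tr: "\<forall>\<sigma>\<in>two_simplices K. \<sigma> = {fst (tr \<sigma>), fst (snd (tr \<sigma>)), snd (snd (tr \<sigma>))} \<and>
      fst (tr \<sigma>) \<noteq> fst (snd (tr \<sigma>)) \<and> fst (snd (tr \<sigma>)) \<noteq> snd (snd (tr \<sigma>)) \<and> fst (tr \<sigma>) \<noteq> snd (snd (tr \<sigma>))"
    by (metis bchoice)
  define U V W where "U \<sigma> = fst (tr \<sigma>)" and "V \<sigma> = fst (snd (tr \<sigma>))" and "W \<sigma> = snd (snd (tr \<sigma>))" for \<sigma>
  have UVW: "\<sigma> = {U \<sigma>, V \<sigma>, W \<sigma>}" "U \<sigma> \<noteq> V \<sigma>" "V \<sigma> \<noteq> W \<sigma>" "U \<sigma> \<noteq> W \<sigma>" if "\<sigma> \<in> two_simplices K" for \<sigma>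
    using tr that unfolding U_def V_def W_def by blast+
  define rel where "rel \<sigma> = wd (U \<sigma>) (V \<sigma>) @ wd (V \<sigma>) (W \<sigma>) @ wd (W \<sigma>) (U \<sigma>)" for \<sigma>
  have sides: "{U \<sigma>, V \<sigma>} \<noteq> {V \<sigma>, W \<sigma>}" "{V \<sigma>, W \<sigma>} \<noteq> {W \<sigma>, U \<sigma>}" "{U \<sigma>, V \<sigma>} \<noteq> {W \<sigma>, U \<sigma>}"
    if "\<sigma> \<in> two_simplices K" for \<sigma>
    using UVW(2-4)[OF that] by (auto simp: doubleton_eq_iff)
  have rel_red: "freely_reduced (rel \<sigma>)" if "\<sigma> \<in> two_simplices K" for \<sigma>
    using sides[OF that] unfolding rel_def
    by (intro freely_reduced_distinct) (auto simp: wd_def idx_inj)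
  have rel_F: "rel \<sigma> \<in> carrier ?F" if "\<sigma> \<in> two_simplices K" for \<sigma>
    using rel_red[OF that] wd_F by (auto simp: free_group_simps rel_def)
  have rel_mult: "rel \<sigma> = wd (U \<sigma>) (V \<sigma>) \<otimes>\<^bsub>?F\<^esub> wd (V \<sigma>) (W \<sigma>) \<otimes>\<^bsub>?F\<^esub> wd (W \<sigma>) (U \<sigma>)"
    if "\<sigma> \<in> two_simplices K" for \<sigma>
  proof -
    have r: "freely_reduced (wd (U \<sigma>) (V \<sigma>) @ wd (V \<sigma>) (W \<sigma>) @ wd (W \<sigma>) (U \<sigma>))"
      using rel_red[OF that] by (simp add: rel_def)
    have r': "freely_reduced (wd (V \<sigma>) (W \<sigma>) @ wd (W \<sigma>) (U \<sigma>))"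
      using r by (auto simp: wd_def split: if_splits)
    have "wd (U \<sigma>) (V \<sigma>) \<otimes>\<^bsub>?F\<^esub> wd (V \<sigma>) (W \<sigma>) \<otimes>\<^bsub>?F\<^esub> wd (W \<sigma>) (U \<sigma>) =
        wd (U \<sigma>) (V \<sigma>) \<otimes>\<^bsub>?F\<^esub> (wd (V \<sigma>) (W \<sigma>) \<otimes>\<^bsub>?F\<^esub> wd (W \<sigma>) (U \<sigma>))"
      by (rule F.m_assoc) (rule wd_F)+
    also have "\<dots> = rel \<sigma>"
      using foldr_push_append[OF r'] foldr_push_append[OF r] by (simp add: free_group_simps rel_def)
    finally show ?thesis by simp
  qed
  obtain ts where ts: "set ts = T'" "distinct ts" using finite_distinct_list[OF finT'] by blast
  define rs where "rs = map rel ts"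
  have rs_F: "set rs \<subseteq> carrier ?F" using rel_F ts by (auto simp: rs_def T'_def)
  have len: "length (rel \<sigma>) = card {e \<in> E. e \<subseteq> \<sigma>}" if "\<sigma> \<in> two_simplices K" for \<sigma>
  proof -
    have "card {e \<in> E. e \<subseteq> \<sigma>} = card {e \<in> E. e \<subseteq> {U \<sigma>, V \<sigma>, W \<sigma>}}"
      using UVW(1)[OF that] by simp
    also have "\<dots> = length (rel \<sigma>)"
      by (subst card_two_subsets_triple) (use UVW(2-4)[OF that] E2 in \<open>auto simp: rel_def wd_def\<close>)
    finally show ?thesis by simp
  qed
  have plen: "presentation_length (n, rs) = (\<Sum>\<sigma>\<in>T'. card {e \<in> E. e \<subseteq> \<sigma>})"
  proof -
    have "presentation_length (n, rs) = (\<Sum>\<sigma>\<in>T'. length (rel \<sigma>))"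
      using sum_list_distinct_conv_sum_set[OF ts(2), of "\<lambda>\<sigma>. length (rel \<sigma>)"] ts(1)
      by (simp add: presentation_length_def rs_def comp_def)
    then show ?thesis using len by (simp add: T'_def)
  qed
  have edgeK: "{u, v} \<in> K" if "{u, v} \<in> E" for u v using that by (simp add: E_def)
  have f_val: "f (idx {u, v}) = (if u < v then edge_class u v else edge_class v u)" if "{u, v} \<in> E" for u v
  proof -
    have "inv_into E idx (idx {u, v}) = {u, v}"
      using idx that by (auto simp: bij_betw_def)
    then show ?thesis by (auto simp: f_def min_def max_def)
  qed
  have trivial: "edge_class u v = \<one>\<^bsub>\<pi>\<^esub>" if uv: "{u, v} \<in> K" "{u, v} \<notin> E" for u v
  proof (cases "u = v")
    case True
    then show ?thesis using cocycle_same[OF coc group_\<pi>] uv by simp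
  next
    case False
    have tree: "edge_class (par w) w = \<one>\<^bsub>\<pi>\<^esub> \<and> edge_class w (par w) = \<one>\<^bsub>\<pi>\<^esub>" if "{w} \<in> K" "w \<noteq> b" for w
      using edge_class_par[OF that] cocycle_inv[OF coc group_\<pi> K, of "par w" w] par[OF that] by auto
    consider w where "{w} \<in> K" "w \<noteq> b" "{u, v} = {par w, w}" | "{b, u, v} \<in> two_simplices K"
      using uv False by (auto simp: E_def)
    then show ?thesis
    proof cases
      case 1
      then show ?thesis using tree[OF 1(1,2)] by (auto simp: doubleton_eq_iff)
    next
      case 2
      then have K3: "{b, u, v} \<in> K" and "u \<noteq> b" "v \<noteq> b"
        using False by (auto simp: two_simplices_def card_insert_if split: if_splits)
      then have "par u = b" "par v = b" "{u} \<in> K" "{v} \<in> K"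
        using star[of u] star[of v] face[OF K3, of "{b, u}"] face[OF K3, of "{b, v}"] in_vertex[OF K3] by auto
      then have "edge_class u b = \<one>\<^bsub>\<pi>\<^esub>" "edge_class b v = \<one>\<^bsub>\<pi>\<^esub>"
        using tree \<open>u \<noteq> b\<close> \<open>v \<noteq> b\<close> by metis+
      then show ?thesis using cocycleD(2)[OF coc K3, of u b v] by simp
    qed
  qed
  have ec: "edge_class u v \<in> carrier \<pi>" if "{u, v} \<in> K" for u v
    using cocycleD(1)[OF coc that] by auto
  have wd_val: "word_val \<pi> f (wd u v) = edge_class u v" if uv: "{u, v} \<in> K" for u v
  proof (cases "{u, v} \<in> E")
    case True
    have vu: "{v, u} \<in> K" using uv by (simp add: insert_commute)
    show ?thesis
      using True ec[OF uv] ec[OF vu] cocycle_inv[OF coc group_\<pi> K vu]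
      by (auto simp: wd_def letter_val_def f_val)
  next
    case False
    then show ?thesis using trivial[OF uv] by (simp add: wd_def)
  qed
  have f_closed: "f i \<in> carrier \<pi>" if "i < n" for i
  proof -
    obtain e where e: "e \<in> E" "i = idx e" using idx \<open>i < n\<close> by (auto simp: bij_betw_def)
    then obtain u v where "e = {u, v}" using E2 by (meson card_2_iff)
    then show ?thesis using e f_val[of u v] ec[of u v] ec[of v u] edgeK[of u v] by (auto simp: insert_commute)
  qed
  interpret h: group_hom ?F \<pi> "word_val \<pi> f"
    using word_val_hom[OF group_\<pi>, of "{..<n}" f] f_closed
    by (simp add: group_hom_def group_hom_axioms_def group_\<pi> group_free_group)
  define N where "N = normal_closure ?F (set rs)"
  interpret N: normal N ?F unfolding N_def by (rule F.normal_closure_normal[OF rs_F])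
  have Q: "group (?F Mod N)" by (rule N.factorgroup_is_group)
  interpret q: group_hom ?F "?F Mod N" "\<lambda>w. N #>\<^bsub>?F\<^esub> w"
    using N.r_coset_hom_Mod Q by (simp add: group_hom_def group_hom_axioms_def group_free_group)
  define \<phi> where "\<phi> u v = N #>\<^bsub>?F\<^esub> wd u v" for u v
  have "cocycle K (?F Mod N) \<phi>"
  proof (rule cocycleI[OF K Q])
    fix u v :: nat
    show "\<phi> u v \<in> carrier (?F Mod N)" unfolding \<phi>_def by (rule q.hom_closed[OF wd_F])
    show "\<phi> u u = \<one>\<^bsub>?F Mod N\<^esub>" using q.hom_one by (simp add: \<phi>_def wd_same free_group_simps)
    show "\<phi> v u = inv\<^bsub>?F Mod N\<^esub> (\<phi> u v)"
      unfolding \<phi>_def using q.hom_inv[OF wd_F[of u v]] wd_inv by simp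
  next
    fix \<sigma> assume \<sigma>: "\<sigma> \<in> two_simplices K"
    have "rel \<sigma> \<in> N"
    proof (cases "b \<in> \<sigma>")
      case True
      \<comment> \<open>A triangle at \<open>b\<close> has two sides in the tree, and its third side
        was excluded from \<open>E\<close>. Its word is empty, so the cocycle condition holds
        although the triangle contributes no relator.\<close>
      have wd0: "wd u v = []" if "u \<in> \<sigma>" "v \<in> \<sigma>" for u v
      proof -
        have \<sigma>K: "\<sigma> \<in> K" "card \<sigma> = 3" using \<sigma> by (auto simp: two_simplices_def)
        have "{u, v} \<notin> E"
        proof
          assume e: "{u, v} \<in> E"
          then have uv: "u \<noteq> v" using E2[OF e] by auto
          have tr: "{w, b} \<notin> E" if "w \<in> \<sigma>" "w \<noteq> b" for w
            using star[of w] face[OF \<sigma>K(1), of "{b, w}"] in_vertex[OF \<sigma>K(1) that(1)] that True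
            by (auto simp: E_def insert_commute)
          have ub: "u \<noteq> b" using tr[of v] that e uv by (auto simp: insert_commute)
          have vb: "v \<noteq> b" using tr[of u] that e uv by auto
          have "card {b, u, v} = 3" using uv ub vb by auto
          then have "{b, u, v} = \<sigma>"
            using True that \<sigma>K finite_face[OF \<sigma>K(1)] by (intro card_subset_eq) auto
          then show False using e \<sigma> by (simp add: E_def)
        qed
        then show ?thesis by (simp add: wd_def)
      qed
      have m: "U \<sigma> \<in> \<sigma>" "V \<sigma> \<in> \<sigma>" "W \<sigma> \<in> \<sigma>" by (subst (2) UVW(1)[OF \<sigma>], simp)+
      have "rel \<sigma> = \<one>\<^bsub>?F\<^esub>" by (simp add: rel_def wd0 m free_group_simps)
      then show ?thesis using N.one_closed by simp
    next
      case False
      then have "rel \<sigma> \<in> set rs" using \<sigma> ts by (auto simp: rs_def T'_def)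
      then show ?thesis unfolding N_def by (rule F.normal_closure_incl[OF _ rs_F])
    qed
    then have "N #>\<^bsub>?F\<^esub> rel \<sigma> = \<one>\<^bsub>?F Mod N\<^esub>"
      using F.coset_join2[OF rel_F[OF \<sigma>] N.is_subgroup] by (simp add: FactGroup_def)
    then have "\<phi> (U \<sigma>) (V \<sigma>) \<otimes>\<^bsub>?F Mod N\<^esub> \<phi> (V \<sigma>) (W \<sigma>) \<otimes>\<^bsub>?F Mod N\<^esub> \<phi> (W \<sigma>) (U \<sigma>) = \<one>\<^bsub>?F Mod N\<^esub>"
      unfolding rel_mult[OF \<sigma>] \<phi>_def using q.hom_mult wd_F by simp
    then show "\<exists>u v w. \<sigma> = {u, v, w} \<and> \<phi> u v \<otimes>\<^bsub>?F Mod N\<^esub> \<phi> v w \<otimes>\<^bsub>?F Mod N\<^esub> \<phi> w u = \<one>\<^bsub>?F Mod N\<^esub>"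
      using UVW(1)[OF \<sigma>] by blast
  qed
  moreover have "\<phi> (par v) v = \<one>\<^bsub>?F Mod N\<^esub>" if "{v} \<in> K" "v \<noteq> b" for v
    using wd_tree[OF that] q.hom_one by (simp add: \<phi>_def free_group_simps)
  ultimately obtain \<Phi> where \<Phi>: "\<Phi> \<in> hom \<pi> (?F Mod N)" "\<And>u v. {u, v} \<in> K \<Longrightarrow> \<Phi> (edge_class u v) = \<phi> u v"
    using cocycle_hom[OF Q] by blast
  have "presents (n, rs) \<pi>"
  proof (rule presentsI[OF group_\<pi> f_closed rs_F])
    fix r assume "r \<in> set rs"
    then obtain \<sigma> where r: "r = rel \<sigma>" and \<sigma>: "\<sigma> \<in> two_simplices K" using ts by (auto simp: rs_def T'_def)
    have \<sigma>K: "\<sigma> \<in> K" using \<sigma> by (simp add: two_simplices_def)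
    have m: "U \<sigma> \<in> \<sigma>" "V \<sigma> \<in> \<sigma>" "W \<sigma> \<in> \<sigma>" by (subst (2) UVW(1)[OF \<sigma>], simp)+
    have e: "{U \<sigma>, V \<sigma>} \<in> K" "{V \<sigma>, W \<sigma>} \<in> K" "{W \<sigma>, U \<sigma>} \<in> K"
      using face[OF \<sigma>K] m by auto
    have "word_val \<pi> f r = edge_class (U \<sigma>) (V \<sigma>) \<otimes>\<^bsub>\<pi>\<^esub> edge_class (V \<sigma>) (W \<sigma>) \<otimes>\<^bsub>\<pi>\<^esub> edge_class (W \<sigma>) (U \<sigma>)"
      unfolding r rel_mult[OF \<sigma>] using h.hom_mult wd_F wd_val[OF e(1)] wd_val[OF e(2)] wd_val[OF e(3)] by simp
    also have "\<dots> = edge_class (U \<sigma>) (U \<sigma>)"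
      using cocycleD(2)[OF coc \<sigma>K] m by metis
    also have "\<dots> = \<one>\<^bsub>\<pi>\<^esub>" by (rule cocycle_same[OF coc group_\<pi> in_vertex[OF \<sigma>K m(1)]])
    finally show "word_val \<pi> f r = \<one>\<^bsub>\<pi>\<^esub>" .
  next
    have "edge_class u v \<in> generate \<pi> (f ` {..<n})" if "{u, v} \<in> K" for u v
      unfolding wd_val[OF that, symmetric]
      using idx_lt by (intro word_val_in_generate group_\<pi>) (auto simp: wd_def split: if_splits)
    then have "edge_subgroup \<subseteq> generate \<pi> (f ` {..<n})"
      using f_closed by (intro P.generate_subgroup_incl P.generate_is_subgroup) auto
    then show "carrier \<pi> \<subseteq> generate \<pi> (f ` {..<n})" by (simp add: edge_classes_generate)
  next
    show "\<Phi> \<in> hom \<pi> (?F Mod normal_closure ?F (set rs))" using \<Phi>(1) by (simp add: N_def)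
    fix i assume "i < n"
    then obtain e where e: "e \<in> E" "i = idx e" using idx by (auto simp: bij_betw_def)
    then obtain u v where uv: "e = {u, v}" "u \<noteq> v" using E2 by (meson card_2_iff)
    define p q where "p = min u v" and "q = max u v"
    have pq: "e = {p, q}" "p < q" using uv by (auto simp: p_def q_def min_def max_def)
    have "f i = edge_class p q" using f_val[of p q] e pq by simp
    then have "\<Phi> (f i) = N #>\<^bsub>?F\<^esub> wd p q"
      using \<Phi>(2)[OF edgeK[of p q]] e pq by (simp add: \<phi>_def)
    then show "\<Phi> (f i) = normal_closure ?F (set rs) #>\<^bsub>?F\<^esub> [(i, True)]"
      using e pq by (simp add: wd_def N_def)
  qed
  moreover have "snd (n, rs) = []" if "two_simplices K = {}"
    using ts that by (simp add: rs_def T'_def)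
  ultimately show ?thesis using that plen by (auto simp: T'_def)
qed

section \<open>Counting the letters saved around a vertex\<close>

lemma sum_triangles_bound:
  assumes T: "finite T" "\<And>\<sigma>. \<sigma> \<in> T \<Longrightarrow> card \<sigma> = 3" and b: "\<sigma>\<^sub>0 \<in> T" "b \<in> \<sigma>\<^sub>0"
    and no_free: "\<And>\<sigma> p q. \<sigma> \<in> T \<Longrightarrow> p \<in> \<sigma> \<Longrightarrow> q \<in> \<sigma> \<Longrightarrow> p \<noteq> q \<Longrightarrow> \<exists>\<tau>\<in>T. p \<in> \<tau> \<and> q \<in> \<tau> \<and> \<tau> \<noteq> \<sigma>"
    and E: "\<And>e. e \<in> E \<Longrightarrow> card e = 2 \<and> insert b e \<notin> T"
  shows "(\<Sum>\<sigma>\<in>{\<sigma>\<in>T. b \<notin> \<sigma>}. card {e\<in>E. e \<subseteq> \<sigma>}) + 12 \<le> 3 * card T"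
proof -
  have fin: "finite \<sigma>" if "\<sigma> \<in> T" for \<sigma> using T(2)[OF that] card.infinite by fastforce
  have third: "\<exists>r. \<tau> = {p, q, r} \<and> r \<noteq> p \<and> r \<noteq> q" if "\<tau> \<in> T" "p \<in> \<tau>" "q \<in> \<tau>" "p \<noteq> q" for \<tau> p q
  proof -
    have "card (\<tau> - {p, q}) = 1" using T(2)[OF that(1)] that by (simp add: card_Diff_subset)
    then obtain r where "\<tau> - {p, q} = {r}" by (meson card_1_singletonE)
    then show ?thesis using that by blast
  qed
  \<comment> \<open>The two edges from \<open>b\<close> to \<open>p\<close> and \<open>q\<close>
    each lie in a second triangle, which gives three triangles at \<open>b\<close> with three
    distinct opposite edges \<open>L\<close>. The new vertices \<open>q'\<close> and
    \<open>p'\<close> may coincide, as they do in the boundary of a tetrahedron; there the estimate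
    is an equality.\<close>
  obtain p where p: "p \<in> \<sigma>\<^sub>0" "p \<noteq> b"
  proof -
    have "\<sigma>\<^sub>0 \<noteq> {b}" using T(2)[OF b(1)] by auto
    then show ?thesis using b(2) that by blast
  qed
  obtain q where q: "\<sigma>\<^sub>0 = {b, p, q}" "q \<noteq> b" "q \<noteq> p" using third[OF b(1,2) p(1)] p(2) by blast
  obtain \<sigma>\<^sub>1 where \<sigma>1: "\<sigma>\<^sub>1 \<in> T" "b \<in> \<sigma>\<^sub>1" "p \<in> \<sigma>\<^sub>1" "\<sigma>\<^sub>1 \<noteq> \<sigma>\<^sub>0" using no_free[OF b(1,2) p(1)] p(2) by blast
  obtain q' where q': "\<sigma>\<^sub>1 = {b, p, q'}" "q' \<noteq> b" "q' \<noteq> p" using third[OF \<sigma>1(1-3)] p(2) by blast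
  obtain \<sigma>\<^sub>2 where \<sigma>2: "\<sigma>\<^sub>2 \<in> T" "b \<in> \<sigma>\<^sub>2" "q \<in> \<sigma>\<^sub>2" "\<sigma>\<^sub>2 \<noteq> \<sigma>\<^sub>0" using no_free[OF b(1,2), of q] q by auto
  obtain p' where p': "\<sigma>\<^sub>2 = {b, q, p'}" "p' \<noteq> b" "p' \<noteq> q" using third[OF \<sigma>2(1-3)] q(2) by blast
  have ne: "q' \<noteq> q" "p' \<noteq> p" using q q' p' \<sigma>1(4) \<sigma>2(4) by auto
  define S where "S = {\<sigma>\<in>T. b \<in> \<sigma>}"
  define R where "R = {\<sigma>\<in>T. b \<notin> \<sigma>}"
  define L where "L = {{p, q}, {p, q'}, {q, p'}}"
  have cardL: "card L = 3" and L2: "\<And>e. e \<in> L \<Longrightarrow> card e = 2 \<and> insert b e \<in> T \<and> b \<notin> e"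
    using ne q q' p' p b \<sigma>1 \<sigma>2 by (auto simp: L_def doubleton_eq_iff)
  have "{\<sigma>\<^sub>0, \<sigma>\<^sub>1, \<sigma>\<^sub>2} \<subseteq> S" using b \<sigma>1 \<sigma>2 by (auto simp: S_def)
  moreover have "\<sigma>\<^sub>1 \<noteq> \<sigma>\<^sub>2" unfolding q'(1) p'(1) using ne q by (auto simp: set_eq_iff)
  then have "card {\<sigma>\<^sub>0, \<sigma>\<^sub>1, \<sigma>\<^sub>2} = 3" using \<sigma>1(4) \<sigma>2(4) by auto
  ultimately have S3: "3 \<le> card S" using card_mono[of S "{\<sigma>\<^sub>0, \<sigma>\<^sub>1, \<sigma>\<^sub>2}"] T(1) by (simp add: S_def)
  have finR: "finite R" using T(1) by (simp add: R_def)
  have "T = S \<union> R" "S \<inter> R = {}" by (auto simp: S_def R_def)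
  then have cardT: "card T = card S + card R"
    using T(1) finR card_Un_disjoint[of S R] by (simp add: S_def)
  \<comment> \<open>Adding the vertex \<open>b\<close> to an edge gives a triangle for edges in
    \<open>L\<close> and never for edges in \<open>E\<close>. The two families are therefore
    disjoint and share the three sides of a triangle.\<close>
  have per: "card {e\<in>E. e \<subseteq> \<sigma>} + card {e\<in>L. e \<subseteq> \<sigma>} \<le> 3" if \<sigma>: "\<sigma> \<in> R" for \<sigma>
  proof -
    have \<sigma>T: "finite \<sigma>" "card \<sigma> = 3" using \<sigma> fin T(2) by (auto simp: R_def)
    have sub: "{e\<in>E. e \<subseteq> \<sigma>} \<union> {e\<in>L. e \<subseteq> \<sigma>} \<subseteq> {e. e \<subseteq> \<sigma> \<and> card e = 2}" using E L2 by auto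
    have f: "finite {e. e \<subseteq> \<sigma> \<and> card e = 2}" using \<sigma>T(1) by (auto intro: finite_subset[of _ "Pow \<sigma>"])
    have "{e\<in>E. e \<subseteq> \<sigma>} \<inter> {e\<in>L. e \<subseteq> \<sigma>} = {}" using E L2 by blast
    then have "card {e\<in>E. e \<subseteq> \<sigma>} + card {e\<in>L. e \<subseteq> \<sigma>} = card ({e\<in>E. e \<subseteq> \<sigma>} \<union> {e\<in>L. e \<subseteq> \<sigma>})"
      using finite_subset[OF sub f] by (intro card_Un_disjoint[symmetric]) auto
    also have "\<dots> \<le> card {e. e \<subseteq> \<sigma> \<and> card e = 2}" by (rule card_mono[OF f sub])
    also have "\<dots> = 3" using n_subsets[OF \<sigma>T(1), of 2] \<sigma>T(2) by (simp add: choose_two)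
    finally show ?thesis .
  qed
  have "3 \<le> (\<Sum>e\<in>L. card {\<sigma>\<in>R. e \<subseteq> \<sigma>})"
  proof -
    have "1 \<le> card {\<sigma>\<in>R. e \<subseteq> \<sigma>}" if e: "e \<in> L" for e
    proof -
      obtain u v where uv: "e = {u, v}" "u \<noteq> v" using L2[OF e] by (meson card_2_iff)
      then obtain \<tau> where \<tau>: "\<tau> \<in> T" "u \<in> \<tau>" "v \<in> \<tau>" "\<tau> \<noteq> insert b e"
        using no_free[of "insert b e" u v] L2[OF e] by auto
      have "b \<notin> \<tau>"
      proof
        assume "b \<in> \<tau>"
        then have "insert b e \<subseteq> \<tau>" using \<tau> uv by simp
        then have "insert b e = \<tau>"
          using fin[OF \<tau>(1)] T(2)[OF \<tau>(1)] T(2)[of "insert b e"] L2[OF e] by (intro card_subset_eq) auto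
        with \<tau>(4) show False by simp
      qed
      then have "\<tau> \<in> {\<sigma>\<in>R. e \<subseteq> \<sigma>}" using \<tau> uv by (simp add: R_def)
      then have "{\<sigma>\<in>R. e \<subseteq> \<sigma>} \<noteq> {}" by blast
      then show ?thesis using finR by (simp add: Suc_le_eq card_gt_0_iff)
    qed
    then have "(\<Sum>e\<in>L. 1) \<le> (\<Sum>e\<in>L. card {\<sigma>\<in>R. e \<subseteq> \<sigma>})" by (rule sum_mono)
    then show ?thesis using cardL by simp
  qed
  \<comment> \<open>Double counting of the incidences between \<open>L\<close> and the triangles
    away from \<open>b\<close>: each edge of \<open>L\<close> occurs at least once.\<close>
  also have "\<dots> = (\<Sum>\<sigma>\<in>R. card {e\<in>L. e \<subseteq> \<sigma>})"
    using finR sum.swap_restrict[of L R "\<lambda>_ _. 1::nat" "\<lambda>e \<sigma>. e \<subseteq> \<sigma>"] by (simp add: L_def)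
  finally have "(\<Sum>\<sigma>\<in>R. card {e\<in>E. e \<subseteq> \<sigma>}) + 3 \<le> (\<Sum>\<sigma>\<in>R. card {e\<in>E. e \<subseteq> \<sigma>} + card {e\<in>L. e \<subseteq> \<sigma>})"
    by (simp add: sum.distrib)
  also have "\<dots> \<le> (\<Sum>\<sigma>\<in>R. 3)" by (rule sum_mono) (rule per)
  finally show ?thesis using S3 cardT by (simp add: R_def)
qed

theorem c_complexity_upper:
  fixes G :: "('a, 'c) monoid_scheme" and K :: "nat set set"
  assumes G: "group G" "\<not> is_free_group G"
    and simp_K: "simplicial_2_complex K" and fund_K: "complex_has_fundamental_group K G"
    and card_K: "card (two_simplices K) = simplicial_complexity G"
  shows "c_complexity G + 12 \<le> 3 * simplicial_complexity G"
proof -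
  let ?T = "two_simplices K"
  interpret two_complex K using simp_K by (simp add: two_complex_def)
  have finK: "finite K" using simp_K by (simp add: simplicial_2_complex_def)
  obtain x where pc: "path_connected \<R>" and x: "x \<in> \<R>" and iso: "fundamental_group \<R> x \<cong> G"
    using fund_K by (auto simp: complex_has_fundamental_group_def)
  have pres: "\<exists>P E. presents P G \<and> presentation_length P = (\<Sum>\<sigma>\<in>{\<sigma> \<in> ?T. b \<notin> \<sigma>}. card {e \<in> E. e \<subseteq> \<sigma>}) \<and>
      (\<forall>e\<in>E. card e = 2 \<and> insert b e \<notin> ?T) \<and> (?T = {} \<longrightarrow> snd P = [])"
    if b: "{b} \<in> K" for b
  proof -
    obtain par rk where T: "rooted_complex K x b par rk" "\<And>v. {b, v} \<in> K \<Longrightarrow> v \<noteq> b \<Longrightarrow> par v = b"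
      using tree_exists[OF x b edge_connected_of_path_connected[OF pc b]] by blast
    obtain P where P: "presents P (fundamental_group \<R> x)"
      "presentation_length P = (\<Sum>\<sigma>\<in>{\<sigma> \<in> ?T. b \<notin> \<sigma>}. card {e \<in> {e \<in> K. card e = 2 \<and>
        \<not> (\<exists>v. {v} \<in> K \<and> v \<noteq> b \<and> e = {par v, v}) \<and> insert b e \<notin> ?T}. e \<subseteq> \<sigma>})"
      "?T = {} \<Longrightarrow> snd P = []"
      using complex_presentation[OF T] by blast
    show ?thesis
      using presents_iso[OF P(1) iso] P(2,3) by (intro exI[of _ P] exI conjI) (assumption | auto)+
  qed
  \<comment> \<open>Without triangles the presentation would have no relators and \<open>G\<close>
    would be free. This is where the exceptional groups are excluded.\<close>
  have "?T \<noteq> {}"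
  proof
    assume T: "?T = {}"
    obtain v where "x v \<noteq> 0" using support_nonempty[OF x] by blast
    then obtain P where "presents P G" "snd P = []" using pres[OF support_vertex[OF x]] T by blast
    then have "presents (fst P, []) G" by (metis prod.collapse)
    then show False using is_free_group_no_relations G by blast
  qed
  then obtain \<sigma>\<^sub>0 where \<sigma>0: "\<sigma>\<^sub>0 \<in> ?T" by blast
  then have \<sigma>0K: "\<sigma>\<^sub>0 \<in> K" by (simp add: two_simplices_def)
  obtain b where b: "b \<in> \<sigma>\<^sub>0" using nonempty_face[OF \<sigma>0K] by blast
  obtain P E where P: "presents P G" "presentation_length P = (\<Sum>\<sigma>\<in>{\<sigma> \<in> ?T. b \<notin> \<sigma>}. card {e \<in> E. e \<subseteq> \<sigma>})"
    and E: "\<forall>e\<in>E. card e = 2 \<and> insert b e \<notin> ?T"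
    using pres[OF in_vertex[OF \<sigma>0K b]] by blast
  have finT: "finite ?T" using finK by (simp add: two_simplices_def)
  have no_free: "\<exists>\<tau>\<in>?T. p \<in> \<tau> \<and> q \<in> \<tau> \<and> \<tau> \<noteq> \<sigma>" if \<sigma>: "\<sigma> \<in> ?T" and pq: "p \<in> \<sigma>" "q \<in> \<sigma>" "p \<noteq> q" for \<sigma> p q
  proof (rule ccontr)
    assume no: "\<not> ?thesis"
    have "\<sigma> \<in> K" and c: "card \<sigma> = 3" using \<sigma> by (auto simp: two_simplices_def)
    then have "card (\<sigma> - {p, q}) = 1" using pq finite_face[of \<sigma>] by (simp add: card_Diff_subset)
    then obtain w where w: "\<sigma> - {p, q} = {w}" by (meson card_1_singletonE)
    then have \<sigma>w: "\<sigma> = {p, q, w}" "p \<noteq> w" "q \<noteq> w" using pq by auto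
    define L where "L = K - {{p, q}, {p, q, w}}"
    have "{p, q, w} \<in> K" using \<open>\<sigma> \<in> K\<close> \<sigma>w by simp
    moreover have "\<tau> = {p, q, w}" if "\<tau> \<in> ?T" "p \<in> \<tau>" "q \<in> \<tau>" for \<tau> using no that \<sigma>w by auto
    ultimately have L: "simplicial_2_complex L" "path_connected (geometric_realization L)"
      "\<exists>y\<in>geometric_realization L. fundamental_group (geometric_realization L) y \<cong> fundamental_group \<R> x"
      "two_simplices L = ?T - {{p, q, w}}"
      unfolding L_def using collapse[OF simp_K pc x _ pq(3) \<sigma>w(2,3)] by blast+
    have "complex_has_fundamental_group L G"
      using L(2,3) iso iso_trans unfolding complex_has_fundamental_group_def by blast
    then have "simplicial_complexity G \<le> card (two_simplices L)"
      unfolding simplicial_complexity_def using L(1) by (intro Least_le) blast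
    moreover have "card (two_simplices L) < card ?T"
      unfolding L(4) using \<sigma> \<sigma>w(1) finT by (intro psubset_card_mono) auto
    ultimately show False using card_K by simp
  qed
  have "c_complexity G \<le> presentation_length P"
    unfolding c_complexity_def using P(1) by (intro Least_le) blast
  moreover have "presentation_length P + 12 \<le> 3 * card ?T"
    unfolding P(2) by (rule sum_triangles_bound[OF finT _ \<sigma>0 b no_free])
      (use E in \<open>auto simp: two_simplices_def\<close>)
  ultimately show ?thesis using card_K by simp
qed

section \<open>A complex built from a presentation\<close>

text \<open>Every generator becomes a triangle \<open>Base, Mid a False, Mid a True\<close> of edges. A relator of
  length \<open>k \<ge> 2\<close> is filled by a disc whose boundary has \<open>3 k\<close> corners and whose interior vertices
  form a ring of \<open>p = \<lceil>3 k / 2\<rceil>\<close> vertices: the ring vertex \<open>j\<close> sees only the consecutive corners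
  \<open>2 j, 2 j + 1, 2 j + 2\<close>, which are distinct vertices because the relator is reduced. Hence no two
  simplices of the disc are identified, and it has \<open>3 k + p + (p - 2) \<le> 6 k - 1\<close> triangles.\<close>

datatype cvertex = Base | Mid nat bool | Ring nat nat

text \<open>The boundary of the disc reads three edges for each letter. For a generator they pass
  \<open>Base\<close>, \<open>Mid a False\<close>, \<open>Mid a True\<close>, \<open>Base\<close>,
  for an inverse the two midpoints are exchanged; comparing the sign of the letter with
  \<open>m mod 3 = 2\<close> selects the right one. The last corner, at three times the length, is
  \<open>Base\<close> again.\<close>

definition corner :: "nat word \<Rightarrow> nat \<Rightarrow> cvertex" where
  "corner r m = (if m mod 3 = 0 then Base
     else Mid (fst (r ! (m div 3))) (snd (r ! (m div 3)) = (m mod 3 = 2)))"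

definition ring_size :: "nat word \<Rightarrow> nat" where
  "ring_size r = (3 * length r + 1) div 2"

definition outer_cells :: "nat \<Rightarrow> nat word \<Rightarrow> cvertex set set" where
  "outer_cells i r = (\<lambda>m. {Ring i (m div 2), corner r m, corner r (Suc m)}) ` {..<3 * length r}"

definition inner_cells :: "nat \<Rightarrow> nat word \<Rightarrow> cvertex set set" where
  "inner_cells i r = (\<lambda>j. {Ring i j, Ring i (Suc j), corner r (2 * j + 2)}) ` {..<ring_size r - 1}"

definition fan_cells :: "nat \<Rightarrow> nat word \<Rightarrow> cvertex set set" where
  "fan_cells i r = (\<lambda>j. {Ring i 0, Ring i j, Ring i (Suc j)}) ` {1..<ring_size r - 1}"

text \<open>For a relator of length 1 the ring would have only two vertices; its three corners are
  filled by a single triangle instead. The additional cell closes the ring at \<open>Base\<close>,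
  which is both the first and the last corner.\<close>

definition disc :: "nat \<Rightarrow> nat word \<Rightarrow> cvertex set set" where
  "disc i r = (if length r = 1 then {{Base, Mid (fst (hd r)) False, Mid (fst (hd r)) True}}
     else insert {Ring i (ring_size r - 1), Ring i 0, Base} (outer_cells i r \<union> inner_cells i r \<union> fan_cells i r))"

definition rose :: "nat \<Rightarrow> cvertex set set" where
  "rose n = insert {Base} ((\<lambda>(a, s). {Base, Mid a s}) ` ({..<n} \<times> UNIV) \<union>
     (\<lambda>a. {Mid a False, Mid a True}) ` {..<n})"

definition pres_cells :: "nat \<Rightarrow> nat word list \<Rightarrow> cvertex set set" where
  "pres_cells n rs = rose n \<union> (\<Union>i<length rs. disc i (rs ! i))"

definition pres_complex :: "nat \<Rightarrow> nat word list \<Rightarrow> cvertex set set" where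
  "pres_complex n rs = {\<tau>. \<tau> \<noteq> {} \<and> (\<exists>\<sigma>\<in>pres_cells n rs. \<tau> \<subseteq> \<sigma>)}"

lemma finite_disc: "finite (disc i r)"
  by (simp add: disc_def outer_cells_def inner_cells_def fan_cells_def)

lemma finite_pres_cells: "finite (pres_cells n rs)"
  by (auto simp: pres_cells_def rose_def finite_disc)

lemma card_disc_cell: "\<sigma> \<in> disc i r \<Longrightarrow> finite \<sigma> \<and> card \<sigma> \<le> 3"
  by (auto simp: disc_def outer_cells_def inner_cells_def fan_cells_def card_insert_if split: if_splits)

lemma card_rose_cell: "\<sigma> \<in> rose n \<Longrightarrow> finite \<sigma> \<and> card \<sigma> \<le> 2"
  by (auto simp: rose_def card_insert_if)

lemma simplicial_pres_complex: "simplicial_2_complex (pres_complex n rs)"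
  unfolding simplicial_2_complex_def
proof (intro conjI ballI allI impI)
  have c: "finite \<sigma> \<and> card \<sigma> \<le> 3" if "\<sigma> \<in> pres_cells n rs" for \<sigma>
    using that card_disc_cell card_rose_cell by (fastforce simp: pres_cells_def)
  have "pres_complex n rs \<subseteq> (\<Union>\<sigma>\<in>pres_cells n rs. Pow \<sigma>)"
    by (auto simp: pres_complex_def)
  moreover have "finite (\<Union>\<sigma>\<in>pres_cells n rs. Pow \<sigma>)"
    using finite_pres_cells c by auto
  ultimately show "finite (pres_complex n rs)" by (rule finite_subset)
  fix \<tau> assume \<tau>: "\<tau> \<in> pres_complex n rs"
  then obtain \<sigma> where \<sigma>: "\<sigma> \<in> pres_cells n rs" "\<tau> \<subseteq> \<sigma>" "\<tau> \<noteq> {}" by (auto simp: pres_complex_def)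
  show "finite \<tau>" "\<tau> \<noteq> {}" using \<sigma> c[OF \<sigma>(1)] finite_subset by auto
  show "card \<tau> \<le> 3" using card_mono[of \<sigma> \<tau>] \<sigma> c[OF \<sigma>(1)] by auto
  fix \<rho> assume "\<rho> \<noteq> {} \<and> \<rho> \<subseteq> \<tau>"
  then show "\<rho> \<in> pres_complex n rs" using \<sigma> unfolding pres_complex_def by blast
qed

lemma card_disc:
  assumes "r \<noteq> []"
  shows "card (disc i r) + 1 \<le> 6 * length r"
proof (cases "length r = 1")
  case False
  then have k: "length r \<ge> 2" using assms by (cases r) (auto simp: Suc_le_eq)
  have "card (disc i r) \<le> Suc (card (outer_cells i r \<union> inner_cells i r \<union> fan_cells i r))"
    using False by (simp add: disc_def card_insert_le_m1 outer_cells_def inner_cells_def fan_cells_def card_insert_if)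
  also have "card (outer_cells i r \<union> inner_cells i r \<union> fan_cells i r) \<le>
      card (outer_cells i r) + card (inner_cells i r) + card (fan_cells i r)"
    using card_Un_le[of "outer_cells i r \<union> inner_cells i r" "fan_cells i r"]
      card_Un_le[of "outer_cells i r" "inner_cells i r"] by linarith
  also have "card (outer_cells i r) \<le> 3 * length r"
    unfolding outer_cells_def by (rule order_trans[OF card_image_le]) simp_all
  also have "card (inner_cells i r) \<le> ring_size r - 1"
    unfolding inner_cells_def by (rule order_trans[OF card_image_le]) simp_all
  also have "card (fan_cells i r) \<le> ring_size r - 2"
    unfolding fan_cells_def by (rule order_trans[OF card_image_le]) simp_all
  finally have "card (disc i r) \<le> Suc (3 * length r + (ring_size r - 1) + (ring_size r - 2))" by simp
  moreover have "2 * ring_size r \<le> 3 * length r + 1" "ring_size r \<ge> 3"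
    using k by (auto simp: ring_size_def)
  ultimately show ?thesis by linarith
qed (simp add: disc_def)

text \<open>The rose has no triangles, so every 2-simplex is a whole cell of a disc. Each disc stays
  at least one below six times the length of its relator, and these units add up to
  \<open>length rs\<close>.\<close>

lemma card_two_simplices_pres_complex:
  assumes "\<And>r. r \<in> set rs \<Longrightarrow> r \<noteq> []"
  shows "card (two_simplices (pres_complex n rs)) + length rs \<le> 6 * presentation_length (n, rs)"
proof -
  have "two_simplices (pres_complex n rs) \<subseteq> (\<Union>i<length rs. disc i (rs ! i))"
  proof
    fix \<tau> assume "\<tau> \<in> two_simplices (pres_complex n rs)"
    then obtain \<sigma> where \<sigma>: "\<sigma> \<in> pres_cells n rs" "\<tau> \<subseteq> \<sigma>" and \<tau>: "card \<tau> = 3"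
      by (auto simp: two_simplices_def pres_complex_def)
    have "\<sigma> \<notin> rose n"
    proof
      assume "\<sigma> \<in> rose n"
      then have "card \<tau> \<le> 2" using card_rose_cell[of \<sigma> n] card_mono[of \<sigma> \<tau>] \<sigma>(2) by auto
      with \<tau> show False by simp
    qed
    then obtain i where i: "i < length rs" "\<sigma> \<in> disc i (rs ! i)" using \<sigma>(1) by (auto simp: pres_cells_def)
    then have "\<tau> = \<sigma>" using card_disc_cell[OF i(2)] \<tau> \<sigma>(2) by (intro card_seteq) auto
    then show "\<tau> \<in> (\<Union>i<length rs. disc i (rs ! i))" using i by auto
  qed
  then have "card (two_simplices (pres_complex n rs)) \<le> card (\<Union>i<length rs. disc i (rs ! i))"
    by (rule card_mono[rotated]) (simp add: finite_disc)
  also have "\<dots> \<le> (\<Sum>i<length rs. card (disc i (rs ! i)))" by (rule card_UN_le) simp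
  finally have "card (two_simplices (pres_complex n rs)) + length rs \<le> (\<Sum>i<length rs. card (disc i (rs ! i)) + 1)"
    by (simp add: sum.distrib del: One_nat_def) 
  also have "\<dots> \<le> (\<Sum>i<length rs. 6 * length (rs ! i))"
    using assms by (intro sum_mono card_disc) auto
  also have "\<dots> = 6 * presentation_length (n, rs)"
    by (simp add: presentation_length_def sum_list_sum_nth sum_distrib_left lessThan_atLeast0)
  finally show ?thesis .
qed

lemma corner_simps:
  "corner r (3 * j) = Base"
  "corner r (Suc (3 * j)) = Mid (fst (r ! j)) (\<not> snd (r ! j))"
  "corner r (Suc (Suc (3 * j))) = Mid (fst (r ! j)) (snd (r ! j))"
proof -
  have "Suc (3 * j) mod 3 = 1" "Suc (3 * j) div 3 = j" "Suc (Suc (3 * j)) mod 3 = 2" "Suc (Suc (3 * j)) div 3 = j"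
    by presburger+
  then show "corner r (3 * j) = Base"
    "corner r (Suc (3 * j)) = Mid (fst (r ! j)) (\<not> snd (r ! j))"
    "corner r (Suc (Suc (3 * j))) = Mid (fst (r ! j)) (snd (r ! j))"
    by (simp_all add: corner_def)
qed

lemma freely_reduced_nth:
  "freely_reduced r \<Longrightarrow> Suc j < length r \<Longrightarrow> r ! Suc j \<noteq> inv_letter (r ! j)"
proof (induction r arbitrary: j rule: freely_reduced.induct)
  case (1 a b w)
  then show ?case by (cases j) auto
qed auto

text \<open>Within distance two the only critical case is the step across \<open>Base\<close> from
  the last midpoint of one letter to the first midpoint of the next. These two coincide exactly if
  the letters are inverse to each other.\<close>

lemma corner_distinct:
  assumes r: "freely_reduced r" and m: "m < m'" "m' \<le> m + 2" "m' \<le> 3 * length r"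
  shows "corner r m \<noteq> corner r m'"
proof -
  define j where "j = m div 3"
  have s3: "Suc (Suc (Suc (3 * j))) = 3 * Suc j" by simp
  have "m = 3 * j \<or> m = Suc (3 * j) \<or> m = Suc (Suc (3 * j))" unfolding j_def by presburger
  then consider "m = 3 * j" | "m = Suc (3 * j)" | "m = Suc (Suc (3 * j))" by blast
  then show ?thesis
  proof cases
    case 1
    then have "m' = Suc (3 * j) \<or> m' = Suc (Suc (3 * j))" using m by auto
    then show ?thesis using 1 by (auto simp: corner_simps)
  next
    case 2
    then have "m' = Suc (Suc (3 * j)) \<or> m' = 3 * Suc j" using m by auto
    then show ?thesis using 2 corner_simps(1)[of r "Suc j"] by (auto simp: corner_simps)
  next
    case 3
    then have "m' = 3 * Suc j \<or> m' = Suc (3 * Suc j)" using m by auto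
    then show ?thesis
    proof
      assume m': "m' = 3 * Suc j"
      show ?thesis unfolding 3 m' corner_simps by simp
    next
      assume m': "m' = Suc (3 * Suc j)"
      then have "Suc j < length r" using m(3) by simp
      then show ?thesis
        using freely_reduced_nth[OF r, of j] unfolding 3 m' corner_simps
        by (auto simp: inv_letter_def prod_eq_iff)
    qed
  qed
qed

section \<open>Edge labels on the complex of a presentation\<close>

fun rose_val :: "('a, 'c) monoid_scheme \<Rightarrow> (nat \<Rightarrow> 'a) \<Rightarrow> cvertex \<Rightarrow> cvertex \<Rightarrow> 'a" where
  "rose_val G f (Mid a s) (Mid a' s') =
     (if a = a' \<and> s \<noteq> s' then if s' then f a else inv\<^bsub>G\<^esub> (f a) else \<one>\<^bsub>G\<^esub>)"
| "rose_val G f _ _ = \<one>\<^bsub>G\<^esub>"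

primrec partial_val :: "('a, 'c) monoid_scheme \<Rightarrow> (nat \<Rightarrow> 'a) \<Rightarrow> nat word \<Rightarrow> nat \<Rightarrow> 'a" where
  "partial_val G f r 0 = \<one>\<^bsub>G\<^esub>"
| "partial_val G f r (Suc m) = partial_val G f r m \<otimes>\<^bsub>G\<^esub> rose_val G f (corner r m) (corner r (Suc m))"

text \<open>A label depends on the vertex, while partial products are indexed by places on the
  boundary, where a vertex can occur many times. The ring vertex \<open>j\<close> sees only the
  places from \<open>2 * j\<close> to \<open>2 * j + 2\<close>, which carry distinct vertices, so
  the least place from \<open>2 * j\<close> on is the right one.\<close>

definition position :: "nat word \<Rightarrow> nat \<Rightarrow> cvertex \<Rightarrow> nat" where
  "position r j v = (LEAST m. 2 * j \<le> m \<and> corner r m = v)"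

text \<open>The disc is labelled as if every ring vertex sat at corner 0: edges of the ring are
  trivial, and the edge from a ring vertex to the corner at place \<open>m\<close> carries the
  boundary product up to \<open>m\<close>.\<close>

fun disc_val :: "('a, 'c) monoid_scheme \<Rightarrow> (nat \<Rightarrow> 'a) \<Rightarrow> nat word list \<Rightarrow> cvertex \<Rightarrow> cvertex \<Rightarrow> 'a" where
  "disc_val G f rs (Ring i j) (Ring i' j') = \<one>\<^bsub>G\<^esub>"
| "disc_val G f rs (Ring i j) v = partial_val G f (rs ! i) (position (rs ! i) j v)"
| "disc_val G f rs v (Ring i j) = inv\<^bsub>G\<^esub> (partial_val G f (rs ! i) (position (rs ! i) j v))"
| "disc_val G f rs u v = rose_val G f u v"

lemma corner_not_Ring [simp]: "corner r m \<noteq> Ring i j" "Ring i j \<noteq> corner r m"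
  by (auto simp: corner_def)

lemma disc_val_Ring:
  assumes v: "\<And>i' j'. v \<noteq> Ring i' j'"
  shows "disc_val G f rs (Ring i j) v = partial_val G f (rs ! i) (position (rs ! i) j v)"
    "disc_val G f rs v (Ring i j) = inv\<^bsub>G\<^esub> (partial_val G f (rs ! i) (position (rs ! i) j v))"
    "(\<And>i' j'. u \<noteq> Ring i' j') \<Longrightarrow> disc_val G f rs u v = rose_val G f u v"
proof -
  have v': "v = Base \<or> (\<exists>a s. v = Mid a s)" using v by (metis cvertex.exhaust)
  then show "disc_val G f rs (Ring i j) v = partial_val G f (rs ! i) (position (rs ! i) j v)"
    by auto
  from v' show "disc_val G f rs v (Ring i j) = inv\<^bsub>G\<^esub> (partial_val G f (rs ! i) (position (rs ! i) j v))"
    by auto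
  assume "\<And>i' j'. u \<noteq> Ring i' j'"
  then have "u = Base \<or> (\<exists>a s. u = Mid a s)" by (metis cvertex.exhaust)
  with v' show "disc_val G f rs u v = rose_val G f u v" by auto
qed

lemma position_corner:
  assumes "freely_reduced r" "2 * j \<le> m" "m \<le> 2 * j + 2" "m \<le> 3 * length r"
  shows "position r j (corner r m) = m"
  unfolding position_def
proof (rule Least_equality)
  fix m' assume m': "2 * j \<le> m' \<and> corner r m' = corner r m"
  show "m \<le> m'"
  proof (rule ccontr)
    assume "\<not> m \<le> m'"
    then have "corner r m' \<noteq> corner r m" using m' assms by (intro corner_distinct) auto
    with m' show False by simp
  qed
qed (use assms in simp)

context group
begin

lemma rose_val_closed: "(\<And>a s. u = Mid a s \<Longrightarrow> f a \<in> carrier G) \<Longrightarrow> rose_val G f u v \<in> carrier G"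
  by (cases u; cases v) auto

lemma rose_val_same: "rose_val G f u u = \<one>"
  by (cases u) auto

lemma rose_val_inv: "(\<And>a s. u = Mid a s \<Longrightarrow> f a \<in> carrier G) \<Longrightarrow> rose_val G f v u = inv (rose_val G f u v)"
  by (cases u; cases v) auto

text \<open>Of the three edges belonging to a letter only the middle one has a label, namely the
  value of that letter.\<close>

lemma partial_val_word:
  assumes "\<And>i. i \<in> fst ` set r \<Longrightarrow> f i \<in> carrier G" and "j \<le> length r"
  shows "partial_val G f r (3 * j) = word_val G f (take j r)"
  using assms(2)
proof (induction j)
  case (Suc j)
  have fc: "f (fst (r ! j)) \<in> carrier G" using assms(1) Suc.prems by simp
  have w: "word_val G f (take j r) \<in> carrier G"
    using assms(1) set_take_subset[of j r] by (intro word_val_closed) auto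
  have l: "letter_val G f (r ! j) \<in> carrier G" using fc by (rule letter_val_closed)
  have m: "3 * Suc j = Suc (Suc (Suc (3 * j)))" by simp
  have b: "corner r (Suc (Suc (Suc (3 * j)))) = Base"
    using corner_simps(1)[of r "Suc j"] unfolding m .
  have "partial_val G f r (3 * Suc j) = word_val G f (take j r) \<otimes> letter_val G f (r ! j)"
    unfolding m using Suc fc w b by (auto simp: corner_simps letter_val_def)
  also have "\<dots> = word_val G f (take (Suc j) r)"
  proof -
    have "take (Suc j) r = take j r @ [r ! j]" using Suc.prems by (simp add: take_Suc_conv_app_nth)
    moreover have "word_val G f (take j r @ [r ! j]) = word_val G f (take j r) \<otimes> word_val G f [r ! j]"
      using assms(1) fc set_take_subset[of j r] by (intro word_val_append) auto
    ultimately show ?thesis using l by simp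
  qed
  finally show ?case .
qed simp

lemma partial_val_closed:
  assumes "\<And>i. i \<in> fst ` set r \<Longrightarrow> f i \<in> carrier G" and "m \<le> 3 * length r"
  shows "partial_val G f r m \<in> carrier G"
  using assms(2)
proof (induction m)
  case (Suc m)
  have "f a \<in> carrier G" if "corner r m = Mid a s" for a s
    using that Suc.prems assms(1) by (auto simp: corner_def split: if_splits)
  then show ?case using Suc by (auto intro: rose_val_closed)
qed simp

end

lemma partial_val_in_generate:
  assumes "group G" "\<And>i. i \<in> fst ` set r \<Longrightarrow> f i \<in> A" and "m \<le> 3 * length r"
  shows "partial_val G f r m \<in> generate G A"
  using assms(3)
proof (induction m)
  case (Suc m)
  have "f a \<in> A" if "corner r m = Mid a s" for a s
    using that Suc.prems assms(2) by (auto simp: corner_def split: if_splits)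
  then have "rose_val G f (corner r m) (corner r (Suc m)) \<in> generate G A"
    by (cases "corner r m"; cases "corner r (Suc m)") (auto intro: generate.one generate.incl generate.inv)
  with Suc show ?case by (auto intro: generate.eng)
qed (auto intro: generate.one)

locale pres_data =
  fixes n :: nat and rs :: "nat word list"
  assumes rs: "\<And>r. r \<in> set rs \<Longrightarrow> r \<in> carrier (free_group {..<n}) \<and> r \<noteq> []"
begin

abbreviation "\<K> \<equiv> pres_complex n rs"

lemma rs_nth:
  assumes "i < length rs"
  shows "freely_reduced (rs ! i)" "rs ! i \<noteq> []" "\<And>a. a \<in> fst ` set (rs ! i) \<Longrightarrow> a < n"
  using rs[OF nth_mem[OF assms]] by (auto simp: free_group_simps)

lemma ring_size_ge:
  assumes "i < length rs" "length (rs ! i) \<noteq> 1"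
  shows "ring_size (rs ! i) \<ge> 3"
proof -
  have "length (rs ! i) \<noteq> 0" using rs_nth(2)[OF assms(1)] by simp
  then have "2 \<le> length (rs ! i)" using assms(2) by linarith
  then show ?thesis unfolding ring_size_def by presburger
qed

lemma cell_in: "\<sigma> \<in> pres_cells n rs \<Longrightarrow> \<tau> \<subseteq> \<sigma> \<Longrightarrow> \<tau> \<noteq> {} \<Longrightarrow> \<tau> \<in> \<K>"
  by (auto simp: pres_complex_def)

lemma disc_cells:
  assumes i: "i < length rs" and k: "length (rs ! i) \<noteq> 1"
  shows "m < 3 * length (rs ! i) \<Longrightarrow> {Ring i (m div 2), corner (rs ! i) m, corner (rs ! i) (Suc m)} \<in> pres_cells n rs"
    "Suc j < ring_size (rs ! i) \<Longrightarrow> {Ring i j, Ring i (Suc j), corner (rs ! i) (2 * j + 2)} \<in> pres_cells n rs"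
    "{Ring i (ring_size (rs ! i) - 1), Ring i 0, Base} \<in> pres_cells n rs"
  using i k by (auto simp: pres_cells_def disc_def outer_cells_def inner_cells_def)

text \<open>For \<open>j = 0\<close> the set shrinks to an edge of an inner cell; admitting this
  case gives the vertex \<open>Ring i 0\<close> the same treatment as the others.\<close>

lemma fan_cell:
  assumes i: "i < length rs" and k: "length (rs ! i) \<noteq> 1" and j: "Suc j < ring_size (rs ! i)"
  shows "{Ring i 0, Ring i j, Ring i (Suc j)} \<in> \<K>"
proof (cases "j = 0")
  case True
  then show ?thesis using cell_in[OF disc_cells(2)[OF i k j]] by auto
next
  case False
  then have "{Ring i 0, Ring i j, Ring i (Suc j)} \<in> pres_cells n rs"
    using i k j by (auto simp: pres_cells_def disc_def fan_cells_def)
  then show ?thesis by (rule cell_in) auto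
qed

lemma cells_cases:
  assumes "\<sigma> \<in> pres_cells n rs"
  obtains (base) "\<sigma> = {Base}"
  | (edge) a s where "a < n" "\<sigma> = {Base, Mid a s}"
  | (middle) a where "a < n" "\<sigma> = {Mid a False, Mid a True}"
  | (triangle) i a s where "i < length rs" "rs ! i = [(a, s)]" "a < n" "\<sigma> = {Base, Mid a False, Mid a True}"
  | (closing) i where "i < length rs" "length (rs ! i) \<noteq> 1" "\<sigma> = {Ring i (ring_size (rs ! i) - 1), Ring i 0, Base}"
  | (outer) i m where "i < length rs" "length (rs ! i) \<noteq> 1" "m < 3 * length (rs ! i)"
      "\<sigma> = {Ring i (m div 2), corner (rs ! i) m, corner (rs ! i) (Suc m)}"
  | (inner) i j where "i < length rs" "length (rs ! i) \<noteq> 1" "Suc j < ring_size (rs ! i)"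
      "\<sigma> = {Ring i j, Ring i (Suc j), corner (rs ! i) (2 * j + 2)}"
  | (fan) i j where "i < length rs" "length (rs ! i) \<noteq> 1" "Suc j < ring_size (rs ! i)"
      "\<sigma> = {Ring i 0, Ring i j, Ring i (Suc j)}"
proof -
  consider "\<sigma> \<in> rose n" | i where "i < length rs" "\<sigma> \<in> disc i (rs ! i)"
    using assms by (auto simp: pres_cells_def)
  then show thesis
  proof cases
    case 1
    then show thesis using that(1-3) by (auto simp: rose_def)
  next
    case (2 i)
    show thesis
    proof (cases "length (rs ! i) = 1")
      case True
      then obtain a s where as: "rs ! i = [(a, s)]" by (cases "rs ! i") auto
      then show thesis using that(4)[OF 2(1) as] 2(2) rs_nth(3)[OF 2(1), of a] by (simp add: disc_def)
    next
      case False
      then consider "\<sigma> = {Ring i (ring_size (rs ! i) - 1), Ring i 0, Base}" | "\<sigma> \<in> outer_cells i (rs ! i)"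
        | "\<sigma> \<in> inner_cells i (rs ! i)" | "\<sigma> \<in> fan_cells i (rs ! i)"
        using 2(2) unfolding disc_def by auto
      then show thesis
      proof cases
        case 1
        then show thesis by (rule that(5)[OF 2(1) False])
      next
        case 2
        then obtain m where "m < 3 * length (rs ! i)"
          "\<sigma> = {Ring i (m div 2), corner (rs ! i) m, corner (rs ! i) (Suc m)}"
          unfolding outer_cells_def by blast
        then show thesis by (rule that(6)[OF \<open>i < length rs\<close> False])
      next
        case 3
        then obtain j where "j < ring_size (rs ! i) - 1"
          "\<sigma> = {Ring i j, Ring i (Suc j), corner (rs ! i) (2 * j + 2)}"
          unfolding inner_cells_def by blast
        then show thesis by (intro that(7)[OF \<open>i < length rs\<close> False]) auto
      next
        case 4
        then obtain j where "j < ring_size (rs ! i) - 1" "\<sigma> = {Ring i 0, Ring i j, Ring i (Suc j)}"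
          unfolding fan_cells_def by auto
        then show thesis by (intro that(8)[OF \<open>i < length rs\<close> False]) auto
      qed
    qed
  qed
qed

lemma ring_bounds:
  assumes "Suc j < ring_size r"
  shows "2 * j + 2 < 3 * length r"
  using assms by (simp add: ring_size_def)

text \<open>A tree of height two: midpoints and the first ring vertex of each disc hang at
  \<open>Base\<close>, the other ring vertices at \<open>Ring i 0\<close>. The fan cells then make
  all consecutive ring edges trivial in any normalized cocycle.\<close>

definition par :: "cvertex \<Rightarrow> cvertex" where
  "par v = (case v of Ring i (Suc j) \<Rightarrow> Ring i 0 | _ \<Rightarrow> Base)"

definition rk :: "cvertex \<Rightarrow> nat" where
  "rk v = (case v of Base \<Rightarrow> 0 | Mid a s \<Rightarrow> 1 | Ring i 0 \<Rightarrow> 1 | Ring i (Suc j) \<Rightarrow> 2)"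

lemma vertex_cases:
  assumes "{v} \<in> \<K>" "v \<noteq> Base"
  obtains (Mid) a s where "v = Mid a s" "a < n" 
  | (Ring) i j where "v = Ring i j" "i < length rs" "length (rs ! i) \<noteq> 1" "j < ring_size (rs ! i)"
proof -
  obtain \<sigma> where \<sigma>: "\<sigma> \<in> pres_cells n rs" "v \<in> \<sigma>" using assms(1) by (auto simp: pres_complex_def)
  have c: thesis if "v = corner (rs ! i) m" "m \<le> 3 * length (rs ! i)" "i < length rs" for i m
  proof (cases "m mod 3 = 0")
    case False
    then have "m div 3 < length (rs ! i)" using that(2) by presburger
    then have "fst (rs ! i ! (m div 3)) < n" using rs_nth(3)[OF that(3)] by simp
    then show thesis using Mid that False by (simp add: corner_def)
  qed (use that assms(2) in \<open>simp add: corner_def\<close>)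
  from \<sigma>(1) show thesis
  proof (cases rule: cells_cases)
    case (outer i m)
    then have "m div 2 < ring_size (rs ! i)" by (simp add: ring_size_def)
    then show thesis using outer \<sigma>(2) c[of i m] c[of i "Suc m"] Ring by auto
  next
    case (inner i j)
    then show thesis using ring_bounds[OF inner(3)] \<sigma>(2) c[of i "2 * j + 2"] Ring by auto
  next
    case (closing i)
    then show thesis using ring_size_ge[OF closing(1,2)] \<sigma>(2) assms(2) Ring by auto
  qed (use \<sigma>(2) assms(2) Mid Ring in auto)
qed

lemma par_edge:
  assumes "{v} \<in> \<K>" "v \<noteq> Base"
  shows "{par v, v} \<in> \<K> \<and> rk v = Suc (rk (par v))"
  using assms
proof (cases rule: vertex_cases)
  case (Mid a s)
  have "{Base, Mid a s} \<in> pres_cells n rs" using Mid(2) by (auto simp: pres_cells_def rose_def)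
  then show ?thesis using Mid cell_in by (auto simp: par_def rk_def)
next
  case (Ring i j)
  show ?thesis
  proof (cases j)
    case 0
    have "{Base, Ring i 0} \<in> \<K>"
      by (rule cell_in[OF disc_cells(3)[OF Ring(2,3)]]) auto
    then show ?thesis using Ring 0 by (simp add: par_def rk_def)
  next
    case (Suc j')
    have "{Ring i 0, Ring i j', Ring i (Suc j')} \<in> \<K>" using Ring Suc by (intro fan_cell) auto
    then have "{Ring i 0, Ring i (Suc j')} \<in> \<K>" by (auto simp: pres_complex_def)
    then show ?thesis using Ring Suc by (simp add: par_def rk_def)
  qed
qed

text \<open>On each single cell the labels come from a potential \<rho>, as the label from
  \<open>u\<close> to \<open>v\<close> is \<open>inv\<close> of \<open>\<rho> u\<close> times
  \<open>\<rho> v\<close>; the cocycle condition is then immediate. Only the cells that close up a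
  relator need it to hold in \<open>G\<close>.\<close>

lemma cocycle_disc_val:
  assumes G: "group G" and f: "\<And>a. a < n \<Longrightarrow> f a \<in> carrier G"
    and rel: "\<And>r. r \<in> set rs \<Longrightarrow> word_val G f r = \<one>\<^bsub>G\<^esub>"
  shows "cocycle \<K> G (disc_val G f rs)"
proof -
  interpret G: group G by fact
  let ?B = "\<lambda>i m. partial_val G f (rs ! i) m"
  have Bc: "?B i m \<in> carrier G" if "i < length rs" "m \<le> 3 * length (rs ! i)" for i m
    using that rs_nth(3)[OF that(1)] f by (intro G.partial_val_closed) auto
  have B_end: "?B i (3 * length (rs ! i)) = \<one>\<^bsub>G\<^esub>" if "i < length rs" for i
    using G.partial_val_word[of "rs ! i" f "length (rs ! i)"] rs_nth(3)[OF that] f rel that by simp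
  have potential: "\<exists>\<rho>. \<forall>u\<in>\<sigma>. \<rho> u \<in> carrier G \<and> (\<forall>v\<in>\<sigma>. disc_val G f rs u v = inv\<^bsub>G\<^esub> (\<rho> u) \<otimes>\<^bsub>G\<^esub> \<rho> v)"
    if "\<sigma> \<in> pres_cells n rs" for \<sigma>
    using that
  proof (cases rule: cells_cases)
    case base
    then show ?thesis by (intro exI[of _ "\<lambda>_. \<one>\<^bsub>G\<^esub>"]) simp
  next
    case (edge a s)
    then show ?thesis by (intro exI[of _ "\<lambda>_. \<one>\<^bsub>G\<^esub>"]) simp
  next
    case (middle a)
    then show ?thesis using f[of a]
      by (intro exI[of _ "\<lambda>v. if v = Mid a True then f a else \<one>\<^bsub>G\<^esub>"]) simp
  next
    case (triangle i a s)
    have "f a = \<one>\<^bsub>G\<^esub>"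
      using rel[OF nth_mem[OF triangle(1)]] f[of a] triangle(2,3)
      by (cases s) (auto simp: letter_val_def)
    then show ?thesis using triangle by (intro exI[of _ "\<lambda>_. \<one>\<^bsub>G\<^esub>"]) simp
  next
    \<comment> \<open>Here the relator enters. For the last ring vertex \<open>Base\<close> is the
      final corner, for \<open>Ring i 0\<close> it is the initial one; the two labels agree because
      the product along the whole boundary is the value of the relator.\<close>
    case (closing i)
    have p: "ring_size (rs ! i) \<ge> 3" by (rule ring_size_ge[OF closing(1,2)])
    have pos: "position (rs ! i) (ring_size (rs ! i) - 1) (corner (rs ! i) (3 * length (rs ! i))) = 3 * length (rs ! i)"
      using p by (intro position_corner rs_nth closing) (auto simp: ring_size_def)
    have pos0: "position (rs ! i) 0 (corner (rs ! i) 0) = 0"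
      by (intro position_corner rs_nth closing) auto
    have "corner (rs ! i) (3 * length (rs ! i)) = Base" "corner (rs ! i) 0 = Base"
      by (simp_all add: corner_def)
    then show ?thesis using closing pos pos0 B_end[OF closing(1)]
      by (intro exI[of _ "\<lambda>_. \<one>\<^bsub>G\<^esub>"]) simp
  next
    case (outer i m)
    let ?u = "corner (rs ! i) m" and ?v = "corner (rs ! i) (Suc m)"
    let ?\<rho> = "\<lambda>v. if v = Ring i (m div 2) then \<one>\<^bsub>G\<^esub> else ?B i (position (rs ! i) (m div 2) v)"
    have pos: "position (rs ! i) (m div 2) ?u = m" "position (rs ! i) (m div 2) ?v = Suc m"
      using outer(3) by (intro position_corner rs_nth outer; simp; presburger)+
    have rc: "f a \<in> carrier G" if "?u = Mid a s \<or> ?v = Mid a s" for a s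
    proof -
      have "{corner (rs ! i) m} \<in> \<K>" "{corner (rs ! i) (Suc m)} \<in> \<K>"
        by (rule cell_in[OF disc_cells(1)[OF outer(1-3)]]; simp)+
      then have "{Mid a s} \<in> \<K>" using that by auto
      then show ?thesis by (cases rule: vertex_cases) (use f in auto)
    qed
    have r: "rose_val G f ?u ?v \<in> carrier G" "rose_val G f ?v ?u = inv\<^bsub>G\<^esub> (rose_val G f ?u ?v)"
      using rc by (auto intro!: G.rose_val_closed G.rose_val_inv)
    have B: "?B i m \<in> carrier G" "?B i (Suc m) = ?B i m \<otimes>\<^bsub>G\<^esub> rose_val G f ?u ?v"
      using Bc outer by auto
    show ?thesis
      using outer(4) B(1) r pos
      by (intro exI[of _ ?\<rho>])
        (auto simp: disc_val_Ring G.rose_val_same G.inv_cancel G.inv_mult_group G.m_assoc)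
  next
    case (inner i j)
    let ?v = "corner (rs ! i) (2 * j + 2)"
    let ?\<rho> = "\<lambda>v. if v = ?v then ?B i (2 * j + 2) else \<one>\<^bsub>G\<^esub>"
    have le: "2 * j + 2 \<le> 3 * length (rs ! i)" using ring_bounds[OF inner(3)] by simp
    have pos: "position (rs ! i) j ?v = 2 * j + 2" "position (rs ! i) (Suc j) ?v = 2 * j + 2"
      using le by (intro position_corner rs_nth inner; simp)+
    have B: "?B i (2 * j + 2) \<in> carrier G" by (rule Bc[OF inner(1) le])
    show ?thesis
      unfolding inner(4) using B pos
      by (intro exI[of _ ?\<rho>]) (auto simp: disc_val_Ring G.rose_val_same simp del: partial_val.simps)
  next
    case (fan i j)
    then show ?thesis by (intro exI[of _ "\<lambda>_. \<one>\<^bsub>G\<^esub>"]) auto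
  qed
  show ?thesis
    unfolding cocycle_def
  proof (intro ballI conjI)
    fix \<tau> u v assume \<tau>: "\<tau> \<in> \<K>" "u \<in> \<tau>" "v \<in> \<tau>"
    then obtain \<sigma> where \<sigma>: "\<sigma> \<in> pres_cells n rs" "\<tau> \<subseteq> \<sigma>" by (auto simp: pres_complex_def)
    obtain \<rho> where \<rho>: "\<And>u. u \<in> \<sigma> \<Longrightarrow> \<rho> u \<in> carrier G"
      "\<And>u v. u \<in> \<sigma> \<Longrightarrow> v \<in> \<sigma> \<Longrightarrow> disc_val G f rs u v = inv\<^bsub>G\<^esub> (\<rho> u) \<otimes>\<^bsub>G\<^esub> \<rho> v"
      using potential[OF \<sigma>(1)] by blast
    have uv: "u \<in> \<sigma>" "v \<in> \<sigma>" using \<tau> \<sigma> by auto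
    then show "disc_val G f rs u v \<in> carrier G" using \<rho> by simp
    fix w assume "w \<in> \<tau>"
    then have "w \<in> \<sigma>" using \<sigma> by auto
    with uv show "disc_val G f rs u v \<otimes>\<^bsub>G\<^esub> disc_val G f rs v w = disc_val G f rs u w"
      using \<rho>(1) by (simp add: \<rho>(2) G.m_assoc G.inv_cancel)
  qed
qed

lemma disc_val_par:
  assumes G: "group G" and v: "{v} \<in> \<K>" "v \<noteq> Base"
  shows "disc_val G f rs (par v) v = \<one>\<^bsub>G\<^esub>"
  using v
proof (cases rule: vertex_cases)
  case (Mid a s)
  then show ?thesis by (simp add: par_def)
next
  case (Ring i j)
  have pos0: "position (rs ! i) 0 (corner (rs ! i) 0) = 0"
    by (intro position_corner rs_nth Ring) auto
  have "corner (rs ! i) 0 = Base" by (simp add: corner_def)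
  then show ?thesis
    using Ring pos0 monoid.inv_one[OF group.is_monoid[OF G]] by (cases j) (simp_all add: par_def)
qed

text \<open>The converse of the preceding construction: a normalized cocycle has no freedom beyond
  its values on the middle edges of the generators. Walking around the ring determines every other
  label as a boundary product, and returning to \<open>Base\<close> gives the relator.\<close>

lemma relators_trivial:
  assumes G: "group G" and coc: "cocycle \<K> G \<theta>"
    and tree: "\<And>v. {v} \<in> \<K> \<Longrightarrow> v \<noteq> Base \<Longrightarrow> \<theta> (par v) v = \<one>\<^bsub>G\<^esub>"
  defines "f \<equiv> \<lambda>a. \<theta> (Mid a False) (Mid a True)"
  shows "r \<in> set rs \<Longrightarrow> word_val G f r = \<one>\<^bsub>G\<^esub>"
    and "{u, v} \<in> \<K> \<Longrightarrow> \<theta> u v \<in> generate G (f ` {..<n})"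
proof -
  interpret G: group G by fact
  note K = simplicial_pres_complex[of n rs]
  interpret two_complex \<K> using K by (simp add: two_complex_def)
  have same: "\<theta> u u = \<one>\<^bsub>G\<^esub>" if "{u} \<in> \<K>" for u using cocycle_same[OF coc G that] .
  have inv: "\<theta> v u = inv\<^bsub>G\<^esub> (\<theta> u v)" if "{u, v} \<in> \<K>" for u v
    using cocycle_inv[OF coc G K that] by simp
  have mid: "{Base, Mid a s} \<in> \<K>" "{Mid a s} \<in> \<K>" "{Mid a False, Mid a True} \<in> \<K>" if "a < n" for a s
  proof -
    have "{Base, Mid a s} \<in> pres_cells n rs" "{Mid a False, Mid a True} \<in> pres_cells n rs"
      using that by (auto simp: pres_cells_def rose_def)
    then show "{Base, Mid a s} \<in> \<K>" "{Mid a s} \<in> \<K>" "{Mid a False, Mid a True} \<in> \<K>"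
      using cell_in by auto
  qed
  have fc: "f a \<in> carrier G" if "a < n" for a
    unfolding f_def using cocycleD(1)[OF coc mid(3)[OF that]] by auto
  have rose: "\<theta> Base (Mid a s) = \<one>\<^bsub>G\<^esub>" "\<theta> (Mid a s) Base = \<one>\<^bsub>G\<^esub>"
    "\<theta> (Mid a (\<not> s)) (Mid a s) = rose_val G f (Mid a (\<not> s)) (Mid a s)" if "a < n" for a s
  proof -
    show "\<theta> Base (Mid a s) = \<one>\<^bsub>G\<^esub>" using tree[OF mid(2)[OF that]] by (simp add: par_def)
    then show "\<theta> (Mid a s) Base = \<one>\<^bsub>G\<^esub>" using inv[OF mid(1)[OF that]] by simp
    show "\<theta> (Mid a (\<not> s)) (Mid a s) = rose_val G f (Mid a (\<not> s)) (Mid a s)"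
      using inv[OF mid(3)[OF that]] by (cases s) (auto simp: f_def)
  qed
  have corners: "\<theta> (corner (rs ! i) m) (corner (rs ! i) (Suc m)) = rose_val G f (corner (rs ! i) m) (corner (rs ! i) (Suc m))"
    if i: "i < length rs" and m: "m < 3 * length (rs ! i)" for i m
  proof -
    define j where "j = m div 3"
    have "j < length (rs ! i)" using m unfolding j_def by presburger
    then have a: "fst (rs ! i ! j) < n" using rs_nth(3)[OF i] by simp
    have "m = 3 * j \<or> m = Suc (3 * j) \<or> m = Suc (Suc (3 * j))" unfolding j_def by presburger
    then show ?thesis
    proof (elim disjE)
      assume m: "m = 3 * j"
      show ?thesis unfolding m corner_simps using rose[OF a] by simp
    next
      assume m: "m = Suc (3 * j)"
      show ?thesis unfolding m corner_simps using rose(3)[OF a] .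
    next
      assume m: "m = Suc (Suc (3 * j))"
      have "Suc m = 3 * Suc j" using m by simp
      then have "corner (rs ! i) (Suc m) = Base" using corner_simps(1) by metis
      then show ?thesis unfolding m corner_simps using rose[OF a] m by simp
    qed
  qed
  let ?B = "\<lambda>i m. partial_val G f (rs ! i) m"
  have Bc: "?B i m \<in> carrier G" if "i < length rs" "m \<le> 3 * length (rs ! i)" for i m
    using that rs_nth(3)[OF that(1)] fc by (intro G.partial_val_closed) auto
  have ring_in: "{Ring i j} \<in> \<K>" if "i < length rs" "length (rs ! i) \<noteq> 1" "j < ring_size (rs ! i)" for i j
  proof (cases j)
    case 0
    then show ?thesis using cell_in[OF disc_cells(3)[OF that(1,2)]] by auto
  next
    case (Suc j')
    then show ?thesis using cell_in[OF disc_cells(2)[OF that(1,2), of j']] that(3) by auto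
  qed
  have spoke0: "\<theta> (Ring i 0) (Ring i j) = \<one>\<^bsub>G\<^esub>"
    if "i < length rs" "length (rs ! i) \<noteq> 1" "j < ring_size (rs ! i)" for i j
    using same[OF ring_in[OF that]] tree[OF ring_in[OF that]] by (cases j) (auto simp: par_def)
  have ring1: "\<theta> (Ring i j) (Ring i (Suc j)) = \<one>\<^bsub>G\<^esub>" "\<theta> (Ring i (Suc j)) (Ring i j) = \<one>\<^bsub>G\<^esub>"
    if "i < length rs" "length (rs ! i) \<noteq> 1" "Suc j < ring_size (rs ! i)" for i j
  proof -
    have fan: "{Ring i 0, Ring i j, Ring i (Suc j)} \<in> \<K>" by (rule fan_cell[OF that])
    have c: "\<theta> (Ring i j) (Ring i (Suc j)) \<in> carrier G"
      using cocycleD(1)[OF coc fan] by auto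
    have "\<theta> (Ring i 0) (Ring i j) \<otimes>\<^bsub>G\<^esub> \<theta> (Ring i j) (Ring i (Suc j)) = \<theta> (Ring i 0) (Ring i (Suc j))"
      by (rule cocycleD(2)[OF coc fan]) auto
    then show 1: "\<theta> (Ring i j) (Ring i (Suc j)) = \<one>\<^bsub>G\<^esub>"
      using c spoke0[OF that(1,2), of j] spoke0[OF that] that(3) by simp
    have "{Ring i j, Ring i (Suc j)} \<in> \<K>" using face[OF fan] by auto
    from inv[OF this] 1 show "\<theta> (Ring i (Suc j)) (Ring i j) = \<one>\<^bsub>G\<^esub>" by simp
  qed
  have ring_corner: "\<theta> (Ring i j) (corner (rs ! i) m) = ?B i m"
    if i: "i < length rs" and k: "length (rs ! i) \<noteq> 1" and m: "m \<le> 3 * length (rs ! i)"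
      and j: "2 * j \<le> m" "m \<le> 2 * j + 2" "j < ring_size (rs ! i)" for i j m
    using m j
  proof (induction m arbitrary: j)
    case 0
    have p: "ring_size (rs ! i) \<ge> 3" by (rule ring_size_ge[OF i k])
    have "{Base, Ring i 0} \<in> \<K>" by (rule cell_in[OF disc_cells(3)[OF i k]]) auto
    moreover have "\<theta> Base (Ring i 0) = \<one>\<^bsub>G\<^esub>"
      using tree[OF ring_in[OF i k, of 0]] p by (simp add: par_def)
    ultimately have "\<theta> (Ring i 0) Base = \<one>\<^bsub>G\<^esub>" using inv by simp
    then show ?case using 0 by (simp add: corner_def)
  next
    case (Suc m)
    have direct: "\<theta> (Ring i j) (corner (rs ! i) (Suc m)) = ?B i (Suc m)"
      if j: "2 * j \<le> m" "Suc m \<le> 2 * j + 2" "j < ring_size (rs ! i)" for j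
    proof -
      have "j = m div 2" using j by presburger
      then have cell: "{Ring i j, corner (rs ! i) m, corner (rs ! i) (Suc m)} \<in> \<K>"
        using disc_cells(1)[OF i k, of m] Suc.prems(1) by (intro cell_in[of "{Ring i j, _, _}"]) auto
      have "\<theta> (Ring i j) (corner (rs ! i) (Suc m)) =
          \<theta> (Ring i j) (corner (rs ! i) m) \<otimes>\<^bsub>G\<^esub> \<theta> (corner (rs ! i) m) (corner (rs ! i) (Suc m))"
        by (rule cocycleD(2)[OF coc cell, symmetric]) auto
      also have "\<dots> = ?B i (Suc m)"
        using Suc.IH[of j] corners[OF i, of m] Suc.prems(1) j by simp
      finally show ?thesis .
    qed
    show ?case
    proof (cases "2 * j \<le> m")
      case True
      then show ?thesis using direct Suc.prems by simp
    next
      case False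
      \<comment> \<open>Only an even place is reached in this case: the corner
        \<open>2 * j' + 2\<close> is the last one seen by \<open>j'\<close> and the first one seen
        by \<open>Suc j'\<close>. The inner cell carries the value from the one ring vertex to the
        next, since the ring edge between them is trivial.\<close>
      define j' where "j' = j - 1"
      have j': "j = Suc j'" "Suc m = 2 * j' + 2"
        using False Suc.prems(2) unfolding j'_def by presburger+
      have cell: "{Ring i j', Ring i j, corner (rs ! i) (Suc m)} \<in> \<K>"
        using disc_cells(2)[OF i k, of j'] Suc.prems(4) j' by (intro cell_in[of "{_, _, corner (rs ! i) (Suc m)}"]) auto
      have c: "\<theta> (Ring i j') (corner (rs ! i) (Suc m)) \<in> carrier G"
        using cocycleD(1)[OF coc cell] by auto
      have "\<theta> (Ring i j) (corner (rs ! i) (Suc m)) =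
          \<theta> (Ring i j) (Ring i j') \<otimes>\<^bsub>G\<^esub> \<theta> (Ring i j') (corner (rs ! i) (Suc m))"
        by (rule cocycleD(2)[OF coc cell, symmetric]) auto
      also have "\<dots> = \<theta> (Ring i j') (corner (rs ! i) (Suc m))"
        using ring1(2)[OF i k, of j'] j' Suc.prems(4) c by simp
      also have "\<dots> = ?B i (Suc m)" using direct[of j'] j' Suc.prems(4) by simp
      finally show ?thesis .
    qed
  qed
  show rel: "word_val G f r = \<one>\<^bsub>G\<^esub>" if r: "r \<in> set rs" for r
  proof -
    obtain i where i: "i < length rs" "r = rs ! i" using r by (metis in_set_conv_nth)
    have fcr: "f a \<in> carrier G" if "a \<in> fst ` set r" for a using fc rs_nth(3)[OF i(1)] that i(2) by simp
    show ?thesis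
    proof (cases "length r = 1")
      case True
      then obtain a s where as: "r = [(a, s)]" by (cases r) auto
      then have a: "a < n" using rs_nth(3)[OF i(1), of a] i(2) by simp
      have "{Base, Mid a False, Mid a True} \<in> pres_cells n rs"
        using i as by (force simp: pres_cells_def disc_def)
      then have cell: "{Base, Mid a False, Mid a True} \<in> \<K>" by (rule cell_in) auto
      have "\<theta> Base (Mid a False) \<otimes>\<^bsub>G\<^esub> \<theta> (Mid a False) (Mid a True) = \<theta> Base (Mid a True)"
        by (rule cocycleD(2)[OF coc cell]) auto
      then have "f a = \<one>\<^bsub>G\<^esub>" using rose(1)[OF a] fc[OF a] by (simp add: f_def)
      then show ?thesis using as by (simp add: letter_val_def)
    next
      case False
      then have k: "length (rs ! i) \<noteq> 1" using i by simp
      have p: "ring_size (rs ! i) \<ge> 3" by (rule ring_size_ge[OF i(1) k])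
      let ?j = "ring_size (rs ! i) - 1"
      have c3: "corner (rs ! i) (3 * length (rs ! i)) = Base" "corner (rs ! i) 0 = Base" by (simp_all add: corner_def)
      \<comment> \<open>The closing cell compares the label at the end of the boundary with the one
        at its beginning, which is the empty product.\<close>
      have "?B i (3 * length (rs ! i)) = \<theta> (Ring i ?j) Base"
        using ring_corner[OF i(1) k, of "3 * length (rs ! i)" ?j] p c3 by (simp add: ring_size_def)
      moreover have cell: "{Ring i ?j, Ring i 0, Base} \<in> \<K>" by (rule cell_in[OF disc_cells(3)[OF i(1) k]]) auto
      have "\<theta> (Ring i 0) Base = \<one>\<^bsub>G\<^esub>" using ring_corner[OF i(1) k, of 0 0] p c3 by simp
      moreover have "\<theta> (Ring i 0) (Ring i ?j) \<otimes>\<^bsub>G\<^esub> \<theta> (Ring i ?j) Base = \<theta> (Ring i 0) Base"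
        by (rule cocycleD(2)[OF coc cell]) auto
      moreover have "\<theta> (Ring i ?j) Base \<in> carrier G" using cocycleD(1)[OF coc cell] by auto
      ultimately have "?B i (3 * length (rs ! i)) = \<one>\<^bsub>G\<^esub>"
        using spoke0[OF i(1) k, of ?j] p by simp
      then show ?thesis
        using G.partial_val_word[of r f "length r"] fcr i(2) by simp
    qed
  qed
  show "\<theta> u v \<in> generate G (f ` {..<n})" if uv: "{u, v} \<in> \<K>" for u v
  proof -
    let ?H = "generate G (f ` {..<n})"
    have sub: "subgroup ?H G" using fc by (intro G.generate_is_subgroup) auto
    have one: "\<one>\<^bsub>G\<^esub> \<in> ?H" by (rule generate.one)
    have BH: "?B i m \<in> ?H" if "i < length rs" "m \<le> 3 * length (rs ! i)" for i m
      using that rs_nth(3)[OF that(1)] by (intro partial_val_in_generate G) auto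
    \<comment> \<open>It suffices to find one vertex \<open>z\<close> in each cell all of whose
      labels lie in the subgroup: the label from \<open>u\<close> to \<open>v\<close> is recovered
      through \<open>z\<close>.\<close>
    have star: "\<theta> u v \<in> ?H" if \<sigma>: "\<sigma> \<in> \<K>" "u \<in> \<sigma>" "v \<in> \<sigma>" "z \<in> \<sigma>" and z: "\<And>w. w \<in> \<sigma> \<Longrightarrow> \<theta> z w \<in> ?H" for \<sigma> u v z
    proof -
      have "\<theta> u v = \<theta> u z \<otimes>\<^bsub>G\<^esub> \<theta> z v" using cocycleD(2)[OF coc \<sigma>(1,2,4,3)] by simp
      moreover have "\<theta> u z = inv\<^bsub>G\<^esub> (\<theta> z u)"
        using inv[of z u] face[OF \<sigma>(1), of "{z, u}"] \<sigma> by auto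
      ultimately show ?thesis
        using z[OF \<sigma>(2)] z[OF \<sigma>(3)] sub by (simp add: subgroup.m_closed subgroup.m_inv_closed)
    qed
    obtain \<sigma> where \<sigma>: "\<sigma> \<in> pres_cells n rs" "u \<in> \<sigma>" "v \<in> \<sigma>" using uv by (auto simp: pres_complex_def)
    have \<sigma>K: "\<sigma> \<in> \<K>" using \<sigma> cell_in by blast
    have self: "\<theta> z z \<in> ?H" if "z \<in> \<sigma>" for z using same[OF in_vertex[OF \<sigma>K that]] one by simp
    from \<sigma>(1) have "\<exists>z\<in>\<sigma>. \<forall>w\<in>\<sigma>. \<theta> z w \<in> ?H"
    proof (cases rule: cells_cases)
      case base
      then show ?thesis using self by blast
    next
      case (edge a s)
      have "\<theta> Base (Mid a s) \<in> ?H" using rose(1)[OF edge(1)] one by simp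
      then show ?thesis using self[of Base] unfolding edge(2) by blast
    next
      case (middle a)
      have "\<theta> (Mid a False) (Mid a True) \<in> ?H" using middle(1) unfolding f_def by (intro generate.incl) auto
      then show ?thesis using self[of "Mid a False"] unfolding middle(2) by blast
    next
      case (triangle i a s)
      have "\<theta> Base (Mid a s) \<in> ?H" for s using rose(1)[OF triangle(3)] one by simp
      then show ?thesis using self[of Base] unfolding triangle(4) by blast
    next
      case (closing i)
      have p: "ring_size (rs ! i) \<ge> 3" by (rule ring_size_ge[OF closing(1,2)])
      have "\<theta> (Ring i 0) Base \<in> ?H"
        using ring_corner[OF closing(1,2), of 0 0] p one by (simp add: corner_def)
      moreover have "\<theta> (Ring i 0) (Ring i (ring_size (rs ! i) - 1)) \<in> ?H"
        using spoke0[OF closing(1,2), of "ring_size (rs ! i) - 1"] p one by simp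
      ultimately show ?thesis using self[of "Ring i 0"] unfolding closing(3) by blast
    next
      case (outer i m)
      have j: "m div 2 < ring_size (rs ! i)" using outer(3) unfolding ring_size_def by presburger
      have "\<theta> (Ring i (m div 2)) (corner (rs ! i) m) \<in> ?H"
        using ring_corner[OF outer(1,2), of m "m div 2"] BH[OF outer(1), of m] outer(3) j by simp
      moreover have "\<theta> (Ring i (m div 2)) (corner (rs ! i) (Suc m)) \<in> ?H"
      proof -
        have "Suc m \<le> 3 * length (rs ! i)" "2 * (m div 2) \<le> Suc m" "Suc m \<le> 2 * (m div 2) + 2"
          using outer(3) by presburger+
        then show ?thesis using ring_corner[OF outer(1,2), of "Suc m" "m div 2"] BH[OF outer(1), of "Suc m"] j
          by (simp del: partial_val.simps)
      qed
      ultimately show ?thesis using self[of "Ring i (m div 2)"] unfolding outer(4) by blast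
    next
      case (inner i j)
      have le: "2 * j + 2 \<le> 3 * length (rs ! i)" using ring_bounds[OF inner(3)] by simp
      have "\<theta> (Ring i j) (corner (rs ! i) (2 * j + 2)) = ?B i (2 * j + 2)"
        using inner(3) by (intro ring_corner[OF inner(1,2) le]) auto
      then have "\<theta> (Ring i j) (corner (rs ! i) (2 * j + 2)) \<in> ?H" using BH[OF inner(1) le] by metis
      moreover have "\<theta> (Ring i j) (Ring i (Suc j)) \<in> ?H" using ring1(1)[OF inner(1-3)] one by simp
      ultimately show ?thesis using self[of "Ring i j"] unfolding inner(4) by blast
    next
      case (fan i j)
      have "\<theta> (Ring i 0) (Ring i j) \<in> ?H" "\<theta> (Ring i 0) (Ring i (Suc j)) \<in> ?H"
        using spoke0[OF fan(1,2), of j] spoke0[OF fan(1-3)] fan(3) one by auto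
      then show ?thesis using self[of "Ring i 0"] unfolding fan(4) by blast
    qed
    then obtain z where "z \<in> \<sigma>" "\<And>w. w \<in> \<sigma> \<Longrightarrow> \<theta> z w \<in> ?H" by blast
    then show ?thesis by (rule star[OF \<sigma>K \<sigma>(2,3)])
  qed
qed

end

section \<open>Vertices as natural numbers\<close>

instance cvertex :: countable
  by countable_datatype

lemma simplicial_image:
  assumes e: "inj e" and K: "simplicial_2_complex K"
  shows "simplicial_2_complex ((`) e ` K)"
proof -
  interpret two_complex K using K by (simp add: two_complex_def)
  show ?thesis
    unfolding simplicial_2_complex_def
  proof (intro conjI ballI allI impI)
    show "finite ((`) e ` K)" using K by (simp add: simplicial_2_complex_def)
    fix \<tau> assume "\<tau> \<in> (`) e ` K"
    then obtain \<sigma> where \<sigma>: "\<tau> = e ` \<sigma>" "\<sigma> \<in> K" by auto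
    show "finite \<tau>" "\<tau> \<noteq> {}" using \<sigma> finite_face nonempty_face by auto
    show "card \<tau> \<le> 3" using \<sigma> card_face card_image_le[OF finite_face[OF \<sigma>(2)], of e] by fastforce
    fix \<rho> assume \<rho>: "\<rho> \<noteq> {} \<and> \<rho> \<subseteq> \<tau>"
    then obtain \<rho>' where \<rho>': "\<rho>' \<subseteq> \<sigma>" "\<rho> = e ` \<rho>'" unfolding \<sigma>(1) by (meson subset_imageE)
    then have "\<rho>' \<in> K" using face[OF \<sigma>(2)] \<rho> by auto
    then show "\<rho> \<in> (`) e ` K" using \<rho>' by auto
  qed
qed

lemma card_two_simplices_image:
  assumes e: "inj e" and K: "simplicial_2_complex K"
  shows "card (two_simplices ((`) e ` K)) \<le> card (two_simplices K)"
proof -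
  have "two_simplices ((`) e ` K) \<subseteq> (`) e ` two_simplices K"
    using card_image[OF inj_on_subset[OF e]] by (auto simp: two_simplices_def)
  moreover have "finite (two_simplices K)" using K by (simp add: two_simplices_def simplicial_2_complex_def)
  ultimately show ?thesis by (meson card_image_le card_mono finite_imageI order_trans)
qed

text \<open>Only a left inverse of the coding of vertices is required, which \<open>from_nat\<close>
  is for \<open>to_nat\<close>; labels can be carried over in both directions.\<close>

lemma cocycle_image:
  assumes e: "\<And>v. d (e v) = v"
  shows "cocycle ((`) e ` K) G \<phi> \<longleftrightarrow> cocycle K G (\<lambda>u v. \<phi> (e u) (e v))"
    and "cocycle ((`) e ` K) G (\<lambda>u v. \<psi> (d u) (d v)) \<longleftrightarrow> cocycle K G \<psi>"
  using e by (auto simp: cocycle_def)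

text \<open>The isomorphism is found indirectly. By \<open>relators_trivial\<close> the edge classes
  satisfy the relators and are generated by the middle edges; the labels \<open>disc_val\<close> in
  the quotient of the free group show that no further relation holds. So \<open>(n, rs)\<close>
  presents the fundamental group too, and a presentation determines its group.\<close>

lemma complex_of_presentation:
  fixes G :: "('a, 'c) monoid_scheme"
  assumes G: "group G" and P: "presents (n, rs) G" and ne: "\<And>r. r \<in> set rs \<Longrightarrow> r \<noteq> []"
  obtains K :: "nat set set" where "simplicial_2_complex K" "complex_has_fundamental_group K G"
    "card (two_simplices K) + length rs \<le> 6 * presentation_length (n, rs)"
proof -
  let ?F = "free_group {..<n}"
  let ?e = "to_nat :: cvertex \<Rightarrow> nat" and ?d = "from_nat :: nat \<Rightarrow> cvertex"
  have rsF: "set rs \<subseteq> carrier ?F" using P by (simp add: presents_def Let_def)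
  interpret pres_data n rs by unfold_locales (use rsF ne in auto)
  define K where "K = (`) ?e ` \<K>"
  have inj: "inj ?e" by simp
  note sK = simplicial_pres_complex[of n rs]
  have simp_K: "simplicial_2_complex K" unfolding K_def by (rule simplicial_image[OF inj sK])
  have pair: "{?e u, ?e v} \<in> K \<longleftrightarrow> {u, v} \<in> \<K>" for u v
  proof -
    have "inj ((`) ?e)" by (rule injI) (simp add: inj_image_eq_iff)
    from inj_image_mem_iff[OF this, of "{u, v}" \<K>] show ?thesis by (simp add: K_def)
  qed
  have edge: "\<exists>u' v'. u = ?e u' \<and> v = ?e v' \<and> {u', v'} \<in> \<K>" if uv: "{u, v} \<in> K" for u v
  proof -
    obtain \<tau> where \<tau>: "\<tau> \<in> \<K>" "{u, v} = ?e ` \<tau>" using uv by (auto simp: K_def)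
    then obtain u' v' where w: "u' \<in> \<tau>" "u = ?e u'" "v' \<in> \<tau>" "v = ?e v'" by (metis image_iff insertI1 insertI2)
    then have "?e ` {u', v'} = ?e ` \<tau>" using \<tau>(2) by simp
    then have "\<tau> = {u', v'}" using inj_image_eq_iff[OF inj] by metis
    then show ?thesis using \<tau>(1) w by blast
  qed
  have vertex: "\<exists>w. v = ?e w \<and> {w} \<in> \<K>" if "{v} \<in> K" for v
    using edge[of v v] that by auto
  have base: "{?e Base} \<in> K"
  proof -
    have "{Base} \<in> \<K>" by (rule cell_in[of "{Base}"]) (auto simp: pres_cells_def rose_def)
    then show ?thesis using pair[of Base Base] by simp
  qed
  interpret C: two_complex K using simp_K by (simp add: two_complex_def)
  interpret R: rooted_complex K "vertex_point (?e Base)" "?e Base" "?e \<circ> par \<circ> ?d" "rk \<circ> ?d"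
  proof
    show "vertex_point (?e Base) \<in> geometric_realization K" by (rule C.vertex_point_realization[OF base])
    show "{?e Base} \<in> K" by (rule base)
    show "(rk \<circ> ?d) (?e Base) = 0" by (simp add: rk_def)
    fix v assume v: "{v} \<in> K" "v \<noteq> ?e Base"
    then obtain w where w: "v = ?e w" "{w} \<in> \<K>" "w \<noteq> Base" using vertex by blast
    show "{(?e \<circ> par \<circ> ?d) v, v} \<in> K \<and> (rk \<circ> ?d) v = Suc ((rk \<circ> ?d) ((?e \<circ> par \<circ> ?d) v))"
      using par_edge[OF w(2,3)] pair[of "par w" w] by (simp add: w(1))
  qed
  define \<theta> where "\<theta> u v = R.edge_class (?e u) (?e v)" for u v
  have coc: "cocycle \<K> R.\<pi> \<theta>"
    using R.cocycle_edge_class cocycle_image(1)[of ?d ?e \<K> R.\<pi> R.edge_class] unfolding K_def[symmetric] \<theta>_def by simp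
  have tree: "\<theta> (par v) v = \<one>\<^bsub>R.\<pi>\<^esub>" if "{v} \<in> \<K>" "v \<noteq> Base" for v
    using R.edge_class_par[of "?e v"] pair[of v v] that by (simp add: \<theta>_def)
  note rel = relators_trivial[OF R.group_\<pi> coc tree]
  define N where "N = normal_closure ?F (set rs)"
  interpret F: group ?F by (rule group_free_group)
  interpret N: normal N ?F unfolding N_def by (rule F.normal_closure_normal[OF rsF])
  have Q: "group (?F Mod N)" by (rule N.factorgroup_is_group)
  interpret q: group_hom ?F "?F Mod N" "\<lambda>w. N #>\<^bsub>?F\<^esub> w"
    using N.r_coset_hom_Mod Q by (simp add: group_hom_def group_hom_axioms_def group_free_group)
  define g where "g a = N #>\<^bsub>?F\<^esub> [(a, True)]" for a
  have g: "g a \<in> carrier (?F Mod N)" if "a < n" for a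
    unfolding g_def using generator_carrier[of a "{..<n}"] that by (intro q.hom_closed) auto
  have g_rel: "word_val (?F Mod N) g r = \<one>\<^bsub>?F Mod N\<^esub>" if r: "r \<in> set rs" for r
  proof -
    have rF: "r \<in> carrier ?F" using r rsF by auto
    have "word_val (?F Mod N) g r = N #>\<^bsub>?F\<^esub> r"
      using hom_word_val[OF Q q.homh rF] by (simp add: g_def[abs_def])
    also have "\<dots> = \<one>\<^bsub>?F Mod N\<^esub>"
      using F.coset_join2[OF rF N.is_subgroup] F.normal_closure_incl[OF r rsF] by (simp add: N_def FactGroup_def)
    finally show ?thesis .
  qed
  have "cocycle K (?F Mod N) (\<lambda>u v. disc_val (?F Mod N) g rs (?d u) (?d v))"
    unfolding K_def using cocycle_disc_val[OF Q g g_rel] by (subst cocycle_image(2)) auto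
  moreover have "disc_val (?F Mod N) g rs (?d ((?e \<circ> par \<circ> ?d) v)) (?d v) = \<one>\<^bsub>?F Mod N\<^esub>"
    if "{v} \<in> K" "v \<noteq> ?e Base" for v
    using vertex[OF that(1)] that(2) disc_val_par[OF Q, of _ g] by auto
  ultimately obtain \<Phi> where \<Phi>: "\<Phi> \<in> hom R.\<pi> (?F Mod N)"
    "\<And>u v. {u, v} \<in> K \<Longrightarrow> \<Phi> (R.edge_class u v) = disc_val (?F Mod N) g rs (?d u) (?d v)"
    using R.cocycle_hom[OF Q, of "\<lambda>u v. disc_val (?F Mod N) g rs (?d u) (?d v)"] by blast
  have mid: "{Mid a False, Mid a True} \<in> \<K>" if "a < n" for a
    using that by (intro cell_in[of "{Mid a False, Mid a True}"]) (auto simp: pres_cells_def rose_def)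
  have "presents (n, rs) R.\<pi>"
  proof (rule presentsI[where f = "\<lambda>a. \<theta> (Mid a False) (Mid a True)", OF R.group_\<pi> _ rsF])
    show "\<theta> (Mid a False) (Mid a True) \<in> carrier R.\<pi>" if "a < n" for a
      using cocycleD(1)[OF coc mid[OF that]] by auto
    show "word_val R.\<pi> (\<lambda>a. \<theta> (Mid a False) (Mid a True)) r = \<one>\<^bsub>R.\<pi>\<^esub>" if "r \<in> set rs" for r
      by (rule rel(1)[OF _ _ that])
    have "R.edge_class u v \<in> generate R.\<pi> ((\<lambda>a. \<theta> (Mid a False) (Mid a True)) ` {..<n})" if "{u, v} \<in> K" for u v
      using edge[OF that] rel(2) by (auto simp: \<theta>_def)
    then have "R.edge_subgroup \<subseteq> generate R.\<pi> ((\<lambda>a. \<theta> (Mid a False) (Mid a True)) ` {..<n})"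
      using cocycleD(1)[OF coc mid] by (intro R.P.generate_subgroup_incl R.P.generate_is_subgroup) auto
    then show "carrier R.\<pi> \<subseteq> generate R.\<pi> ((\<lambda>a. \<theta> (Mid a False) (Mid a True)) ` {..<n})"
      by (simp add: R.edge_classes_generate)
    show "\<Phi> \<in> hom R.\<pi> (?F Mod normal_closure ?F (set rs))" using \<Phi>(1) by (simp add: N_def)
    show "\<Phi> (\<theta> (Mid a False) (Mid a True)) = normal_closure ?F (set rs) #>\<^bsub>?F\<^esub> [(a, True)]" if "a < n" for a
      using \<Phi>(2)[of "?e (Mid a False)" "?e (Mid a True)"] pair mid[OF that] by (simp add: \<theta>_def g_def N_def)
  qed
  then have "R.\<pi> \<cong> G" using presents_unique P by blast
  then have "complex_has_fundamental_group K G"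
    unfolding complex_has_fundamental_group_def using R.path_connected_realization R.x by blast
  moreover have "card (two_simplices K) + length rs \<le> 6 * presentation_length (n, rs)"
    using card_two_simplices_image[OF inj sK] card_two_simplices_pres_complex[OF ne, of rs n]
    by (simp add: K_def)
  ultimately show ?thesis using that simp_K by blast
qed

section \<open>The two inequalities\<close>

lemma presents_filter:
  assumes "presents (n, rs) G"
  shows "presents (n, filter (\<lambda>r. r \<noteq> []) rs) G"
proof -
  let ?F = "free_group {..<n}" and ?rs = "filter (\<lambda>r. r \<noteq> []) rs"
  interpret F: group ?F by (rule group_free_group)
  have R: "set rs \<subseteq> carrier ?F" "set ?rs \<subseteq> carrier ?F"
    using assms by (auto simp: presents_def Let_def)
  have "r \<in> normal_closure ?F (set ?rs)" if "r \<in> set rs" for r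
  proof (cases "r = []")
    case True
    then have "r = \<one>\<^bsub>?F\<^esub>" by (simp add: free_group_simps)
    then show ?thesis
      using subgroup.one_closed[OF normal_imp_subgroup[OF F.normal_closure_normal[OF R(2)]]] by simp
  next
    case False
    then show ?thesis using that by (intro F.normal_closure_incl[OF _ R(2)]) simp
  qed
  then have "normal_closure ?F (set rs) = normal_closure ?F (set ?rs)"
    using R F.normal_closure_incl[OF _ R(1)] by (intro F.normal_closure_eqI) auto
  then show ?thesis using assms R(2) by (simp add: presents_def Let_def)
qed

lemma presentation_length_filter:
  "presentation_length (n, filter (\<lambda>r. r \<noteq> []) rs) = presentation_length (n, rs)"
  by (induction rs) (simp_all add: presentation_length_def)

theorem proposition2p1:
  fixes G :: "('a, 'b) monoid_scheme"
  assumes "group G" and "finitely_presentable G"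
  shows "1 / 6 * (real (simplicial_complexity G) + real (min_num_relations G))
           \<le> real (c_complexity G) \<and>
         (\<not> is_free_group G \<longrightarrow>
           real (c_complexity G) \<le> 3 * (real (simplicial_complexity G) - 4))"
proof -
  have "\<exists>P. presents P G \<and> presentation_length P = c_complexity G"
    unfolding c_complexity_def using assms(2)[unfolded finitely_presentable_def] by (rule_tac LeastI_ex) blast
  then obtain n rs where P: "presents (n, rs) G" "presentation_length (n, rs) = c_complexity G" by auto
  \<comment> \<open>An empty relator adds nothing to the length, but the bound 6 k - 1 on the
    triangles of its disc would fail for k = 0. The number of remaining relators still bounds
    \<open>min_num_relations G\<close> from above.\<close>
  define rs' where "rs' = filter (\<lambda>r. r \<noteq> []) rs"
  have P': "presents (n, rs') G" "presentation_length (n, rs') = c_complexity G"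
    using presents_filter[OF P(1)] presentation_length_filter[of n rs] P(2) by (simp_all add: rs'_def)
  obtain K :: "nat set set" where K: "simplicial_2_complex K" "complex_has_fundamental_group K G"
    "card (two_simplices K) + length rs' \<le> 6 * c_complexity G"
    using complex_of_presentation[OF assms(1) P'(1)] P'(2) by (auto simp: rs'_def)
  have "simplicial_complexity G \<le> card (two_simplices K)"
    unfolding simplicial_complexity_def using K by (intro Least_le) blast
  moreover have "min_num_relations G \<le> length rs'"
    unfolding min_num_relations_def using P'(1) by (intro Least_le) (auto simp: num_relations_def)
  ultimately have "simplicial_complexity G + min_num_relations G \<le> 6 * c_complexity G"
    using K(3) by linarith
  moreover have "c_complexity G + 12 \<le> 3 * simplicial_complexity G" if "\<not> is_free_group G"
  proof -
    \<comment> \<open>The complex found for the lower bound also witnesses that the minimum in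
      \<open>simplicial_complexity G\<close> is attained, so a minimal complex is available.\<close>
    have "\<exists>K :: nat set set. simplicial_2_complex K \<and> complex_has_fundamental_group K G \<and>
        card (two_simplices K) = simplicial_complexity G"
      unfolding simplicial_complexity_def using K by (rule_tac LeastI_ex) blast
    then show ?thesis using c_complexity_upper[OF assms(1) that] by blast
  qed
  ultimately show ?thesis by (auto simp: of_nat_add[symmetric] simp del: of_nat_add)
qed

end
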